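(* For each $N\in\mathbb{N}$, let $f_N(0)$ be an initial probability density on $\mathcal{D}_N$ (hard spheres of unit diameter in $\mathbb{R}^d$), symmetric under particle interchange, and let $f_N(t,Z_N)=f_N(0,\psi_N^{-t}Z_N)$. Let $f_N^{(s)}(t)$, $1\le s\le N$, denote the $s$-marginal of $f_N(t)$. Further assume that $f_N(0)$ is smooth and compactly supported in the interior of $\mathcal{D}_N$. Then for all $2\le s\le N$, $$\sum_{1\le i<j\le s}\int_{-\infty}^{\infty}\int_{\mathbb{R}^{ds}\times\mathbb{R}^{d(s-1)}\times\mathbb{S}^{d-1}}\left|\omega\cdot(v_j-v_i)\right|^2 f_N^{(s)}(t,\dots,x_i,v_i,\dots,x_i+\omega,v_j,\dots)\,d\omega\,dX_s^{(j)}\,dV_s\,dt$$ $$\le\ C_d\,\frac{s(s-1)}{N}\left(\int|x|^2f_N^{(1)}(0,x,v)\,dx\,dv\right)^{1/2}\left(\int|v|^2f_N^{(1)}(0,x,v)\,dx\,dv\right)^{1/2},$$ where in the $(i,j)$ term $f_N^{(s)}(t,\cdot)$ is evaluated with $x_j=x_i+\omega$, where $dX_s^{(j)}=dx_1\cdots dx_{j-1}\,dx_{j+1}\cdots dx_s$, $dV_s=dv_1\cdots dv_s$, and where $C_d$ is a constant depending only on the dimension $d$.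
   Context: Phase space: points are $Z_N=(z_1,\dots,z_N)=(X_N,V_N)\in\mathbb{R}^{2dN}$, with $z_i=(x_i,v_i)$, $X_N=(x_1,\dots,x_N)$ the positions and $V_N=(v_1,\dots,v_N)$ the velocities, $x_i,v_i\in\mathbb{R}^d$. For hard spheres of unit diameter, $$\mathcal{D}_N=\{Z_N\in\mathbb{R}^{2dN}:\ |x_i-x_j|>1\ \ \forall\,1\le i<j\le N\}.$$ Hard sphere flow: $\psi_N^t$ ($t\in\mathbb{R}$) is the hard sphere flow, defined for almost every $Z_N\in\mathcal{D}_N$. Between collisions $\dot X_N=V_N$, $\dot V_N=0$. When particles $i<j$ collide, with $x_j=x_i+\omega$, $\omega\in\mathbb{S}^{d-1}$ (and no other pair in contact), the positions are continuous in time and the velocities $v_i,v_j$ just before the collision jump to $$v_i^*=v_i+\omega\,\big(\omega\cdot(v_j-v_i)\big),\qquad v_j^*=v_j-\omega\,\big(\omega\cdot(v_j-v_i)\big)$$ just after it, all other velocities being unchanged. Simultaneous collisions of more than two particles occur only for a null set of initial data. For every $t$ the map $\psi_N^t$ preserves Lebesgue measure on $\mathcal{D}_N$. Symmetry under particle interchange: $f_N(0,z_{\sigma(1)},\dots,z_{\sigma(N)})=f_N(0,z_1,\dots,z_N)$ for every permutation $\sigma$ of $\{1,\dots,N\}$. Marginals: $f_N(t)$ is extended by zero to $\mathbb{R}^{2dN}$, and for $1\le s\le N$, $f_N^{(s)}(t,Z_s)=\int_{\mathbb{R}^{2d(N-s)}}f_N(t,Z_N)\,dz_{s+1}\cdots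 dz_N$. Traces: on the left-hand side, the values of $f_N^{(s)}(t,\cdot)$ on the hypersurface $x_j=x_i+\omega$, $|\omega|=1$, are understood as boundary traces (taken from inside the region $|x_i-x_j|>1$). For $f_N(0)$ smooth and compactly supported in $\mathcal{D}_N$ these traces are known to exist for almost every $t\in\mathbb{R}$. Here $d\omega$ is the surface measure on $\mathbb{S}^{d-1}$. *)

theory Defs
  imports "HOL-Analysis.Analysis"
begin

text \<open>
  The space \<open>\<real>\<^sup>d\<close> is a type \<open>'a\<close> of class \<open>euclidean_space\<close>, so that \<open>d = DIM('a)\<close>. Because the
  number of particles varies inside the statement, a point of \<open>\<real>\<^bsup>2dN\<^esup>\<close> is a function
  \<open>Z :: nat \<Rightarrow> 'a \<times> 'a\<close> in \<open>extensional {1..N}\<close>, with \<open>Z k = (x\<^sub>k, v\<^sub>k)\<close>. Topological notions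
  refer to the product topology on \<open>nat \<Rightarrow> 'a \<times> 'a\<close>, which induces the Euclidean topology
  on \<open>extensional {1..N}\<close>.
\<close>

definition phase_measure :: "nat \<Rightarrow> (nat \<Rightarrow> 'a::euclidean_space \<times> 'a) measure" where
  "phase_measure N = (\<Pi>\<^sub>M k\<in>{1..N}. lborel)"

definition hs_domain :: "nat \<Rightarrow> (nat \<Rightarrow> 'a::euclidean_space \<times> 'a) set" where
  "hs_domain N = {Z \<in> extensional {1..N}.
     \<forall>i j. 1 \<le> i \<and> i < j \<and> j \<le> N \<longrightarrow> norm (fst (Z i) - fst (Z j)) > 1}"

definition contacts :: "nat \<Rightarrow> (nat \<Rightarrow> 'a::euclidean_space \<times> 'a) \<Rightarrow> (nat \<times> nat) set" where
  "contacts N Z = {(i, j). 1 \<le> i \<and> i < j \<and> j \<le> N \<and> norm (fst (Z i) - fst (Z j)) = 1}"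

text \<open>The velocities just after a collision of \<open>i\<close> and \<open>j\<close> with \<open>x\<^sub>j = x\<^sub>i + \<omega>\<close>, in terms of the
  velocities \<open>U\<close> just before it.\<close>

definition scatter ::
    "nat \<Rightarrow> nat \<Rightarrow> 'a::euclidean_space \<Rightarrow> (nat \<Rightarrow> 'a) \<Rightarrow> nat \<Rightarrow> 'a" where
  "scatter i j \<omega> U = U(i := U i + (\<omega> \<bullet> (U j - U i)) *\<^sub>R \<omega>, j := U j - (\<omega> \<bullet> (U j - U i)) *\<^sub>R \<omega>)"

text \<open>Collision times do not accumulate, and all collisions are binary. At the instant of a collision
  only the one-sided limits of the velocities of the two colliding particles are prescribed.\<close>

definition hs_trajectory :: "nat \<Rightarrow> (real \<Rightarrow> nat \<Rightarrow> 'a::euclidean_space \<times> 'a) \<Rightarrow> bool" where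
  "hs_trajectory N \<gamma> \<longleftrightarrow>
     (\<forall>k\<in>{1..N}. continuous_on UNIV (\<lambda>t. fst (\<gamma> t k))) \<and>
     (\<forall>t i j. 1 \<le> i \<and> i < j \<and> j \<le> N \<longrightarrow> norm (fst (\<gamma> t i) - fst (\<gamma> t j)) \<ge> 1) \<and>
     (\<forall>a b. finite {t \<in> {a..b}. contacts N (\<gamma> t) \<noteq> {}}) \<and>
     (\<forall>t. contacts N (\<gamma> t) = {} \<longrightarrow>
        (\<forall>k\<in>{1..N}. ((\<lambda>\<tau>. fst (\<gamma> \<tau> k)) has_vector_derivative snd (\<gamma> t k)) (at t) \<and>
                     ((\<lambda>\<tau>. snd (\<gamma> \<tau> k)) has_vector_derivative 0) (at t))) \<and>
     (\<forall>t. contacts N (\<gamma> t) \<noteq> {} \<longrightarrow>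
        (\<exists>i j U. contacts N (\<gamma> t) = {(i, j)} \<and>
           (\<forall>k\<in>{1..N}. ((\<lambda>\<tau>. snd (\<gamma> \<tau> k)) \<longlongrightarrow> U k) (at_left t) \<and>
                        ((\<lambda>\<tau>. snd (\<gamma> \<tau> k)) \<longlongrightarrow>
                           scatter i j (fst (\<gamma> t j) - fst (\<gamma> t i)) U k) (at_right t)) \<and>
           (\<forall>k\<in>{1..N} - {i, j}. snd (\<gamma> t k) = U k)))"

text \<open>The hard sphere flow is determined up to null sets only. The three clauses characterise its
  versions: Borel measurability, preservation of Lebesgue measure on the domain, and, for almost
  every initial datum, the equations of motion for all times.\<close>

definition hard_sphere_flow ::
    "nat \<Rightarrow> (real \<Rightarrow> (nat \<Rightarrow> 'a::euclidean_space \<times> 'a) \<Rightarrow> nat \<Rightarrow> 'a \<times> 'a) \<Rightarrow> bool" where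
  "hard_sphere_flow N \<psi> \<longleftrightarrow>
     (\<forall>t. \<psi> t \<in> measurable (phase_measure N) (phase_measure N)) \<and>
     (\<forall>t. \<forall>A\<in>sets (phase_measure N). A \<subseteq> hs_domain N \<longrightarrow>
        emeasure (phase_measure N) (\<psi> t -` A \<inter> hs_domain N) = emeasure (phase_measure N) A) \<and>
     (AE Z in phase_measure N. Z \<in> hs_domain N \<longrightarrow>
        \<psi> 0 Z = Z \<and> hs_trajectory N (\<lambda>t. \<psi> t Z))"

text \<open>\<open>C\<^sup>\<infinity>\<close> on a relatively open subset \<open>S\<close> of \<open>extensional {1..N}\<close>: all iterated partial
  derivatives exist and are continuous on \<open>S\<close>.\<close>

coinductive smooth_on ::
    "nat \<Rightarrow> (nat \<Rightarrow> 'a::euclidean_space \<times> 'a) set \<Rightarrow> ((nat \<Rightarrow> 'a \<times> 'a) \<Rightarrow> real) \<Rightarrow> bool"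
  for N S where
  "continuous_on S f \<Longrightarrow>
   (\<And>k b. k \<in> {1..N} \<Longrightarrow> b \<in> Basis \<Longrightarrow>
      \<exists>g. smooth_on N S g \<and>
        (\<forall>Z\<in>S. ((\<lambda>h. f (Z(k := Z k + h *\<^sub>R b))) has_real_derivative g Z) (at 0))) \<Longrightarrow>
   smooth_on N S f"

text \<open>Here \<open>f\<close> is already the extension by zero of a density on \<open>hs_domain N\<close>.\<close>

definition hs_initial_density ::
    "nat \<Rightarrow> ((nat \<Rightarrow> 'a::euclidean_space \<times> 'a) \<Rightarrow> real) \<Rightarrow> bool" where
  "hs_initial_density N f \<longleftrightarrow>
     (\<forall>Z\<in>extensional {1..N}. 0 \<le> f Z) \<and>
     has_bochner_integral (phase_measure N) f 1 \<and>
     (\<forall>\<sigma>. \<sigma> permutes {1..N} \<longrightarrow> (\<forall>Z\<in>extensional {1..N}. f (Z \<circ> \<sigma>) = f Z)) \<and>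
     smooth_on N (hs_domain N) f \<and>
     (\<exists>K. compact K \<and> K \<subseteq> hs_domain N \<and> (\<forall>Z\<in>extensional {1..N} - K. f Z = 0))"

definition evolve ::
    "nat \<Rightarrow> (real \<Rightarrow> (nat \<Rightarrow> 'a::euclidean_space \<times> 'a) \<Rightarrow> nat \<Rightarrow> 'a \<times> 'a) \<Rightarrow>
     ((nat \<Rightarrow> 'a \<times> 'a) \<Rightarrow> real) \<Rightarrow> real \<Rightarrow> (nat \<Rightarrow> 'a \<times> 'a) \<Rightarrow> real" where
  "evolve N \<psi> f0 t Z = (if Z \<in> hs_domain N then f0 (\<psi> (- t) Z) else 0)"

definition marginal ::
    "nat \<Rightarrow> nat \<Rightarrow> ((nat \<Rightarrow> 'a::euclidean_space \<times> 'a) \<Rightarrow> real) \<Rightarrow> (nat \<Rightarrow> 'a \<times> 'a) \<Rightarrow> real" where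
  "marginal N s F Z = (LINT Y|(\<Pi>\<^sub>M k\<in>{s+1..N}. lborel). F (merge {1..s} {s+1..N} (Z, Y)))"

text \<open>The surface measure on the unit sphere, extended by zero to \<open>'a\<close>, from polar coordinates:
  \<open>d\<close> times the volume of the part of the unit ball lying in the cone over the set.\<close>

definition sphere_measure :: "'a::euclidean_space measure" where
  "sphere_measure =
     scale_measure (of_nat DIM('a)) (distr (restrict_space lborel (ball 0 1 - {0})) borel sgn)"

text \<open>The point of \<open>\<real>\<^bsup>2ds\<^esup>\<close> with positions \<open>X\<close>, except that \<open>x\<^sub>j = x\<^sub>i + r \<omega>\<close>, and velocities \<open>V\<close>.\<close>

definition pair_config ::
    "nat \<Rightarrow> nat \<Rightarrow> nat \<Rightarrow> (nat \<Rightarrow> 'a::euclidean_space) \<Rightarrow> (nat \<Rightarrow> 'a) \<Rightarrow> 'a \<Rightarrow> real \<Rightarrow>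
     nat \<Rightarrow> 'a \<times> 'a" where
  "pair_config s i j X V \<omega> r = (\<lambda>k\<in>{1..s}. (if k = j then X i + r *\<^sub>R \<omega> else X k, V k))"

text \<open>Boundary value at \<open>x\<^sub>j = x\<^sub>i + \<omega>\<close>, from the side \<open>\<bar>x\<^sub>i - x\<^sub>j\<bar> > 1\<close>. The marginals are determined
  almost everywhere only, so the limit is taken in the mean along the normal; a change of \<open>F\<close> on a
  null set then affects the traces only on a null set of the boundary, and where the one-sided limit
  of \<open>F\<close> exists, it is the trace.\<close>

definition has_trace ::
    "((nat \<Rightarrow> 'a::euclidean_space \<times> 'a) \<Rightarrow> real) \<Rightarrow> nat \<Rightarrow> nat \<Rightarrow> nat \<Rightarrow>
     (nat \<Rightarrow> 'a) \<Rightarrow> (nat \<Rightarrow> 'a) \<Rightarrow> 'a \<Rightarrow> real \<Rightarrow> bool" where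
  "has_trace F s i j X V \<omega> g \<longleftrightarrow>
     ((\<lambda>\<delta>. (\<integral>\<^sup>+r\<in>{1<..<1 + \<delta>}. ennreal \<bar>F (pair_config s i j X V \<omega> r) - g\<bar> \<partial>lborel) / ennreal \<delta>)
        \<longlongrightarrow> 0) (at_right 0)"

text \<open>For the marginals in question, a trace exists for almost every time at almost every boundary
  point, so the value \<open>0\<close> in the remaining case is immaterial.\<close>

definition boundary_trace ::
    "((nat \<Rightarrow> 'a::euclidean_space \<times> 'a) \<Rightarrow> real) \<Rightarrow> nat \<Rightarrow> nat \<Rightarrow> nat \<Rightarrow>
     (nat \<Rightarrow> 'a) \<Rightarrow> (nat \<Rightarrow> 'a) \<Rightarrow> 'a \<Rightarrow> real" where
  "boundary_trace F s i j X V \<omega> =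
     (if \<exists>g. has_trace F s i j X V \<omega> g then THE g. has_trace F s i j X V \<omega> g else 0)"

end

(*
  Let A(t) = X.V - t |V|^2. It is constant along free flight and jumps at a collision by the impact
  speed |omega . (v_j - v_i)|. Moreover |X - t V|^2 is constant along free flight and jumps by
  -2 t |omega . (v_j - v_i)|, so it is largest at t = 0; as A = (X - t V).V, |A(t)| is at most
  |X(0)| |V(0)|, and the impact speeds along a trajectory sum up to at most 2 |X(0)| |V(0)|.

  The trace is a limit of averages over 1 < |x_j - x_i| < 1 + delta. By Fatou's lemma, polar
  coordinates and the change of variables given by the flow, the left-hand side is bounded by a
  lower limit of expectations, under the initial density, of the time integrals of
  |omega . (v_j - v_i)|^2 / delta over the part of the trajectory spent in that shell. To bound
  these uniformly in delta, and by a multiple of the impact speeds as delta tends to 0, one adds to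
  A the sum of k(|x_j - x_i|) times the radial velocities, with k rising from -1 at contact to 0
  across the shell. Symmetry under particle interchange and the Cauchy-Schwarz inequality give the
  claim.
*)

theory Submission
  imports Defs
begin

text \<open>Two obstacles shape the proof. First, \<open>hard_sphere_flow\<close> provides neither a
  group law nor equivariance under relabelling. Both are derived almost everywhere from uniqueness
  of trajectories, and only at times without contact, since the velocities of a colliding pair are
  not prescribed at the instant of collision. Second, the flow is measurable for each fixed time
  only, so integrals over time and phase space are interchanged for a sampled version of it.

  The passage \<open>d\<close> to 0 needs two estimates along a trajectory: a crude one, uniform in
  \<open>d\<close>, which by compact support of the density dominates in the reverse Fatou lemma,
  and a sharp one for the upper limit.

  Origin of 32: the weight \<open>1 / d\<close> of the shell against a slope of at least
  \<open>1 / (2 * d)\<close> costs a factor 2. For small \<open>d\<close> the radial sum over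
  ordered pairs drops by at most 4 times the impact speed, so A is taken 4 times, and A varies by at
  most twice \<open>|X(0)| |V(0)|\<close>. This gives 16. Symmetry divides by
  \<open>N * (N - 1)\<close>, the moments contribute \<open>N\<close>, and
  \<open>16 / (N - 1)\<close> is at most \<open>32 / N\<close>.\<close>

section \<open>Functions with jumps\<close>

text \<open>The fundamental theorem of calculus on the pieces between jumps telescopes to
  \<open>q - p\<close> minus the sum of the jumps \<open>r - l\<close>, which are nonnegative.
  Points of \<open>F\<close> outside the interval are allowed, so that the induction can use the
  same set on both sides of a jump.\<close>

lemma has_integral_jumps_le:
  fixes f f' :: "real \<Rightarrow> real"
  assumes "finite F" "a < b"
    and "\<And>t. a < t \<Longrightarrow> t < b \<Longrightarrow> t \<notin> F \<Longrightarrow> (f has_real_derivative f' t) (at t)"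
    and "\<And>t. t \<in> F \<Longrightarrow> a < t \<Longrightarrow> t < b \<Longrightarrow>
          \<exists>l r. (f \<longlongrightarrow> l) (at_left t) \<and> (f \<longlongrightarrow> r) (at_right t) \<and> l \<le> r"
    and "(f \<longlongrightarrow> p) (at_right a)" "(f \<longlongrightarrow> q) (at_left b)"
  shows "\<exists>I. (f' has_integral I) {a..b} \<and> I \<le> q - p"
  using assms
proof (induction F arbitrary: a b p q rule: finite_induct)
  case empty
  \<comment> \<open>\<open>f\<close> is unconstrained at the endpoints; its one-sided limits are put
    there to obtain continuity on the closed interval.\<close>
  define g where "g t = (if t = a then p else if t = b then q else f t)" for t
  have ga: "(g \<longlongrightarrow> p) (at_right a)"
    by (rule Lim_transform_eventually[OF empty.prems(4)])
       (use empty.prems(1) in \<open>auto simp: g_def eventually_at_right intro!: exI[of _ b]\<close>)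
  have gb: "(g \<longlongrightarrow> q) (at_left b)"
    by (rule Lim_transform_eventually[OF empty.prems(5)])
       (use empty.prems(1) in \<open>auto simp: g_def eventually_at_left intro!: exI[of _ a]\<close>)
  have der: "(g has_real_derivative f' t) (at t)" if "a < t" "t < b" for t
  proof (rule has_field_derivative_transform_within_open[of f])
    show "(f has_real_derivative f' t) (at t)" using empty.prems(2) that by auto
    show "open {a<..<b}" "t \<in> {a<..<b}" using that by auto
    show "\<And>x. x \<in> {a<..<b} \<Longrightarrow> f x = g x" by (auto simp: g_def)
  qed
  have "continuous_on {a..b} g"
    unfolding continuous_on_def
  proof
    fix t assume t: "t \<in> {a..b}"
    consider "t = a" | "t = b" | "a < t" "t < b" using t by force
    then show "(g \<longlongrightarrow> g t) (at t within {a..b})"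
    proof cases
      case 1
      then show ?thesis using ga empty.prems(1) by (simp add: at_within_Icc_at_right g_def)
    next
      case 2
      then show ?thesis using gb empty.prems(1) by (simp add: at_within_Icc_at_left g_def)
    next
      case 3
      then show ?thesis using DERIV_isCont[OF der]
        by (simp add: isCont_def Lim_at_imp_Lim_at_within)
    qed
  qed
  then have "(f' has_integral (g b - g a)) {a..b}"
    using der empty.prems(1)
    by (intro fundamental_theorem_of_calculus_interior)
       (auto simp: has_real_derivative_iff_has_vector_derivative)
  then show ?case using empty.prems(1) by (auto simp: g_def)
next
  case (insert x F)
  show ?case
  proof (cases "a < x \<and> x < b")
    case False
    then show ?thesis
      using insert.prems by (intro insert.IH) auto
  next
    case True
    then obtain l r where lr: "(f \<longlongrightarrow> l) (at_left x)" "(f \<longlongrightarrow> r) (at_right x)" "l \<le> r"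
      using insert.prems(3)[of x] by auto
    have "\<exists>I. (f' has_integral I) {a..x} \<and> I \<le> l - p"
      using insert.prems True lr by (intro insert.IH) auto
    moreover have "\<exists>I. (f' has_integral I) {x..b} \<and> I \<le> q - r"
      using insert.prems True lr by (intro insert.IH) auto
    ultimately obtain I J where IJ: "(f' has_integral I) {a..x}" "(f' has_integral J) {x..b}"
      "I \<le> l - p" "J \<le> q - r" by auto
    then have "(f' has_integral (I + J)) {a..b}"
      using True by (intro has_integral_combine[of a x b]) auto
    then show ?thesis using IJ(3,4) lr(3) by (intro exI[of _ "I + J"]) auto
  qed
qed

section \<open>Hard sphere trajectories and their uniqueness\<close>

definition touching :: "nat \<Rightarrow> (nat \<Rightarrow> 'a::euclidean_space \<times> 'a) \<Rightarrow> bool" where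
  "touching N Z \<longleftrightarrow> (\<exists>i\<in>{1..N}. \<exists>j\<in>{1..N}. i \<noteq> j \<and> norm (fst (Z j) - fst (Z i)) = 1)"

text \<open>Unlike \<open>hs_trajectory\<close>, this form does not refer to the order of the indices, which makes its
  invariance under permutations and time reversal evident; it says nothing about the velocities at
  the instant of a collision.\<close>

definition billiard :: "nat \<Rightarrow> (real \<Rightarrow> nat \<Rightarrow> 'a::euclidean_space \<times> 'a) \<Rightarrow> bool" where
  "billiard N \<gamma> \<longleftrightarrow>
     (\<forall>k\<in>{1..N}. continuous_on UNIV (\<lambda>t. fst (\<gamma> t k))) \<and>
     (\<forall>t. \<forall>i\<in>{1..N}. \<forall>j\<in>{1..N}. i \<noteq> j \<longrightarrow> 1 \<le> norm (fst (\<gamma> t j) - fst (\<gamma> t i))) \<and>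
     (\<forall>a b. finite {t \<in> {a..b}. touching N (\<gamma> t)}) \<and>
     (\<forall>t. \<not> touching N (\<gamma> t) \<longrightarrow>
        (\<forall>k\<in>{1..N}. ((\<lambda>\<tau>. fst (\<gamma> \<tau> k)) has_vector_derivative snd (\<gamma> t k)) (at t) \<and>
                     ((\<lambda>\<tau>. snd (\<gamma> \<tau> k)) has_vector_derivative 0) (at t))) \<and>
     (\<forall>t. touching N (\<gamma> t) \<longrightarrow>
        (\<exists>i\<in>{1..N}. \<exists>j\<in>{1..N}. i \<noteq> j \<and> norm (fst (\<gamma> t j) - fst (\<gamma> t i)) = 1 \<and>
           (\<forall>a\<in>{1..N}. \<forall>b\<in>{1..N}. a \<noteq> b \<longrightarrow> norm (fst (\<gamma> t b) - fst (\<gamma> t a)) = 1 \<longrightarrow>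
              (a = i \<and> b = j \<or> a = j \<and> b = i)) \<and>
           (\<exists>U. \<forall>k\<in>{1..N}. ((\<lambda>\<tau>. snd (\<gamma> \<tau> k)) \<longlongrightarrow> U k) (at_left t) \<and>
                 ((\<lambda>\<tau>. snd (\<gamma> \<tau> k)) \<longlongrightarrow>
                    scatter i j (fst (\<gamma> t j) - fst (\<gamma> t i)) U k) (at_right t))))"

lemma billiardD:
  assumes "billiard N \<gamma>"
  shows "k \<in> {1..N} \<Longrightarrow> continuous_on UNIV (\<lambda>t. fst (\<gamma> t k))"
    and "i \<in> {1..N} \<Longrightarrow> j \<in> {1..N} \<Longrightarrow> i \<noteq> j \<Longrightarrow> 1 \<le> norm (fst (\<gamma> t j) - fst (\<gamma> t i))"
    and "finite {t \<in> {a..b}. touching N (\<gamma> t)}"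
    and "\<not> touching N (\<gamma> t) \<Longrightarrow> k \<in> {1..N} \<Longrightarrow>
          ((\<lambda>\<tau>. fst (\<gamma> \<tau> k)) has_vector_derivative snd (\<gamma> t k)) (at t)"
    and "\<not> touching N (\<gamma> t) \<Longrightarrow> k \<in> {1..N} \<Longrightarrow>
          ((\<lambda>\<tau>. snd (\<gamma> \<tau> k)) has_vector_derivative 0) (at t)"
  using assms unfolding billiard_def by simp_all

lemma billiard_collision:
  assumes "billiard N \<gamma>" "touching N (\<gamma> t)"
  obtains i j U where "i \<in> {1..N}" "j \<in> {1..N}" "i \<noteq> j" "norm (fst (\<gamma> t j) - fst (\<gamma> t i)) = 1"
    "\<And>a b. a \<in> {1..N} \<Longrightarrow> b \<in> {1..N} \<Longrightarrow> a \<noteq> b \<Longrightarrow> norm (fst (\<gamma> t b) - fst (\<gamma> t a)) = 1 \<Longrightarrow>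
       (a = i \<and> b = j \<or> a = j \<and> b = i)"
    "\<And>k. k \<in> {1..N} \<Longrightarrow> ((\<lambda>\<tau>. snd (\<gamma> \<tau> k)) \<longlongrightarrow> U k) (at_left t)"
    "\<And>k. k \<in> {1..N} \<Longrightarrow> ((\<lambda>\<tau>. snd (\<gamma> \<tau> k)) \<longlongrightarrow>
       scatter i j (fst (\<gamma> t j) - fst (\<gamma> t i)) U k) (at_right t)"
proof -
  have "\<exists>i\<in>{1..N}. \<exists>j\<in>{1..N}. i \<noteq> j \<and> norm (fst (\<gamma> t j) - fst (\<gamma> t i)) = 1 \<and>
           (\<forall>a\<in>{1..N}. \<forall>b\<in>{1..N}. a \<noteq> b \<longrightarrow> norm (fst (\<gamma> t b) - fst (\<gamma> t a)) = 1 \<longrightarrow>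
              (a = i \<and> b = j \<or> a = j \<and> b = i)) \<and>
           (\<exists>U. \<forall>k\<in>{1..N}. ((\<lambda>\<tau>. snd (\<gamma> \<tau> k)) \<longlongrightarrow> U k) (at_left t) \<and>
                 ((\<lambda>\<tau>. snd (\<gamma> \<tau> k)) \<longlongrightarrow>
                    scatter i j (fst (\<gamma> t j) - fst (\<gamma> t i)) U k) (at_right t))"
    using assms unfolding billiard_def by blast
  then obtain i j where "i \<in> {1..N}" "j \<in> {1..N}" "i \<noteq> j" "norm (fst (\<gamma> t j) - fst (\<gamma> t i)) = 1"
    and u: "\<forall>a\<in>{1..N}. \<forall>b\<in>{1..N}. a \<noteq> b \<longrightarrow>
       norm (fst (\<gamma> t b) - fst (\<gamma> t a)) = 1 \<longrightarrow> (a = i \<and> b = j \<or> a = j \<and> b = i)"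
    and "\<exists>U. \<forall>k\<in>{1..N}. ((\<lambda>\<tau>. snd (\<gamma> \<tau> k)) \<longlongrightarrow> U k) (at_left t) \<and>
       ((\<lambda>\<tau>. snd (\<gamma> \<tau> k)) \<longlongrightarrow>
          scatter i j (fst (\<gamma> t j) - fst (\<gamma> t i)) U k) (at_right t)"
    by (elim bexE conjE) assumption
  moreover from this obtain U where
    U: "\<forall>k\<in>{1..N}. ((\<lambda>\<tau>. snd (\<gamma> \<tau> k)) \<longlongrightarrow> U k) (at_left t) \<and>
       ((\<lambda>\<tau>. snd (\<gamma> \<tau> k)) \<longlongrightarrow>
          scatter i j (fst (\<gamma> t j) - fst (\<gamma> t i)) U k) (at_right t)" by (elim exE)
  ultimately show ?thesis by (intro that[of i j U]) (use u U in \<open>(assumption | blast)+\<close>)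
qed

lemma touching_iff_contacts: "touching N Z \<longleftrightarrow> contacts N Z \<noteq> {}"
proof
  assume "touching N Z"
  then obtain i j where ij: "i \<in> {1..N}" "j \<in> {1..N}" "i \<noteq> j" "norm (fst (Z j) - fst (Z i)) = 1"
    by (auto simp: touching_def)
  then have "(min i j, max i j) \<in> contacts N Z"
    by (auto simp: contacts_def min_def max_def norm_minus_commute)
  then show "contacts N Z \<noteq> {}" by blast
next
  assume "contacts N Z \<noteq> {}"
  then obtain i j where "1 \<le> i" "i < j" "j \<le> N" "norm (fst (Z i) - fst (Z j)) = 1"
    by (auto simp: contacts_def)
  then show "touching N Z" unfolding touching_def
    by (intro bexI[of _ i] bexI[of _ j]) (auto simp: norm_minus_commute)
qed

lemma billiard_of_hs_trajectory:
  assumes "hs_trajectory N \<gamma>"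
  shows "billiard N \<gamma>"
proof -
  have ct: "contacts N Z = {} \<longleftrightarrow> \<not> touching N Z" for Z :: "nat \<Rightarrow> 'a \<times> 'a"
    by (simp add: touching_iff_contacts)
  note h = assms[unfolded hs_trajectory_def ct not_not]
  have sep: "1 \<le> norm (fst (\<gamma> t j) - fst (\<gamma> t i))" if "i \<in> {1..N}" "j \<in> {1..N}" "i \<noteq> j" for t i j
  proof -
    have "norm (fst (\<gamma> t a) - fst (\<gamma> t b)) \<ge> 1" if "1 \<le> a" "a < b" "b \<le> N" for a b
      using h that by blast
    from this[of i j] this[of j i] that show ?thesis
      by (cases "i < j") (simp_all add: norm_minus_commute)
  qed
  have col: "\<exists>i\<in>{1..N}. \<exists>j\<in>{1..N}. i \<noteq> j \<and> norm (fst (\<gamma> t j) - fst (\<gamma> t i)) = 1 \<and>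
           (\<forall>a\<in>{1..N}. \<forall>b\<in>{1..N}. a \<noteq> b \<longrightarrow> norm (fst (\<gamma> t b) - fst (\<gamma> t a)) = 1 \<longrightarrow>
              (a = i \<and> b = j \<or> a = j \<and> b = i)) \<and>
           (\<exists>U. \<forall>k\<in>{1..N}. ((\<lambda>\<tau>. snd (\<gamma> \<tau> k)) \<longlongrightarrow> U k) (at_left t) \<and>
                 ((\<lambda>\<tau>. snd (\<gamma> \<tau> k)) \<longlongrightarrow>
                    scatter i j (fst (\<gamma> t j) - fst (\<gamma> t i)) U k) (at_right t))"
    if tch: "touching N (\<gamma> t)" for t
  proof -
    obtain i j U where c: "contacts N (\<gamma> t) = {(i, j)}" and
      U: "\<forall>k\<in>{1..N}. ((\<lambda>\<tau>. snd (\<gamma> \<tau> k)) \<longlongrightarrow> U k) (at_left t) \<and>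
                        ((\<lambda>\<tau>. snd (\<gamma> \<tau> k)) \<longlongrightarrow>
                           scatter i j (fst (\<gamma> t j) - fst (\<gamma> t i)) U k) (at_right t)"
      using h tch by blast
    have "(i, j) \<in> contacts N (\<gamma> t)" using c by simp
    then have ij: "1 \<le> i" "i < j" "j \<le> N" "norm (fst (\<gamma> t i) - fst (\<gamma> t j)) = 1"
      by (auto simp: contacts_def)
    have "(a = i \<and> b = j \<or> a = j \<and> b = i)"
      if "a \<in> {1..N}" "b \<in> {1..N}" "a \<noteq> b" "norm (fst (\<gamma> t b) - fst (\<gamma> t a)) = 1" for a b
    proof -
      have "(a, b) \<in> contacts N (\<gamma> t) \<or> (b, a) \<in> contacts N (\<gamma> t)"
        using that by (cases "a < b") (simp_all add: contacts_def norm_minus_commute)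
      then show ?thesis using c by auto
    qed
    then show ?thesis using ij U
      by (intro bexI[of _ i] bexI[of _ j] conjI ballI impI exI[of _ U])
        (simp_all add: norm_minus_commute)
  qed
  show ?thesis
    unfolding billiard_def
  proof (intro conjI)
    show "\<forall>t. \<forall>i\<in>{1..N}. \<forall>j\<in>{1..N}. i \<noteq> j \<longrightarrow> 1 \<le> norm (fst (\<gamma> t j) - fst (\<gamma> t i))"
      using sep by simp
    show "\<forall>k\<in>{1..N}. continuous_on UNIV (\<lambda>t. fst (\<gamma> t k))" using h by blast
    show "\<forall>a b. finite {t \<in> {a..b}. touching N (\<gamma> t)}" using h by blast
    show "\<forall>t. \<not> touching N (\<gamma> t) \<longrightarrow>
      (\<forall>k\<in>{1..N}. ((\<lambda>\<tau>. fst (\<gamma> \<tau> k)) has_vector_derivative snd (\<gamma> t k)) (at t) \<and>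
                    ((\<lambda>\<tau>. snd (\<gamma> \<tau> k)) has_vector_derivative 0) (at t))" using h by blast
  qed (use col in blast)
qed

section \<open>Symmetries of the dynamics: relabelling, time shift and time reversal\<close>

lemma touching_comp:
  assumes "\<sigma> permutes {1..N}"
  shows "touching N (Z \<circ> \<sigma>) \<longleftrightarrow> touching N Z"
proof -
  have *: "touching N (Z \<circ> \<sigma>) \<Longrightarrow> touching N Z" if "\<sigma> permutes {1..N}" for Z :: "nat \<Rightarrow> 'a \<times> 'a" and \<sigma>
  proof -
    assume "touching N (Z \<circ> \<sigma>)"
    then obtain i j where "i \<in> {1..N}" "j \<in> {1..N}" "i \<noteq> j" "norm (fst (Z (\<sigma> j)) - fst (Z (\<sigma> i))) = 1"
      by (auto simp: touching_def)
    then show "touching N Z" unfolding touching_def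
      using permutes_in_image[OF that] permutes_inj[OF that]
      by (intro bexI[of _ "\<sigma> i"] bexI[of _ "\<sigma> j"]) (auto dest: injD)
  qed
  show ?thesis
    using *[OF assms, of Z] *[OF permutes_inv[OF assms], of "Z \<circ> \<sigma>"]
    by (auto simp: comp_assoc permutes_inv_o[OF assms])
qed

lemma billiard_permute:
  assumes "billiard N \<gamma>" and \<sigma>: "\<sigma> permutes {1..N}"
  shows "billiard N (\<lambda>t. \<gamma> t \<circ> \<sigma>)"
proof -
  note im = permutes_in_image[OF \<sigma>]
  note inj = permutes_inj[OF \<sigma>]
  \<comment> \<open>Index \<open>k\<close> of the relabelled trajectory shows particle
    \<open>\<sigma> k\<close>, so a collision of \<open>i\<close> and \<open>j\<close> is seen at
    the indices \<open>\<rho> i\<close> and \<open>\<rho> j\<close>, with incoming velocities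
    \<open>U \<circ> \<sigma>\<close>.\<close>
  define \<rho> where "\<rho> = inv \<sigma>"
  have \<rho>: "\<rho> permutes {1..N}" unfolding \<rho>_def using permutes_inv[OF \<sigma>] .
  have \<sigma>\<rho>: "\<sigma> (\<rho> x) = x" "\<rho> (\<sigma> x) = x" for x
    using permutes_inverses[OF \<sigma>] by (auto simp: \<rho>_def)
  have col: "\<exists>i\<in>{1..N}. \<exists>j\<in>{1..N}. i \<noteq> j \<and> norm (fst (\<gamma> t (\<sigma> j)) - fst (\<gamma> t (\<sigma> i))) = 1 \<and>
           (\<forall>a\<in>{1..N}. \<forall>b\<in>{1..N}. a \<noteq> b \<longrightarrow> norm (fst (\<gamma> t (\<sigma> b)) - fst (\<gamma> t (\<sigma> a))) = 1 \<longrightarrow>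
              (a = i \<and> b = j \<or> a = j \<and> b = i)) \<and>
           (\<exists>U. \<forall>k\<in>{1..N}. ((\<lambda>\<tau>. snd (\<gamma> \<tau> (\<sigma> k))) \<longlongrightarrow> U k) (at_left t) \<and>
                 ((\<lambda>\<tau>. snd (\<gamma> \<tau> (\<sigma> k))) \<longlongrightarrow>
                    scatter i j (fst (\<gamma> t (\<sigma> j)) - fst (\<gamma> t (\<sigma> i))) U k) (at_right t))"
    if tch: "touching N (\<gamma> t)" for t
  proof -
    obtain i j U where ij: "i \<in> {1..N}" "j \<in> {1..N}" "i \<noteq> j" "norm (fst (\<gamma> t j) - fst (\<gamma> t i)) = 1"
      and u: "\<And>a b. a \<in> {1..N} \<Longrightarrow> b \<in> {1..N} \<Longrightarrow> a \<noteq> b \<Longrightarrow>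
         norm (fst (\<gamma> t b) - fst (\<gamma> t a)) = 1 \<Longrightarrow> (a = i \<and> b = j \<or> a = j \<and> b = i)"
      and U: "\<And>k. k \<in> {1..N} \<Longrightarrow> ((\<lambda>\<tau>. snd (\<gamma> \<tau> k)) \<longlongrightarrow> U k) (at_left t)"
        "\<And>k. k \<in> {1..N} \<Longrightarrow> ((\<lambda>\<tau>. snd (\<gamma> \<tau> k)) \<longlongrightarrow>
       scatter i j (fst (\<gamma> t j) - fst (\<gamma> t i)) U k) (at_right t)"
      by (rule billiard_collision[OF assms(1) tch], rule that)
    have sc: "scatter (\<rho> i) (\<rho> j) \<omega> (U \<circ> \<sigma>) k = scatter i j \<omega> U (\<sigma> k)" for \<omega> k
      unfolding scatter_def using \<sigma>\<rho> by (auto simp: fun_upd_def)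
    have "(a = \<rho> i \<and> b = \<rho> j \<or> a = \<rho> j \<and> b = \<rho> i)"
      if "a \<in> {1..N}" "b \<in> {1..N}" "a \<noteq> b" "norm (fst (\<gamma> t (\<sigma> b)) - fst (\<gamma> t (\<sigma> a))) = 1" for a b
    proof -
      have "\<sigma> a = i \<and> \<sigma> b = j \<or> \<sigma> a = j \<and> \<sigma> b = i"
        using that im inj by (intro u) (auto dest: injD)
      then show ?thesis using \<sigma>\<rho>(2) by metis
    qed
    moreover have "\<rho> i \<noteq> \<rho> j" using ij(3) \<sigma>\<rho> by metis
    moreover have "((\<lambda>\<tau>. snd (\<gamma> \<tau> (\<sigma> k))) \<longlongrightarrow> (U \<circ> \<sigma>) k) (at_left t) \<and>
                 ((\<lambda>\<tau>. snd (\<gamma> \<tau> (\<sigma> k))) \<longlongrightarrow>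
                    scatter (\<rho> i) (\<rho> j) (fst (\<gamma> t (\<sigma> (\<rho> j))) - fst (\<gamma> t (\<sigma> (\<rho> i)))) (U \<circ> \<sigma>) k) (at_right t)"
      if "k \<in> {1..N}" for k
      unfolding sc \<sigma>\<rho> using U[of "\<sigma> k"] im that by auto
    moreover have "\<rho> i \<in> {1..N}" "\<rho> j \<in> {1..N}" using permutes_in_image[OF \<rho>] ij by auto
    ultimately show ?thesis using ij(4)
      by (intro bexI[of _ "\<rho> i"] bexI[of _ "\<rho> j"] conjI ballI impI exI[of _ "U \<circ> \<sigma>"])
        (simp_all add: \<sigma>\<rho>)
  qed
  show ?thesis
    unfolding billiard_def touching_comp[OF \<sigma>] comp_apply
  proof (intro conjI)
    show "\<forall>k\<in>{1..N}. continuous_on UNIV (\<lambda>t. fst (\<gamma> t (\<sigma> k)))"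
      using billiardD(1)[OF assms(1)] im by simp
    show "\<forall>t. \<forall>i\<in>{1..N}. \<forall>j\<in>{1..N}. i \<noteq> j \<longrightarrow> 1 \<le> norm (fst (\<gamma> t (\<sigma> j)) - fst (\<gamma> t (\<sigma> i)))"
      using billiardD(2)[OF assms(1)] im inj by (metis injD)
    show "\<forall>a b. finite {t \<in> {a..b}. touching N (\<gamma> t)}" using billiardD(3)[OF assms(1)] by simp
    show "\<forall>t. \<not> touching N (\<gamma> t) \<longrightarrow>
      (\<forall>k\<in>{1..N}. ((\<lambda>\<tau>. fst (\<gamma> \<tau> (\<sigma> k))) has_vector_derivative snd (\<gamma> t (\<sigma> k))) (at t) \<and>
                    ((\<lambda>\<tau>. snd (\<gamma> \<tau> (\<sigma> k))) has_vector_derivative 0) (at t))"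
      using billiardD(4,5)[OF assms(1)] im by simp
  qed (use col in blast)
qed

text \<open>Restarting a trajectory at another time is what turns uniqueness into the group law in
  \<open>flow_inverse\<close>.\<close>

lemma billiard_shift:
  assumes "billiard N \<gamma>"
  shows "billiard N (\<lambda>t. \<gamma> (t + s))"
proof -
  have tl: "filterlim (\<lambda>\<tau>. \<tau> + s) (at_left (t + s)) (at_left t)" for t
    by (auto simp: filterlim_at eventually_at_filter intro!: tendsto_intros)
  have tr: "filterlim (\<lambda>\<tau>. \<tau> + s) (at_right (t + s)) (at_right t)" for t
    by (auto simp: filterlim_at eventually_at_filter intro!: tendsto_intros)
  have d: "((\<lambda>\<tau>. f (\<tau> + s)) has_vector_derivative D) (at t)"
    if "(f has_vector_derivative D) (at (t + s))" for f :: "real \<Rightarrow> 'a" and D t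
  proof -
    have "((\<lambda>\<tau>. \<tau> + s) has_vector_derivative 1) (at t)"
      by (auto intro!: derivative_eq_intros)
    from vector_diff_chain_at[OF this that] show ?thesis by (simp add: o_def)
  qed
  have fin: "finite {t \<in> {a..b}. touching N (\<gamma> (t + s))}" for a b
  proof -
    have "finite {t \<in> {a + s..b + s}. touching N (\<gamma> t)}" by (rule billiardD(3)[OF assms])
    then have "finite ((\<lambda>t. t - s) ` {t \<in> {a + s..b + s}. touching N (\<gamma> t)})" by (rule finite_imageI)
    then show ?thesis
      by (rule rev_finite_subset) (auto intro!: image_eqI[of _ _ "_ + s"])
  qed
  have c: "continuous_on UNIV (\<lambda>t. fst (\<gamma> (t + s) k))" if "k \<in> {1..N}" for k
    by (rule continuous_on_compose2[OF billiardD(1)[OF assms that], of UNIV "\<lambda>t. t + s"])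
       (auto intro!: continuous_intros)
  show ?thesis
    unfolding billiard_def
    apply (intro conjI)
    subgoal using c by blast
    subgoal using billiardD(2)[OF assms] by simp
    subgoal using fin by blast
    subgoal using d billiardD(4,5)[OF assms] by blast
    subgoal
    proof (intro allI impI)
      fix t assume tch: "touching N (\<gamma> (t + s))"
      obtain i j U where ij: "i \<in> {1..N}" "j \<in> {1..N}" "i \<noteq> j"
        "norm (fst (\<gamma> (t + s) j) - fst (\<gamma> (t + s) i)) = 1"
        and u: "\<And>a b. a \<in> {1..N} \<Longrightarrow> b \<in> {1..N} \<Longrightarrow> a \<noteq> b \<Longrightarrow>
           norm (fst (\<gamma> (t + s) b) - fst (\<gamma> (t + s) a)) = 1 \<Longrightarrow> (a = i \<and> b = j \<or> a = j \<and> b = i)"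
        and U: "\<And>k. k \<in> {1..N} \<Longrightarrow> ((\<lambda>\<tau>. snd (\<gamma> \<tau> k)) \<longlongrightarrow> U k) (at_left (t + s))"
        "\<And>k. k \<in> {1..N} \<Longrightarrow> ((\<lambda>\<tau>. snd (\<gamma> \<tau> k)) \<longlongrightarrow>
           scatter i j (fst (\<gamma> (t + s) j) - fst (\<gamma> (t + s) i)) U k) (at_right (t + s))"
        by (rule billiard_collision[OF assms tch], rule that)
      show "\<exists>i\<in>{1..N}. \<exists>j\<in>{1..N}. i \<noteq> j \<and> norm (fst (\<gamma> (t + s) j) - fst (\<gamma> (t + s) i)) = 1 \<and>
           (\<forall>a\<in>{1..N}. \<forall>b\<in>{1..N}. a \<noteq> b \<longrightarrow> norm (fst (\<gamma> (t + s) b) - fst (\<gamma> (t + s) a)) = 1 \<longrightarrow>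
              (a = i \<and> b = j \<or> a = j \<and> b = i)) \<and>
           (\<exists>U. \<forall>k\<in>{1..N}. ((\<lambda>\<tau>. snd (\<gamma> (\<tau> + s) k)) \<longlongrightarrow> U k) (at_left t) \<and>
                 ((\<lambda>\<tau>. snd (\<gamma> (\<tau> + s) k)) \<longlongrightarrow>
                    scatter i j (fst (\<gamma> (t + s) j) - fst (\<gamma> (t + s) i)) U k) (at_right t))"
        using ij u filterlim_compose[OF U(1) tl] filterlim_compose[OF U(2) tr]
        by (intro bexI[of _ i] bexI[of _ j] conjI ballI impI exI[of _ U]) simp_all
    qed
    done
qed

text \<open>The normal points from the first particle to the second, so exchanging the labels
  reverses it, and the two sign changes cancel in the impulse. Hence the order in which a collision
  lists its pair is immaterial.\<close>

lemma scatter_swap: "scatter j i (- \<omega>) U = scatter i j \<omega> U" if "i \<noteq> j"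
  using that by (auto simp: scatter_def fun_upd_def inner_diff_right algebra_simps)

text \<open>For a unit normal, scattering turns the normal component \<open>p\<close> of the
  relative velocity into \<open>- p\<close> and keeps the rest, so a second scattering undoes the
  first. Reversibility of a collision rests on this.\<close>

lemma scatter_involution:
  assumes "i \<noteq> j" "norm \<omega> = 1"
  shows "scatter i j \<omega> (scatter i j \<omega> U) = U"
proof -
  define p where "p = \<omega> \<bullet> (U j - U i)"
  have \<omega>: "\<omega> \<bullet> \<omega> = 1" using assms(2) by (simp add: norm_eq_1)
  have "\<omega> \<bullet> (scatter i j \<omega> U j - scatter i j \<omega> U i) = - p"
    using assms(1) by (simp add: scatter_def p_def[symmetric] inner_diff_right inner_add_right \<omega>)
      (simp add: p_def inner_diff_right)
  then show ?thesis
    using assms(1) unfolding scatter_def[of i j \<omega> "scatter i j \<omega> U"]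
    by (auto simp: fun_eq_iff) (auto simp: scatter_def p_def)
qed

lemma scatter_uminus: "scatter i j (\<omega>) (\<lambda>k. - U k) k = - scatter i j \<omega> U k"
  by (simp add: scatter_def inner_diff_right algebra_simps)

lemma billiard_reverse:
  assumes "billiard N \<gamma>"
  shows "billiard N (\<lambda>t k. (fst (\<gamma> (- t) k), - snd (\<gamma> (- t) k)))"
proof -
  have tl: "filterlim uminus (at_right (- t)) (at_left t)" for t :: real
    by (auto simp: filterlim_at eventually_at_filter intro!: tendsto_intros)
  have tr: "filterlim uminus (at_left (- t)) (at_right t)" for t :: real
    by (auto simp: filterlim_at eventually_at_filter intro!: tendsto_intros)
  have d: "((\<lambda>\<tau>. f (- \<tau>)) has_vector_derivative - D) (at t)"
    if "(f has_vector_derivative D) (at (- t))" for f :: "real \<Rightarrow> 'a" and D t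
  proof -
    have "(uminus has_vector_derivative - 1) (at t)"
      by (auto intro!: derivative_eq_intros)
    from vector_diff_chain_at[OF this that] show ?thesis by (simp add: o_def)
  qed
  have tch: "touching N (\<lambda>k. (fst (\<gamma> t k), - snd (\<gamma> t k))) = touching N (\<gamma> t)" for t
    by (simp add: touching_def)
  have fin: "finite {t \<in> {a..b}. touching N (\<gamma> (- t))}" for a b
  proof -
    have "finite {t \<in> {- b..- a}. touching N (\<gamma> t)}" by (rule billiardD(3)[OF assms])
    then have "finite (uminus ` {t \<in> {- b..- a}. touching N (\<gamma> t)})" by (rule finite_imageI)
    then show ?thesis
      by (rule rev_finite_subset) (auto intro!: image_eqI[of _ _ "- _"])
  qed
  have c: "continuous_on UNIV (\<lambda>t. fst (\<gamma> (- t) k))" if "k \<in> {1..N}" for k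
    by (rule continuous_on_compose2[OF billiardD(1)[OF assms that], of UNIV uminus])
       (auto intro!: continuous_intros)
  show ?thesis
    unfolding billiard_def tch fst_conv snd_conv
    apply (intro conjI)
    subgoal using c by blast
    subgoal using billiardD(2)[OF assms] by simp
    subgoal using fin by blast
    subgoal
    proof (intro allI impI ballI conjI)
      fix t k assume h: "\<not> touching N (\<gamma> (- t))" "k \<in> {1..N}"
      show "((\<lambda>\<tau>. fst (\<gamma> (- \<tau>) k)) has_vector_derivative - snd (\<gamma> (- t) k)) (at t)"
        using d[OF billiardD(4)[OF assms h]] .
      show "((\<lambda>\<tau>. - snd (\<gamma> (- \<tau>) k)) has_vector_derivative 0) (at t)"
        using has_vector_derivative_minus[OF d[OF billiardD(5)[OF assms h]]] by simp
    qed
    subgoal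
    proof (intro allI impI)
      fix t assume tch: "touching N (\<gamma> (- t))"
      obtain i j U where ij: "i \<in> {1..N}" "j \<in> {1..N}" "i \<noteq> j"
        "norm (fst (\<gamma> (- t) j) - fst (\<gamma> (- t) i)) = 1"
        and u: "\<And>a b. a \<in> {1..N} \<Longrightarrow> b \<in> {1..N} \<Longrightarrow> a \<noteq> b \<Longrightarrow>
           norm (fst (\<gamma> (- t) b) - fst (\<gamma> (- t) a)) = 1 \<Longrightarrow> (a = i \<and> b = j \<or> a = j \<and> b = i)"
        and U: "\<And>k. k \<in> {1..N} \<Longrightarrow> ((\<lambda>\<tau>. snd (\<gamma> \<tau> k)) \<longlongrightarrow> U k) (at_left (- t))"
        "\<And>k. k \<in> {1..N} \<Longrightarrow> ((\<lambda>\<tau>. snd (\<gamma> \<tau> k)) \<longlongrightarrow>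
           scatter i j (fst (\<gamma> (- t) j) - fst (\<gamma> (- t) i)) U k) (at_right (- t))"
        by (rule billiard_collision[OF assms tch], rule that)
      define \<omega> where "\<omega> = fst (\<gamma> (- t) j) - fst (\<gamma> (- t) i)"
      \<comment> \<open>The velocities entering the reversed collision are the outgoing ones with
        opposite sign. Scattering is linear and an involution, so they leave as
        \<open>- U\<close>.\<close>
      define W where "W k = - scatter i j \<omega> U k" for k
      have W: "scatter i j \<omega> W k = - U k" for k
      proof -
        have "scatter i j \<omega> W k = - scatter i j \<omega> (scatter i j \<omega> U) k"
          unfolding W_def using scatter_uminus[of i j \<omega> "scatter i j \<omega> U" k] by simp
        then show ?thesis using scatter_involution[OF ij(3), of \<omega> U] ij(4) by (simp add: \<omega>_def)
      qed
      have "((\<lambda>\<tau>. - snd (\<gamma> (- \<tau>) k)) \<longlongrightarrow> W k) (at_left t)" if "k \<in> {1..N}" for k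
        using tendsto_minus[OF filterlim_compose[OF U(2)[OF that] tl]] by (simp add: W_def \<omega>_def)
      moreover have "((\<lambda>\<tau>. - snd (\<gamma> (- \<tau>) k)) \<longlongrightarrow> scatter i j \<omega> W k) (at_right t)" if "k \<in> {1..N}" for k
        using tendsto_minus[OF filterlim_compose[OF U(1)[OF that] tr]] by (simp add: W)
      ultimately
      show "\<exists>i\<in>{1..N}. \<exists>j\<in>{1..N}. i \<noteq> j \<and> norm (fst (\<gamma> (- t) j) - fst (\<gamma> (- t) i)) = 1 \<and>
           (\<forall>a\<in>{1..N}. \<forall>b\<in>{1..N}. a \<noteq> b \<longrightarrow> norm (fst (\<gamma> (- t) b) - fst (\<gamma> (- t) a)) = 1 \<longrightarrow>
              (a = i \<and> b = j \<or> a = j \<and> b = i)) \<and>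
           (\<exists>U. \<forall>k\<in>{1..N}. ((\<lambda>\<tau>. - snd (\<gamma> (- \<tau>) k)) \<longlongrightarrow> U k) (at_left t) \<and>
                 ((\<lambda>\<tau>. - snd (\<gamma> (- \<tau>) k)) \<longlongrightarrow>
                    scatter i j (fst (\<gamma> (- t) j) - fst (\<gamma> (- t) i)) U k) (at_right t))"
        using ij u unfolding \<omega>_def
        by (intro bexI[of _ i] bexI[of _ j] conjI ballI impI exI[of _ W]) simp_all
    qed
    done
qed

section \<open>Uniqueness of trajectories\<close>

lemma billiard_punctured_free:
  assumes "billiard N \<gamma>"
  obtains e where "0 < e" "\<And>s. s \<noteq> t \<Longrightarrow> \<bar>s - t\<bar> < e \<Longrightarrow> \<not> touching N (\<gamma> s)"
proof -
  define F where "F = {s \<in> {t - 1..t + 1}. touching N (\<gamma> s)}"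
  have "finite F" unfolding F_def by (rule billiardD(3)[OF assms])
  then obtain d where d: "0 < d" "\<And>s. s \<in> F \<Longrightarrow> s \<noteq> t \<Longrightarrow> d \<le> dist t s"
    using finite_set_avoid by metis
  show ?thesis
  proof
    show "0 < min d 1" using d by simp
    show "\<not> touching N (\<gamma> s)" if "s \<noteq> t" "\<bar>s - t\<bar> < min d 1" for s
      using d(2)[of s] that by (auto simp: F_def dist_real_def abs_if split: if_splits)
  qed
qed

text \<open>The vanishing derivative makes the velocity constant on the contact-free interval, and
  the constant can only be the right limit at \<open>t\<close>. The velocity at \<open>t\<close>
  itself is avoided, so that \<open>t\<close> may be a collision time.\<close>

lemma billiard_velocity_after:
  assumes "billiard N \<gamma>" "k \<in> {1..N}" "((\<lambda>\<tau>. snd (\<gamma> \<tau> k)) \<longlongrightarrow> R) (at_right t)"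
    and free: "\<And>s. t < s \<Longrightarrow> s < u \<Longrightarrow> \<not> touching N (\<gamma> s)" and s: "t < s" "s < u"
  shows "snd (\<gamma> s k) = R" "fst (\<gamma> s k) = fst (\<gamma> t k) + (s - t) *\<^sub>R R"
proof -
  have const: "snd (\<gamma> s k) = R" if s: "t < s" "s < u" for s
  proof -
    have d: "((\<lambda>\<tau>. snd (\<gamma> \<tau> k)) has_vector_derivative 0) (at x)" if "x \<in> {t<..<u}" for x
      using billiardD(5)[OF assms(1) free assms(2)] that by auto
    have "(\<lambda>\<tau>. snd (\<gamma> \<tau> k)) constant_on {t<..<u}"
    proof (rule has_derivative_zero_connected_constant_on[of _ "{}"])
      show "continuous_on {t<..<u} (\<lambda>\<tau>. snd (\<gamma> \<tau> k))"
        using has_vector_derivative_continuous[OF d] by (simp add: continuous_at_imp_continuous_on)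
    qed (use d in \<open>auto simp: has_vector_derivative_def intro: has_derivative_at_withinI\<close>)
    then obtain c where c: "\<And>x. t < x \<Longrightarrow> x < u \<Longrightarrow> snd (\<gamma> x k) = c"
      by (auto simp: constant_on_def)
    have "((\<lambda>\<tau>. snd (\<gamma> \<tau> k)) \<longlongrightarrow> c) (at_right t)"
      using s by (intro tendsto_eventually) (auto simp: eventually_at_right intro!: exI[of _ u] c)
    then show ?thesis using tendsto_unique[OF _ assms(3)] c[OF s] by simp
  qed
  show "snd (\<gamma> s k) = R" using const[OF s] .
  define g where "g x = fst (\<gamma> x k) - (x - t) *\<^sub>R R" for x
  have "g s = g t"
  proof (rule has_derivative_zero_unique_strong_interval[of "{t}" t s])
    show "continuous_on {t..s} g" unfolding g_def
      by (intro continuous_intros continuous_on_subset[OF billiardD(1)[OF assms(1,2)]]) simp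
    fix x assume x: "x \<in> {t..s} - {t}"
    then have "((\<lambda>\<tau>. fst (\<gamma> \<tau> k)) has_vector_derivative R) (at x)"
      using billiardD(4)[OF assms(1) free assms(2), of x] const[of x] s by auto
    then have "(g has_vector_derivative R - (1 - 0) *\<^sub>R R) (at x)"
      unfolding g_def by (auto intro!: derivative_eq_intros)
    then show "(g has_derivative (\<lambda>h. 0)) (at x within {t..s})"
      by (simp add: has_vector_derivative_def has_derivative_at_withinI)
  qed (use s in auto)
  then show "fst (\<gamma> s k) = fst (\<gamma> t k) + (s - t) *\<^sub>R R" by (simp add: g_def algebra_simps)
qed

text \<open>The local step of uniqueness. Off contact, the velocities at \<open>t\<close> are their
  own right limits. At a contact, the positions determine the colliding pair and the velocities just
  before determine those just after. In both cases the two motions then fly freely with the same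
  data until one of them next has a contact.\<close>

lemma billiard_agree_step:
  assumes b: "billiard N \<gamma>" "billiard N \<eta>"
    and pos: "\<And>k. k \<in> {1..N} \<Longrightarrow> fst (\<gamma> t k) = fst (\<eta> t k)"
    and vel: "\<not> touching N (\<gamma> t) \<Longrightarrow> \<forall>k\<in>{1..N}. snd (\<gamma> t k) = snd (\<eta> t k)"
    and left: "touching N (\<gamma> t) \<Longrightarrow>
      \<forall>k\<in>{1..N}. eventually (\<lambda>s. snd (\<gamma> s k) = snd (\<eta> s k)) (at_left t)"
  obtains u where "t < u" "\<And>s k. t < s \<Longrightarrow> s < u \<Longrightarrow> k \<in> {1..N} \<Longrightarrow> \<gamma> s k = \<eta> s k"
proof -
  have tch: "touching N (\<gamma> t) = touching N (\<eta> t)"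
    unfolding touching_def using pos by auto
  have "\<exists>R. ((\<lambda>\<tau>. snd (\<gamma> \<tau> k)) \<longlongrightarrow> R) (at_right t) \<and> ((\<lambda>\<tau>. snd (\<eta> \<tau> k)) \<longlongrightarrow> R) (at_right t)"
    if k: "k \<in> {1..N}" for k
  proof (cases "touching N (\<gamma> t)")
    case False
    have "isCont (\<lambda>\<tau>. snd (\<gamma> \<tau> k)) t" "isCont (\<lambda>\<tau>. snd (\<eta> \<tau> k)) t"
      using billiardD(5)[OF b(1) False k] billiardD(5)[OF b(2) _ k] False tch
      by (auto intro: has_vector_derivative_continuous)
    then show ?thesis using vel[OF False] k
      by (auto simp: isCont_def filterlim_at_split intro!: exI[of _ "snd (\<eta> t k)"])
  next
    case True
    obtain i j U where ij: "i \<in> {1..N}" "j \<in> {1..N}" "i \<noteq> j"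
      "norm (fst (\<gamma> t j) - fst (\<gamma> t i)) = 1"
      and u: "\<And>a b. a \<in> {1..N} \<Longrightarrow> b \<in> {1..N} \<Longrightarrow> a \<noteq> b \<Longrightarrow>
           norm (fst (\<gamma> t b) - fst (\<gamma> t a)) = 1 \<Longrightarrow> (a = i \<and> b = j \<or> a = j \<and> b = i)"
      and U: "\<And>k. k \<in> {1..N} \<Longrightarrow> ((\<lambda>\<tau>. snd (\<gamma> \<tau> k)) \<longlongrightarrow> U k) (at_left t)"
        "\<And>k. k \<in> {1..N} \<Longrightarrow> ((\<lambda>\<tau>. snd (\<gamma> \<tau> k)) \<longlongrightarrow>
           scatter i j (fst (\<gamma> t j) - fst (\<gamma> t i)) U k) (at_right t)"
      by (rule billiard_collision[OF b(1) True], rule that)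
    have True': "touching N (\<eta> t)" using True tch by simp
    obtain i' j' W where ij': "i' \<in> {1..N}" "j' \<in> {1..N}" "i' \<noteq> j'"
      "norm (fst (\<eta> t j') - fst (\<eta> t i')) = 1"
      and W: "\<And>k. k \<in> {1..N} \<Longrightarrow> ((\<lambda>\<tau>. snd (\<eta> \<tau> k)) \<longlongrightarrow> W k) (at_left t)"
        "\<And>k. k \<in> {1..N} \<Longrightarrow> ((\<lambda>\<tau>. snd (\<eta> \<tau> k)) \<longlongrightarrow>
           scatter i' j' (fst (\<eta> t j') - fst (\<eta> t i')) W k) (at_right t)"
      by (rule billiard_collision[OF b(2) True'], rule that)
    have UW: "U k = W k" if k: "k \<in> {1..N}" for k
    proof (rule tendsto_unique[OF _ U(1)[OF k]])
      show "((\<lambda>\<tau>. snd (\<gamma> \<tau> k)) \<longlongrightarrow> W k) (at_left t)"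
        by (rule Lim_transform_eventually[OF W(1)[OF k]])
          (use left[OF True] k in \<open>auto elim!: ballE[of _ _ k] eventually_mono\<close>)
    qed simp
    \<comment> \<open>Contact is read off from the positions, so both trajectories collide the same
      pair; only the order in which it is listed may differ, which \<open>scatter_swap\<close>
      absorbs.\<close>
    have cases: "i' = i \<and> j' = j \<or> i' = j \<and> j' = i"
      using u[of i' j'] ij' pos by simp
    have "scatter i' j' (fst (\<eta> t j') - fst (\<eta> t i')) W k =
        scatter i j (fst (\<gamma> t j) - fst (\<gamma> t i)) W k"
      using cases
    proof
      assume "i' = j \<and> j' = i"
      then show ?thesis
        using scatter_swap[OF ij(3), of "fst (\<gamma> t j) - fst (\<gamma> t i)" W] pos ij(1,2) by simp
    qed (use pos ij in auto)
    also have "\<dots> = scatter i j (fst (\<gamma> t j) - fst (\<gamma> t i)) U k"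
      using UW ij(1,2) k by (simp add: scatter_def)
    finally show ?thesis using U(2)[OF k] W(2)[OF k] by auto
  qed
  then obtain R where R: "\<And>k. k \<in> {1..N} \<Longrightarrow> ((\<lambda>\<tau>. snd (\<gamma> \<tau> k)) \<longlongrightarrow> R k) (at_right t)"
    "\<And>k. k \<in> {1..N} \<Longrightarrow> ((\<lambda>\<tau>. snd (\<eta> \<tau> k)) \<longlongrightarrow> R k) (at_right t)" by metis
  obtain e where e: "0 < e" "\<And>s. s \<noteq> t \<Longrightarrow> \<bar>s - t\<bar> < e \<Longrightarrow> \<not> touching N (\<gamma> s)"
    using billiard_punctured_free[OF b(1)] by metis
  obtain e' where e': "0 < e'" "\<And>s. s \<noteq> t \<Longrightarrow> \<bar>s - t\<bar> < e' \<Longrightarrow> \<not> touching N (\<eta> s)"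
    using billiard_punctured_free[OF b(2)] by metis
  define u where "u = t + min e e'"
  show ?thesis
  proof
    show "t < u" using e e' by (simp add: u_def)
    fix s k assume s: "t < s" "s < u" and k: "k \<in> {1..N}"
    have "snd (\<gamma> s k) = R k" "fst (\<gamma> s k) = fst (\<gamma> t k) + (s - t) *\<^sub>R R k"
      using billiard_velocity_after[OF b(1) k R(1)[OF k], of u s] e(2) s by (auto simp: u_def)
    moreover have "snd (\<eta> s k) = R k" "fst (\<eta> s k) = fst (\<eta> t k) + (s - t) *\<^sub>R R k"
      using billiard_velocity_after[OF b(2) k R(2)[OF k], of u s] e'(2) s by (auto simp: u_def)
    ultimately show "\<gamma> s k = \<eta> s k" using pos[OF k] by (simp add: prod_eq_iff)
  qed
qed

text \<open>Continuation argument: at the infimum \<open>T\<close> of the times of disagreement the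
  trajectories still agree, by their left limits, and \<open>billiard_agree_step\<close> carries the
  agreement past \<open>T\<close>. A start without contact covers the case \<open>T = 0\<close>,
  where no earlier velocities are available to determine a collision.\<close>

lemma billiard_unique_forward:
  assumes b: "billiard N \<gamma>" "billiard N \<eta>"
    and free: "\<not> touching N (\<gamma> 0)" and init: "\<And>k. k \<in> {1..N} \<Longrightarrow> \<gamma> 0 k = \<eta> 0 k"
    and "0 \<le> t"
  shows "\<forall>k\<in>{1..N}. fst (\<gamma> t k) = fst (\<eta> t k)"
    and "\<not> touching N (\<gamma> t) \<Longrightarrow> \<forall>k\<in>{1..N}. \<gamma> t k = \<eta> t k"
proof -
  \<comment> \<open>Velocities are compared off contacts only, because \<open>billiard\<close>
    leaves them open at the instant of a collision.\<close>
  define good where "good t \<longleftrightarrow> (\<forall>k\<in>{1..N}. fst (\<gamma> t k) = fst (\<eta> t k)) \<and>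
     (\<not> touching N (\<gamma> t) \<longrightarrow> (\<forall>k\<in>{1..N}. \<gamma> t k = \<eta> t k))" for t
  have "good t"
  proof (rule ccontr)
    assume bad: "\<not> good t"
    define S where "S = {s. 0 \<le> s \<and> \<not> good s}"
    have S: "S \<noteq> {}" "bdd_below S" using bad assms(5) by (auto simp: S_def intro: bdd_belowI)
    define T where "T = Inf S"
    have T0: "0 \<le> T" unfolding T_def using S(1) by (intro cInf_greatest) (auto simp: S_def)
    have before: "good s" if "0 \<le> s" "s < T" for s
      using cInf_lower[OF _ S(2), of s] that by (force simp: T_def S_def)
    have pos: "fst (\<gamma> T k) = fst (\<eta> T k)" if k: "k \<in> {1..N}" for k
    proof (cases "T = 0")
      case False
      have "isCont (\<lambda>t. fst (\<gamma> t k)) T" "isCont (\<lambda>t. fst (\<eta> t k)) T"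
        using billiardD(1)[OF b(1) k] billiardD(1)[OF b(2) k]
        by (simp_all add: continuous_on_eq_continuous_at)
      then have *: "((\<lambda>t. fst (\<gamma> t k)) \<longlongrightarrow> fst (\<gamma> T k)) (at_left T)"
        "((\<lambda>t. fst (\<eta> t k)) \<longlongrightarrow> fst (\<eta> T k)) (at_left T)"
        by (auto simp: isCont_def filterlim_at_split)
      have "((\<lambda>t. fst (\<gamma> t k)) \<longlongrightarrow> fst (\<eta> T k)) (at_left T)"
        by (rule Lim_transform_eventually[OF *(2)])
          (use before T0 False k in \<open>auto simp: eventually_at_left_field good_def intro!: exI[of _ 0]\<close>)
      then show ?thesis using tendsto_unique[OF _ *(1)] by simp
    qed (use init k in simp)
    have left: "eventually (\<lambda>s. \<gamma> s k = \<eta> s k) (at_left T)" if k: "k \<in> {1..N}" "T \<noteq> 0" for k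
    proof -
      obtain e where e: "0 < e" "\<And>s. s \<noteq> T \<Longrightarrow> \<bar>s - T\<bar> < e \<Longrightarrow> \<not> touching N (\<gamma> s)"
        using billiard_punctured_free[OF b(1)] by metis
      have "\<gamma> s k = \<eta> s k" if "max 0 (T - e) < s" "s < T" for s
        using before[of s] e(2)[of s] that k by (auto simp: good_def)
      then show ?thesis using T0 that e(1)
        by (auto simp: eventually_at_left_field intro!: exI[of _ "max 0 (T - e)"])
    qed
    have vel: "\<forall>k\<in>{1..N}. snd (\<gamma> T k) = snd (\<eta> T k)" if nt: "\<not> touching N (\<gamma> T)"
    proof (cases "T = 0")
      case False
      have nt': "\<not> touching N (\<eta> T)" using nt pos unfolding touching_def by auto
      show ?thesis
      proof
        fix k assume k: "k \<in> {1..N}"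
        have "isCont (\<lambda>\<tau>. snd (\<gamma> \<tau> k)) T" "isCont (\<lambda>\<tau>. snd (\<eta> \<tau> k)) T"
          using billiardD(5)[OF b(1) nt k] billiardD(5)[OF b(2) nt' k]
          by (auto intro: has_vector_derivative_continuous)
        then have *: "((\<lambda>t. snd (\<gamma> t k)) \<longlongrightarrow> snd (\<gamma> T k)) (at_left T)"
          "((\<lambda>t. snd (\<eta> t k)) \<longlongrightarrow> snd (\<eta> T k)) (at_left T)"
          by (auto simp: isCont_def filterlim_at_split)
        have "((\<lambda>t. snd (\<gamma> t k)) \<longlongrightarrow> snd (\<eta> T k)) (at_left T)"
          by (rule Lim_transform_eventually[OF *(2)])
            (use left[OF k False] in \<open>auto elim: eventually_mono\<close>)
        then show "snd (\<gamma> T k) = snd (\<eta> T k)" using tendsto_unique[OF _ *(1)] by simp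
      qed
    qed (use init in simp)
    have goodT: "good T" using pos vel by (auto simp: good_def prod_eq_iff)
    have left': "\<forall>k\<in>{1..N}. eventually (\<lambda>s. snd (\<gamma> s k) = snd (\<eta> s k)) (at_left T)"
      if "touching N (\<gamma> T)"
    proof -
      have "T \<noteq> 0" using that free by auto
      then show ?thesis by (auto intro: eventually_mono[OF left])
    qed
    obtain u where u: "T < u" "\<And>s k. T < s \<Longrightarrow> s < u \<Longrightarrow> k \<in> {1..N} \<Longrightarrow> \<gamma> s k = \<eta> s k"
      by (rule billiard_agree_step[OF b pos vel left']) auto
    have "good s" if "0 \<le> s" "s < u" for s
      using before[of s] goodT u(2)[of s] that by (cases "s < T"; cases "s = T") (auto simp: good_def)
    then have "u \<le> Inf S" using S(1) by (intro cInf_greatest) (auto simp: S_def not_less[symmetric])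
    then show False using u(1) by (simp add: T_def)
  qed
  then show "\<forall>k\<in>{1..N}. fst (\<gamma> t k) = fst (\<eta> t k)"
    and "\<not> touching N (\<gamma> t) \<Longrightarrow> \<forall>k\<in>{1..N}. \<gamma> t k = \<eta> t k"
    by (auto simp: good_def)
qed

text \<open>Negative times follow by time reversal. Since the positions agree at all times, both
  trajectories have the same contact times, so it is enough that one of them is free of contact at
  \<open>t\<close>.\<close>

lemma billiard_unique:
  assumes b: "billiard N \<gamma>" "billiard N \<eta>"
    and free: "\<not> touching N (\<gamma> 0)" and init: "\<And>k. k \<in> {1..N} \<Longrightarrow> \<gamma> 0 k = \<eta> 0 k"
    and t: "\<not> touching N (\<gamma> t) \<or> \<not> touching N (\<eta> t)" and k: "k \<in> {1..N}"
  shows "\<gamma> t k = \<eta> t k"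
proof -
  have *: "(\<forall>k\<in>{1..N}. fst (\<gamma> t k) = fst (\<eta> t k)) \<and>
    (\<not> touching N (\<gamma> t) \<longrightarrow> (\<forall>k\<in>{1..N}. \<gamma> t k = \<eta> t k))"
  proof (cases "0 \<le> t")
    case True
    then show ?thesis using billiard_unique_forward[OF b free init] by simp
  next
    case False
    define \<gamma>' where "\<gamma>' t k = (fst (\<gamma> (- t) k), - snd (\<gamma> (- t) k))" for t k
    define \<eta>' where "\<eta>' t k = (fst (\<eta> (- t) k), - snd (\<eta> (- t) k))" for t k
    have tch: "touching N (\<gamma>' s) = touching N (\<gamma> (- s))" for s
      by (simp add: touching_def \<gamma>'_def)
    have b': "billiard N \<gamma>'" "billiard N \<eta>'"
      using billiard_reverse[OF b(1)] billiard_reverse[OF b(2)]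
      by (simp_all add: \<gamma>'_def[abs_def] \<eta>'_def[abs_def])
    have "\<forall>k\<in>{1..N}. fst (\<gamma>' (- t) k) = fst (\<eta>' (- t) k)"
      "\<not> touching N (\<gamma>' (- t)) \<Longrightarrow> \<forall>k\<in>{1..N}. \<gamma>' (- t) k = \<eta>' (- t) k"
      using billiard_unique_forward[OF b', of "- t"] free init False
      by (simp_all add: tch) (simp_all add: \<gamma>'_def \<eta>'_def)
    then show ?thesis unfolding tch by (auto simp: \<gamma>'_def \<eta>'_def prod_eq_iff)
  qed
  then have "touching N (\<gamma> t) = touching N (\<eta> t)"
    unfolding touching_def by auto
  then show ?thesis using * t k by auto
qed

section \<open>The virial identity\<close>

definition pairs :: "nat \<Rightarrow> (nat \<times> nat) set" where
  "pairs N = {(i, j). i \<in> {1..N} \<and> j \<in> {1..N} \<and> i \<noteq> j}"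

lemma finite_pairs [simp]: "finite (pairs N)"
  by (rule finite_subset[of _ "{1..N} \<times> {1..N}"]) (auto simp: pairs_def)

definition kinetic :: "nat \<Rightarrow> (nat \<Rightarrow> 'a::euclidean_space \<times> 'a) \<Rightarrow> real" where
  "kinetic N Z = (\<Sum>k\<in>{1..N}. (norm (snd (Z k)))\<^sup>2)"

definition inertia :: "nat \<Rightarrow> (nat \<Rightarrow> 'a::euclidean_space \<times> 'a) \<Rightarrow> real" where
  "inertia N Z = (\<Sum>k\<in>{1..N}. (norm (fst (Z k)))\<^sup>2)"

text \<open>On a trajectory, \<open>virial N t\<close> is \<open>X \<bullet> V - t \<bar>V\<bar>\<^sup>2\<close>.\<close>

definition virial :: "nat \<Rightarrow> real \<Rightarrow> (nat \<Rightarrow> 'a::euclidean_space \<times> 'a) \<Rightarrow> real" where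
  "virial N t Z = (\<Sum>k\<in>{1..N}. (fst (Z k) - t *\<^sub>R snd (Z k)) \<bullet> snd (Z k))"

text \<open>The moment of inertia that the configuration would have had at time 0 if it had been in
  free flight since then.\<close>

definition retarded :: "nat \<Rightarrow> real \<Rightarrow> (nat \<Rightarrow> 'a::euclidean_space \<times> 'a) \<Rightarrow> real" where
  "retarded N t Z = (\<Sum>k\<in>{1..N}. (norm (fst (Z k) - t *\<^sub>R snd (Z k)))\<^sup>2)"

text \<open>The squared normal velocity spread over a shell of width \<open>d\<close>: in place of
  the surface measure at contact stands \<open>1 / d\<close> times the indicator of the
  shell.\<close>

definition shell :: "real \<Rightarrow> 'a::euclidean_space \<Rightarrow> 'a \<Rightarrow> real" where
  "shell d y w = (if 1 < norm y \<and> norm y < 1 + d then (sgn y \<bullet> w)\<^sup>2 / d else 0)"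

text \<open>A \<open>C\<^sup>1\<close> function that rises from \<open>- 1\<close> at contact to \<open>0\<close> at distance \<open>1 + 2 d\<close>, with slope at
  least \<open>1 / (2 d)\<close> in the shell.\<close>

definition cutoff :: "real \<Rightarrow> real \<Rightarrow> real" where
  "cutoff d r = - (max 0 (1 - (r - 1) / (2 * d)))\<^sup>2"

definition radial :: "real \<Rightarrow> 'a::euclidean_space \<Rightarrow> 'a \<Rightarrow> real" where
  "radial d y w = cutoff d (norm y) * ((y \<bullet> w) / norm y)"

lemma has_real_derivative_inner:
  fixes f g :: "real \<Rightarrow> 'a::real_inner"
  assumes "(f has_vector_derivative f') (at t)" "(g has_vector_derivative g') (at t)"
  shows "((\<lambda>\<tau>. f \<tau> \<bullet> g \<tau>) has_real_derivative (f t \<bullet> g' + f' \<bullet> g t)) (at t)"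
  using bounded_bilinear.has_vector_derivative[OF bounded_bilinear_inner assms]
  by (simp add: has_real_derivative_iff_has_vector_derivative)

text \<open>Squaring removes the kink of the positive part, since the difference quotient at 0 is
  bounded by \<open>\<bar>h\<bar>\<close>. With a linear ramp in \<open>cutoff\<close>, the passages
  of a pair through distance \<open>1 + 2 * d\<close> would be further exceptional times.\<close>

lemma has_real_derivative_max0_square:
  "((\<lambda>z::real. (max 0 z)\<^sup>2) has_real_derivative 2 * max 0 z) (at z)"
proof -
  consider "z > 0" | "z < 0" | "z = 0" by linarith
  then show ?thesis
  proof cases
    case 1
    show ?thesis
      by (rule has_field_derivative_transform_within_open[of "\<lambda>z. z\<^sup>2" _ _ "{0<..}"])
        (use 1 in \<open>auto intro!: derivative_eq_intros\<close>)
  next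
    case 2
    show ?thesis
      by (rule has_field_derivative_transform_within_open[of "\<lambda>z. 0" _ _ "{..<0}"])
        (use 2 in \<open>auto intro!: derivative_eq_intros\<close>)
  next
    case 3
    have "((\<lambda>h. (max 0 h)\<^sup>2 / h) \<longlongrightarrow> 0) (at (0::real))"
    proof (rule Lim_null_comparison)
      show "\<forall>\<^sub>F h in at 0. norm ((max 0 h)\<^sup>2 / h) \<le> norm (h::real)"
        by (rule always_eventually) (auto simp: max_def power2_eq_square)
      show "((\<lambda>h. norm (h::real)) \<longlongrightarrow> 0) (at 0)" by (auto intro!: tendsto_eq_intros)
    qed
    then show ?thesis using 3 by (simp add: DERIV_def)
  qed
qed

lemma has_real_derivative_cutoff:
  assumes "0 < d"
  shows "(cutoff d has_real_derivative max 0 (1 - (r - 1) / (2 * d)) / d) (at r)"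
proof -
  have "((\<lambda>r. 1 - (r - 1) / (2 * d)) has_real_derivative - (1 / (2 * d))) (at r)"
    using assms by (auto intro!: derivative_eq_intros)
  from DERIV_minus[OF DERIV_chain2[OF has_real_derivative_max0_square this]]
  show ?thesis unfolding cutoff_def[abs_def] by (simp add: field_simps)
qed

lemma cutoff_bounds: "0 < d \<Longrightarrow> 1 \<le> r \<Longrightarrow> - 1 \<le> cutoff d r" "cutoff d r \<le> 0"
  by (auto simp: cutoff_def max_def power_le_one)

lemma cutoff_eq_0: "0 < d \<Longrightarrow> 1 + 2 * d \<le> r \<Longrightarrow> cutoff d r = 0"
  by (auto simp: cutoff_def max_def field_simps)

lemma radial_abs_le:
  assumes "0 < d" "1 \<le> norm y"
  shows "\<bar>radial d y w\<bar> \<le> norm w"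
proof -
  have "\<bar>cutoff d (norm y)\<bar> \<le> 1" using cutoff_bounds[of d "norm y"] assms by simp
  moreover have "\<bar>(y \<bullet> w) / norm y\<bar> \<le> norm w"
    using Cauchy_Schwarz_ineq2[of y w] order_less_le_trans[OF zero_less_one assms(2)]
    by (simp add: divide_le_eq mult.commute)
  ultimately have "\<bar>cutoff d (norm y)\<bar> * \<bar>(y \<bullet> w) / norm y\<bar> \<le> 1 * norm w"
    by (intro mult_mono) auto
  then show ?thesis by (simp add: radial_def abs_mult)
qed

text \<open>The radial relative velocity of a free pair is nondecreasing, so the cutoff, being nonpositive,
  costs only the error term supported in the enlarged shell.\<close>

lemma has_real_derivative_radial:
  fixes y w :: "real \<Rightarrow> 'a::euclidean_space"
  assumes d: "0 < d" and y: "(y has_vector_derivative w t) (at t)"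
    and w: "(w has_vector_derivative 0) (at t)" and r: "1 \<le> norm (y t)"
  shows "\<exists>D. ((\<lambda>\<tau>. radial d (y \<tau>) (w \<tau>)) has_real_derivative D) (at t) \<and>
     shell d (y t) (w t) \<le> 2 * (D + (if norm (y t) < 1 + 2 * d then (norm (w t))\<^sup>2 else 0))"
proof -
  define r where "r = norm (y t)"
  define p where "p = y t \<bullet> w t"
  define q where "q = (norm (w t))\<^sup>2"
  have r1: "1 \<le> r" using r by (simp add: r_def)
  have ds: "((\<lambda>\<tau>. y \<tau> \<bullet> y \<tau>) has_real_derivative 2 * p) (at t)"
    using has_real_derivative_inner[OF y y] by (simp add: p_def inner_commute)
  have dp: "((\<lambda>\<tau>. y \<tau> \<bullet> w \<tau>) has_real_derivative q) (at t)"
    using has_real_derivative_inner[OF y w] by (simp add: q_def power2_norm_eq_inner)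
  have s: "y t \<bullet> y t = r\<^sup>2" by (simp add: r_def power2_norm_eq_inner)
  have dr: "((\<lambda>\<tau>. norm (y \<tau>)) has_real_derivative p / r) (at t)"
  proof -
    have "((\<lambda>\<tau>. sqrt (y \<tau> \<bullet> y \<tau>)) has_real_derivative (inverse (sqrt (y t \<bullet> y t)) / 2) * (2 * p)) (at t)"
      by (rule DERIV_chain2[OF DERIV_real_sqrt ds]) (use r1 s in simp)
    then show ?thesis using r1 by (simp add: norm_eq_sqrt_inner[symmetric] r_def field_simps)
  qed
  define m where "m = max 0 (1 - (r - 1) / (2 * d))"
  have dc: "((\<lambda>\<tau>. cutoff d (norm (y \<tau>))) has_real_derivative (m / d) * (p / r)) (at t)"
    using DERIV_chain2[OF has_real_derivative_cutoff[OF d] dr] by (simp add: m_def r_def)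
  have dq: "((\<lambda>\<tau>. (y \<tau> \<bullet> w \<tau>) / norm (y \<tau>)) has_real_derivative (q * r - p * (p / r)) / (r * r)) (at t)"
    using DERIV_divide[OF dp dr] order_less_le_trans[OF zero_less_one r1] by (auto simp: r_def p_def)
  \<comment> \<open>Product rule. The first term, slope of the cutoff times squared radial velocity,
    dominates \<open>shell\<close>; the second one is the error.\<close>
  define D where "D = (m / d) * (p / r) * (p / r) + ((q * r - p * (p / r)) / (r * r)) * cutoff d r"
  have "((\<lambda>\<tau>. radial d (y \<tau>) (w \<tau>)) has_real_derivative D) (at t)"
    using DERIV_mult[OF dc dq] unfolding radial_def D_def by (simp add: r_def p_def)
  moreover have "shell d (y t) (w t) \<le> 2 * (D + (if r < 1 + 2 * d then q else 0))"
  proof -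
    have pq: "p\<^sup>2 \<le> r\<^sup>2 * q"
      using Cauchy_Schwarz_ineq[of "y t" "w t"] by (simp add: p_def q_def r_def power2_norm_eq_inner)
    \<comment> \<open>The derivative of the radial velocity, which is the squared tangential speed
      divided by \<open>r\<close>. It is nonnegative by Cauchy-Schwarz and at most \<open>q\<close>
      because \<open>r\<close> is at least 1.\<close>
    define z where "z = (q * r - p * (p / r)) / (r * r)"
    have z0: "0 \<le> z" using pq r1 by (simp add: z_def field_simps power2_eq_square)
    have zq: "z \<le> q"
    proof -
      have "z \<le> q * r / (r * r)" unfolding z_def using r1 by (intro divide_right_mono) auto
      also have "\<dots> = q / r" using r1 by simp
      also have "\<dots> \<le> q" using r1 by (simp add: q_def divide_le_eq mult_le_cancel_left1)
      finally show ?thesis .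
    qed
    have c: "- (if r < 1 + 2 * d then q else 0) \<le> z * cutoff d r"
    proof (cases "r < 1 + 2 * d")
      case True
      have "z * (-1) \<le> z * cutoff d r"
        using cutoff_bounds(1)[OF d r1] z0 by (intro mult_left_mono) auto
      then show ?thesis using True zq by simp
    qed (use cutoff_eq_0[OF d] in auto)
    have "shell d (y t) (w t) \<le> 2 * ((m / d) * (p / r) * (p / r))"
    proof (cases "1 < r \<and> r < 1 + d")
      case True
      \<comment> \<open>In the shell, \<open>(r - 1) / (2 * d)\<close> stays below 1/2. This is why
        the cutoff extends to twice the width of the shell; the lower bound 1/2 is the source of the
        factor 2 in the claim.\<close>
      then have m: "1 / 2 \<le> m" using d by (simp add: m_def field_simps max_def)
      have "sgn (y t) \<bullet> w t = p / r" by (simp add: sgn_div_norm p_def r_def divide_inverse)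
      then have "shell d (y t) (w t) = (1 / d) * ((p / r) * (p / r))"
        using True by (simp add: shell_def r_def power2_eq_square)
      also have "\<dots> \<le> (2 * m / d) * ((p / r) * (p / r))"
        using m d by (intro mult_right_mono divide_right_mono) auto
      finally show ?thesis by (simp add: mult_ac)
    next
      case False
      then have "shell d (y t) (w t) = 0" by (auto simp: shell_def r_def)
      moreover have "0 \<le> (m / d) * ((p / r) * (p / r))"
        using d by (intro mult_nonneg_nonneg[OF divide_nonneg_pos zero_le_square]) (auto simp: m_def)
      ultimately show ?thesis by simp
    qed
    then show ?thesis using c unfolding D_def z_def[symmetric] by argo
  qed
  ultimately show ?thesis unfolding r_def q_def by blast
qed

section \<open>Collisions: jumps and conserved quantities\<close>

lemma billiard_integral_le:
  assumes "billiard N \<gamma>" "a < b" "\<not> touching N (\<gamma> a)" "\<not> touching N (\<gamma> b)"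
    and der: "\<And>t. a \<le> t \<Longrightarrow> t \<le> b \<Longrightarrow> \<not> touching N (\<gamma> t) \<Longrightarrow> (f has_real_derivative f' t) (at t)"
    and jump: "\<And>t. a < t \<Longrightarrow> t < b \<Longrightarrow> touching N (\<gamma> t) \<Longrightarrow>
          \<exists>l r. (f \<longlongrightarrow> l) (at_left t) \<and> (f \<longlongrightarrow> r) (at_right t) \<and> l \<le> r"
  shows "\<exists>I. (f' has_integral I) {a..b} \<and> I \<le> f b - f a"
proof (rule has_integral_jumps_le[where F = "{t \<in> {a..b}. touching N (\<gamma> t)}"])
  show "finite {t \<in> {a..b}. touching N (\<gamma> t)}" using billiardD(3)[OF assms(1)] .
  have "isCont f a" "isCont f b"
    using DERIV_isCont[OF der[of a]] DERIV_isCont[OF der[of b]] assms by auto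
  then show "(f \<longlongrightarrow> f a) (at_right a)" "(f \<longlongrightarrow> f b) (at_left b)"
    by (auto simp: isCont_def filterlim_at_split)
qed (use assms in auto)

text \<open>The geometric content is the sign of \<open>p\<close>. If the pair were separating just
  before contact, its squared distance would increase up to the value 1 at time \<open>t\<close> and
  would have been below 1 earlier, which exclusion forbids. The outgoing velocities are written as
  increments of \<open>U\<close> so that jumps of sums can be computed.\<close>

lemma billiard_jump:
  assumes b: "billiard N \<gamma>" and tch: "touching N (\<gamma> t)"
  obtains i j p U R where "i \<in> {1..N}" "j \<in> {1..N}" "i \<noteq> j" "norm (fst (\<gamma> t j) - fst (\<gamma> t i)) = 1"
    "\<And>a b. a \<in> {1..N} \<Longrightarrow> b \<in> {1..N} \<Longrightarrow> a \<noteq> b \<Longrightarrow> norm (fst (\<gamma> t b) - fst (\<gamma> t a)) = 1 \<Longrightarrow>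
       (a = i \<and> b = j \<or> a = j \<and> b = i)"
    "\<And>k. k \<in> {1..N} \<Longrightarrow> ((\<lambda>\<tau>. snd (\<gamma> \<tau> k)) \<longlongrightarrow> U k) (at_left t)"
    "\<And>k. k \<in> {1..N} \<Longrightarrow> ((\<lambda>\<tau>. snd (\<gamma> \<tau> k)) \<longlongrightarrow> R k) (at_right t)"
    "\<And>k. R k = U k + (if k = i then p else 0) *\<^sub>R (fst (\<gamma> t j) - fst (\<gamma> t i))
          - (if k = j then p else 0) *\<^sub>R (fst (\<gamma> t j) - fst (\<gamma> t i))"
    "p = (fst (\<gamma> t j) - fst (\<gamma> t i)) \<bullet> (U j - U i)" "p \<le> 0"
proof -
  obtain i j U where ij: "i \<in> {1..N}" "j \<in> {1..N}" "i \<noteq> j"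
    "norm (fst (\<gamma> t j) - fst (\<gamma> t i)) = 1"
    and u: "\<And>a b. a \<in> {1..N} \<Longrightarrow> b \<in> {1..N} \<Longrightarrow> a \<noteq> b \<Longrightarrow>
         norm (fst (\<gamma> t b) - fst (\<gamma> t a)) = 1 \<Longrightarrow> (a = i \<and> b = j \<or> a = j \<and> b = i)"
    and U: "\<And>k. k \<in> {1..N} \<Longrightarrow> ((\<lambda>\<tau>. snd (\<gamma> \<tau> k)) \<longlongrightarrow> U k) (at_left t)"
      "\<And>k. k \<in> {1..N} \<Longrightarrow> ((\<lambda>\<tau>. snd (\<gamma> \<tau> k)) \<longlongrightarrow>
         scatter i j (fst (\<gamma> t j) - fst (\<gamma> t i)) U k) (at_right t)"
    by (rule billiard_collision[OF b tch], rule that)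
  define \<omega> where "\<omega> = fst (\<gamma> t j) - fst (\<gamma> t i)"
  define p where "p = \<omega> \<bullet> (U j - U i)"
  have "p \<le> 0"
  proof (rule ccontr)
    assume "\<not> p \<le> 0"
    then have p: "0 < p" by simp
    define g where "g s = (fst (\<gamma> s j) - fst (\<gamma> s i)) \<bullet> (fst (\<gamma> s j) - fst (\<gamma> s i))" for s
    define g' where "g' s = (fst (\<gamma> s j) - fst (\<gamma> s i)) \<bullet> (snd (\<gamma> s j) - snd (\<gamma> s i))" for s
    have cont: "isCont (\<lambda>s. fst (\<gamma> s k)) s" if "k \<in> {1..N}" for k s
      using billiardD(1)[OF b that] by (simp add: continuous_on_eq_continuous_at)
    have lim: "((\<lambda>s. fst (\<gamma> s k)) \<longlongrightarrow> fst (\<gamma> t k)) (at_left t)" if "k \<in> {1..N}" for k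
      using cont[OF that, of t] by (auto simp: isCont_def filterlim_at_split)
    have "(g' \<longlongrightarrow> p) (at_left t)"
      unfolding g'_def p_def \<omega>_def using ij by (intro tendsto_intros lim U(1))
    then have "\<forall>\<^sub>F s in at_left t. 0 < g' s" using p by (rule order_tendstoD)
    then obtain s0 where s0: "s0 < t" "\<And>s. s0 < s \<Longrightarrow> s < t \<Longrightarrow> 0 < g' s"
      by (auto simp: eventually_at_left_field)
    obtain e where e: "0 < e" "\<And>s. s \<noteq> t \<Longrightarrow> \<bar>s - t\<bar> < e \<Longrightarrow> \<not> touching N (\<gamma> s)"
      using billiard_punctured_free[OF b] by metis
    define s where "s = max s0 (t - e / 2)"
    have s: "s < t" "s0 \<le> s" "t - e < s" using s0(1) e(1) by (auto simp: s_def)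
    have "g s < g t"
    proof (rule DERIV_pos_imp_increasing_open[OF s(1)])
      fix x assume x: "s < x" "x < t"
      then have nt: "\<not> touching N (\<gamma> x)" using e(2)[of x] s by auto
      have dx: "((\<lambda>\<tau>. fst (\<gamma> \<tau> j) - fst (\<gamma> \<tau> i)) has_vector_derivative
         (snd (\<gamma> x j) - snd (\<gamma> x i))) (at x)"
        using billiardD(4)[OF b nt] ij by (intro has_vector_derivative_diff) auto
      have "(g has_real_derivative 2 * g' x) (at x)"
        using has_real_derivative_inner[OF dx dx] unfolding g_def g'_def by (simp add: inner_commute)
      then show "\<exists>y. (g has_real_derivative y) (at x) \<and> 0 < y"
        using s0(2)[of x] x s by (intro exI[of _ "2 * g' x"]) auto
    next
      show "continuous_on {s..t} g"
        unfolding g_def using cont ij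
        by (intro continuous_intros continuous_at_imp_continuous_on) auto
    qed
    moreover have "g t = 1" using ij(4) by (simp add: g_def dot_square_norm)
    moreover have "1 \<le> g s" using billiardD(2)[OF b ij(1-3), of s] by (simp add: g_def dot_square_norm)
    ultimately show False by simp
  qed
  then show ?thesis
    using ij u U unfolding \<omega>_def p_def
    by (intro that[of i j U "scatter i j (fst (\<gamma> t j) - fst (\<gamma> t i)) U" p])
       (auto simp: scatter_def p_def \<omega>_def)
qed

lemma billiard_isCont: "billiard N \<gamma> \<Longrightarrow> k \<in> {1..N} \<Longrightarrow> isCont (\<lambda>t. fst (\<gamma> t k)) t"
  using billiardD(1) by (auto simp: continuous_on_eq_continuous_at)

lemma billiard_position_limits:
  assumes "billiard N \<gamma>" "k \<in> {1..N}"
  shows "((\<lambda>t. fst (\<gamma> t k)) \<longlongrightarrow> fst (\<gamma> t k)) (at_left t)"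
    and "((\<lambda>t. fst (\<gamma> t k)) \<longlongrightarrow> fst (\<gamma> t k)) (at_right t)"
  using billiard_isCont[OF assms, of t] by (auto simp: isCont_def filterlim_at_split)

lemma sum_scatter_diff:
  fixes h :: "nat \<Rightarrow> 'a::real_vector \<Rightarrow> real"
  assumes "i \<in> A" "j \<in> A" "i \<noteq> j" "finite A"
    and R: "\<And>k. R k = U k + (if k = i then p else 0) *\<^sub>R \<omega> - (if k = j then p else 0) *\<^sub>R \<omega>"
  shows "(\<Sum>k\<in>A. h k (R k)) = (\<Sum>k\<in>A. h k (U k)) +
    (h i (U i + p *\<^sub>R \<omega>) - h i (U i)) + (h j (U j - p *\<^sub>R \<omega>) - h j (U j))"
proof -
  have "(\<Sum>k\<in>A. h k (R k)) - (\<Sum>k\<in>A. h k (U k)) = (\<Sum>k\<in>A. h k (R k) - h k (U k))"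
    by (simp add: sum_subtractf)
  also have "\<dots> = (\<Sum>k\<in>{i, j}. h k (R k) - h k (U k))"
    using assms by (intro sum.mono_neutral_right) auto
  finally show ?thesis using assms(3) by (simp add: R)
qed

context
  fixes N :: nat and \<gamma> :: "real \<Rightarrow> nat \<Rightarrow> 'a::euclidean_space \<times> 'a"
  assumes b: "billiard N \<gamma>"
begin

lemma
  assumes "\<not> touching N (\<gamma> t)"
  shows kinetic_deriv: "((\<lambda>\<tau>. kinetic N (\<gamma> \<tau>)) has_real_derivative 0) (at t)"
    and virial_deriv: "((\<lambda>\<tau>. virial N \<tau> (\<gamma> \<tau>)) has_real_derivative 0) (at t)"
    and retarded_deriv: "((\<lambda>\<tau>. retarded N \<tau> (\<gamma> \<tau>)) has_real_derivative 0) (at t)"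
proof -
  note x = billiardD(4)[OF b assms] and v = billiardD(5)[OF b assms]
  have y: "((\<lambda>\<tau>. fst (\<gamma> \<tau> k) - \<tau> *\<^sub>R snd (\<gamma> \<tau> k)) has_vector_derivative 0) (at t)"
    if k: "k \<in> {1..N}" for k
  proof -
    have "((\<lambda>\<tau>. \<tau> *\<^sub>R snd (\<gamma> \<tau> k)) has_vector_derivative (t *\<^sub>R 0 + 1 *\<^sub>R snd (\<gamma> t k))) (at t)"
      by (rule has_vector_derivative_scaleR[OF DERIV_ident v[OF k]])
    from has_vector_derivative_diff[OF x[OF k] this] show ?thesis by simp
  qed
  show "((\<lambda>\<tau>. kinetic N (\<gamma> \<tau>)) has_real_derivative 0) (at t)"
    unfolding kinetic_def power2_norm_eq_inner
    by (rule DERIV_cong[OF DERIV_sum[where f' = "\<lambda>_. 0"]])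
      (use has_real_derivative_inner[OF v v] in simp_all)
  show "((\<lambda>\<tau>. virial N \<tau> (\<gamma> \<tau>)) has_real_derivative 0) (at t)"
    unfolding virial_def
    by (rule DERIV_cong[OF DERIV_sum[where f' = "\<lambda>_. 0"]])
      (use has_real_derivative_inner[OF y v] in simp_all)
  show "((\<lambda>\<tau>. retarded N \<tau> (\<gamma> \<tau>)) has_real_derivative 0) (at t)"
    unfolding retarded_def power2_norm_eq_inner
    by (rule DERIV_cong[OF DERIV_sum[where f' = "\<lambda>_. 0"]])
      (use has_real_derivative_inner[OF y y] in simp_all)
qed

text \<open>The impulse is \<open>p\<close> times the normal, and the normal is the difference of
  the two positions. So the energy does not jump, the sum of the \<open>x \<bullet> v\<close> jumps
  by \<open>- p\<close>, and \<open>retarded\<close> picks up \<open>2 * t * p\<close> through its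
  mixed term. For the radial sum a lower bound is enough: every pair within reach of the cutoff is
  charged the worst possible change \<open>2 * p\<close>. For small \<open>d\<close> only the
  colliding pair is within reach.\<close>

lemma billiard_jumps:
  assumes tch: "touching N (\<gamma> t)"
  obtains p lk lv lr where "p \<le> 0"
    "((\<lambda>\<tau>. kinetic N (\<gamma> \<tau>)) \<longlongrightarrow> lk) (at_left t)" "((\<lambda>\<tau>. kinetic N (\<gamma> \<tau>)) \<longlongrightarrow> lk) (at_right t)"
    "((\<lambda>\<tau>. virial N \<tau> (\<gamma> \<tau>)) \<longlongrightarrow> lv) (at_left t)" "((\<lambda>\<tau>. virial N \<tau> (\<gamma> \<tau>)) \<longlongrightarrow> lv - p) (at_right t)"
    "((\<lambda>\<tau>. retarded N \<tau> (\<gamma> \<tau>)) \<longlongrightarrow> lr) (at_left t)"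
    "((\<lambda>\<tau>. retarded N \<tau> (\<gamma> \<tau>)) \<longlongrightarrow> lr + 2 * t * p) (at_right t)"
    "\<And>d. 0 < d \<Longrightarrow> \<exists>l r. ((\<lambda>\<tau>. \<Sum>(a, b)\<in>pairs N. radial d (fst (\<gamma> \<tau> b) - fst (\<gamma> \<tau> a)) (snd (\<gamma> \<tau> b) - snd (\<gamma> \<tau> a))) \<longlongrightarrow> l) (at_left t) \<and>
       ((\<lambda>\<tau>. \<Sum>(a, b)\<in>pairs N. radial d (fst (\<gamma> \<tau> b) - fst (\<gamma> \<tau> a)) (snd (\<gamma> \<tau> b) - snd (\<gamma> \<tau> a))) \<longlongrightarrow> r) (at_right t) \<and>
       l + 2 * p * real (card {(a, b) \<in> pairs N. norm (fst (\<gamma> t b) - fst (\<gamma> t a)) < 1 + 2 * d}) \<le> r"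
proof -
  obtain i j p U R where ij: "i \<in> {1..N}" "j \<in> {1..N}" "i \<noteq> j" "norm (fst (\<gamma> t j) - fst (\<gamma> t i)) = 1"
    and U: "\<And>k. k \<in> {1..N} \<Longrightarrow> ((\<lambda>\<tau>. snd (\<gamma> \<tau> k)) \<longlongrightarrow> U k) (at_left t)"
      "\<And>k. k \<in> {1..N} \<Longrightarrow> ((\<lambda>\<tau>. snd (\<gamma> \<tau> k)) \<longlongrightarrow> R k) (at_right t)"
    and R0: "\<And>k. R k = U k + (if k = i then p else 0) *\<^sub>R (fst (\<gamma> t j) - fst (\<gamma> t i))
          - (if k = j then p else 0) *\<^sub>R (fst (\<gamma> t j) - fst (\<gamma> t i))"
    and p0: "p = (fst (\<gamma> t j) - fst (\<gamma> t i)) \<bullet> (U j - U i)" "p \<le> 0"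
    by (rule billiard_jump[OF b tch], rule that)
  define \<omega> where "\<omega> = fst (\<gamma> t j) - fst (\<gamma> t i)"
  have R: "\<And>k. R k = U k + (if k = i then p else 0) *\<^sub>R \<omega> - (if k = j then p else 0) *\<^sub>R \<omega>"
    using R0 by (simp add: \<omega>_def)
  have \<omega>1: "\<omega> \<bullet> \<omega> = 1" using ij(4) by (simp add: \<omega>_def dot_square_norm)
  have xj: "fst (\<gamma> t j) = fst (\<gamma> t i) + \<omega>" by (simp add: \<omega>_def)
  have p: "p = \<omega> \<bullet> U j - \<omega> \<bullet> U i" using p0(1) by (simp add: \<omega>_def inner_diff_right)
  note x = billiard_position_limits[OF b]
  note ssd = sum_scatter_diff[OF ij(1-3) finite_atLeastAtMost R]
  have k: "(\<Sum>k\<in>{1..N}. (norm (R k))\<^sup>2) = (\<Sum>k\<in>{1..N}. (norm (U k))\<^sup>2)"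
    unfolding ssd[of "\<lambda>k u. (norm u)\<^sup>2"] unfolding power2_norm_eq_inner
    by (simp add: inner_add_left inner_add_right inner_diff_left inner_diff_right \<omega>1
        inner_commute[of "U _" \<omega>] p)
  have v: "(\<Sum>k\<in>{1..N}. (fst (\<gamma> t k) - t *\<^sub>R R k) \<bullet> R k) =
      (\<Sum>k\<in>{1..N}. (fst (\<gamma> t k) - t *\<^sub>R U k) \<bullet> U k) - p"
    unfolding ssd[of "\<lambda>k u. (fst (\<gamma> t k) - t *\<^sub>R u) \<bullet> u"] unfolding xj
    by (simp add: inner_add_left inner_add_right inner_diff_left inner_diff_right \<omega>1
        inner_commute p algebra_simps)
  have r: "(\<Sum>k\<in>{1..N}. (norm (fst (\<gamma> t k) - t *\<^sub>R R k))\<^sup>2) =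
      (\<Sum>k\<in>{1..N}. (norm (fst (\<gamma> t k) - t *\<^sub>R U k))\<^sup>2) + 2 * t * p"
    unfolding ssd[of "\<lambda>k u. (norm (fst (\<gamma> t k) - t *\<^sub>R u))\<^sup>2"] unfolding xj power2_norm_eq_inner
    by (simp add: inner_add_left inner_add_right inner_diff_left inner_diff_right \<omega>1
        inner_commute p algebra_simps)
  have rad: "\<exists>l r. ((\<lambda>\<tau>. \<Sum>(a, b)\<in>pairs N. radial d (fst (\<gamma> \<tau> b) - fst (\<gamma> \<tau> a)) (snd (\<gamma> \<tau> b) - snd (\<gamma> \<tau> a))) \<longlongrightarrow> l) (at_left t) \<and>
       ((\<lambda>\<tau>. \<Sum>(a, b)\<in>pairs N. radial d (fst (\<gamma> \<tau> b) - fst (\<gamma> \<tau> a)) (snd (\<gamma> \<tau> b) - snd (\<gamma> \<tau> a))) \<longlongrightarrow> r) (at_right t) \<and>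
       l + 2 * p * real (card {(a, b) \<in> pairs N. norm (fst (\<gamma> t b) - fst (\<gamma> t a)) < 1 + 2 * d}) \<le> r"
    if d: "0 < d" for d
  proof -
    define y where "y = (\<lambda>(a, b). fst (\<gamma> t b) - fst (\<gamma> t a))"
    define S where "S W = (\<Sum>(a, b)\<in>pairs N. radial d (y (a, b)) (W b - W a))" for W
    have cut: "isCont (cutoff d) r" for r
      using DERIV_isCont[OF has_real_derivative_cutoff[OF d]] .
    have r1: "1 \<le> norm (y q)" if "q \<in> pairs N" for q
      using that billiardD(2)[OF b] by (auto simp: pairs_def y_def)
    have lim: "((\<lambda>\<tau>. \<Sum>(a, b)\<in>pairs N. radial d (fst (\<gamma> \<tau> b) - fst (\<gamma> \<tau> a)) (snd (\<gamma> \<tau> b) - snd (\<gamma> \<tau> a))) \<longlongrightarrow> S W) F"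
      if "\<And>k. k \<in> {1..N} \<Longrightarrow> ((\<lambda>t. fst (\<gamma> t k)) \<longlongrightarrow> fst (\<gamma> t k)) F"
        "\<And>k. k \<in> {1..N} \<Longrightarrow> ((\<lambda>\<tau>. snd (\<gamma> \<tau> k)) \<longlongrightarrow> W k) F" for F W
      unfolding S_def
    proof (rule tendsto_sum, clarify)
      fix a b assume ab: "(a, b) \<in> pairs N"
      then have y: "((\<lambda>\<tau>. fst (\<gamma> \<tau> b) - fst (\<gamma> \<tau> a)) \<longlongrightarrow> y (a, b)) F"
        unfolding y_def split by (intro tendsto_diff that) (auto simp: pairs_def)
      have w: "((\<lambda>\<tau>. snd (\<gamma> \<tau> b) - snd (\<gamma> \<tau> a)) \<longlongrightarrow> W b - W a) F"
        using ab by (intro tendsto_diff that) (auto simp: pairs_def)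
      have "norm (y (a, b)) \<noteq> 0" using r1[OF ab] by linarith
      then show "((\<lambda>\<tau>. radial d (fst (\<gamma> \<tau> b) - fst (\<gamma> \<tau> a)) (snd (\<gamma> \<tau> b) - snd (\<gamma> \<tau> a))) \<longlongrightarrow>
          radial d (y (a, b)) (W b - W a)) F"
        unfolding radial_def
        by (intro tendsto_intros isCont_tendsto_compose[OF cut] y w)
    qed
    have step: "(if norm (y q) < 1 + 2 * d then 2 * p else 0) \<le>
        radial d (y q) (R (snd q) - R (fst q)) - radial d (y q) (U (snd q) - U (fst q))"
      if q: "q \<in> pairs N" for q
    proof -
      \<comment> \<open>According to how the pair \<open>q\<close> overlaps with the colliding one,
        \<open>e\<close> is 0, plus or minus \<open>p\<close>, or plus or minus
        \<open>2 * p\<close>.\<close>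
      obtain e where e: "R (snd q) - R (fst q) = U (snd q) - U (fst q) + e *\<^sub>R \<omega>" "\<bar>e\<bar> \<le> - 2 * p"
      proof
        show "R (snd q) - R (fst q) = U (snd q) - U (fst q) +
          (((if snd q = i then p else 0) - (if snd q = j then p else 0)) -
           ((if fst q = i then p else 0) - (if fst q = j then p else 0))) *\<^sub>R \<omega>"
          unfolding R by (simp add: algebra_simps)
        show "\<bar>((if snd q = i then p else 0) - (if snd q = j then p else 0)) -
           ((if fst q = i then p else 0) - (if fst q = j then p else 0))\<bar> \<le> - 2 * p"
          using p0(2) ij(3) by auto
      qed
      \<comment> \<open>\<open>radial\<close> is linear in the velocity, so its jump is
        \<open>radial\<close> of the velocity increment, which \<open>radial_abs_le\<close>
        controls.\<close>
      have *: "radial d (y q) (R (snd q) - R (fst q)) - radial d (y q) (U (snd q) - U (fst q)) =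
          radial d (y q) (e *\<^sub>R \<omega>)"
        unfolding e radial_def
        by (simp add: inner_add_right add_divide_distrib diff_divide_distrib algebra_simps)
      show ?thesis
      proof (cases "norm (y q) < 1 + 2 * d")
        case True
        have "\<bar>radial d (y q) (e *\<^sub>R \<omega>)\<bar> \<le> \<bar>e\<bar>"
          using radial_abs_le[OF d r1[OF q], of "e *\<^sub>R \<omega>"] ij(4) by (simp add: \<omega>_def)
        then show ?thesis using e(2) True unfolding * by auto
      next
        case False
        then show ?thesis using cutoff_eq_0[OF d] unfolding * by (auto simp: radial_def)
      qed
    qed
    have "2 * p * real (card {q \<in> pairs N. norm (y q) < 1 + 2 * d}) =
        (\<Sum>q\<in>pairs N. if norm (y q) < 1 + 2 * d then 2 * p else 0)"
      by (simp add: sum.If_cases Int_def)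
    also have "\<dots> \<le> (\<Sum>q\<in>pairs N. radial d (y q) (R (snd q) - R (fst q)) - radial d (y q) (U (snd q) - U (fst q)))"
      by (intro sum_mono step)
    also have "\<dots> = S R - S U" by (simp add: S_def case_prod_beta sum_subtractf)
    finally have "S U + 2 * p * real (card {q \<in> pairs N. norm (y q) < 1 + 2 * d}) \<le> S R" by simp
    then have "S U + 2 * p * real (card {(a, b) \<in> pairs N. norm (fst (\<gamma> t b) - fst (\<gamma> t a)) < 1 + 2 * d}) \<le> S R"
      by (simp add: y_def case_prod_beta' Collect_conj_eq)
    with lim[OF x(1) U(1)] lim[OF x(2) U(2)] show ?thesis by blast
  qed
  show ?thesis
  proof (rule that[OF p0(2) _ _ _ _ _ _ rad])
    show "((\<lambda>\<tau>. kinetic N (\<gamma> \<tau>)) \<longlongrightarrow> (\<Sum>k\<in>{1..N}. (norm (U k))\<^sup>2)) (at_left t)"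
      unfolding kinetic_def by (intro tendsto_intros U)
    show "((\<lambda>\<tau>. kinetic N (\<gamma> \<tau>)) \<longlongrightarrow> (\<Sum>k\<in>{1..N}. (norm (U k))\<^sup>2)) (at_right t)"
      unfolding kinetic_def k[symmetric] by (intro tendsto_intros U)
    show "((\<lambda>\<tau>. virial N \<tau> (\<gamma> \<tau>)) \<longlongrightarrow> (\<Sum>k\<in>{1..N}. (fst (\<gamma> t k) - t *\<^sub>R U k) \<bullet> U k)) (at_left t)"
      unfolding virial_def by (intro tendsto_intros U x)
    show "((\<lambda>\<tau>. virial N \<tau> (\<gamma> \<tau>)) \<longlongrightarrow> (\<Sum>k\<in>{1..N}. (fst (\<gamma> t k) - t *\<^sub>R U k) \<bullet> U k) - p) (at_right t)"
      unfolding virial_def v[symmetric] by (intro tendsto_intros U x)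
    show "((\<lambda>\<tau>. retarded N \<tau> (\<gamma> \<tau>)) \<longlongrightarrow> (\<Sum>k\<in>{1..N}. (norm (fst (\<gamma> t k) - t *\<^sub>R U k))\<^sup>2)) (at_left t)"
      unfolding retarded_def by (intro tendsto_intros U x)
    show "((\<lambda>\<tau>. retarded N \<tau> (\<gamma> \<tau>)) \<longlongrightarrow> (\<Sum>k\<in>{1..N}. (norm (fst (\<gamma> t k) - t *\<^sub>R U k))\<^sup>2) + 2 * t * p) (at_right t)"
      unfolding retarded_def r[symmetric] by (intro tendsto_intros U x)
  qed
qed

lemma billiard_mono:
  assumes "a \<le> c" "\<not> touching N (\<gamma> a)" "\<not> touching N (\<gamma> c)"
    and "\<And>t. a \<le> t \<Longrightarrow> t \<le> c \<Longrightarrow> \<not> touching N (\<gamma> t) \<Longrightarrow> (f has_real_derivative 0) (at t)"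
    and "\<And>t. a < t \<Longrightarrow> t < c \<Longrightarrow> touching N (\<gamma> t) \<Longrightarrow>
          \<exists>l r. (f \<longlongrightarrow> l) (at_left t) \<and> (f \<longlongrightarrow> r) (at_right t) \<and> l \<le> r"
  shows "f a \<le> f c"
proof (cases "a = c")
  case False
  then have "\<exists>I. ((\<lambda>_. 0) has_integral I) {a..c} \<and> I \<le> f c - f a"
    using assms by (intro billiard_integral_le[OF b]) auto
  then show ?thesis using has_integral_unique[OF has_integral_0] by force
qed simp

lemma kinetic_eq:
  assumes "\<not> touching N (\<gamma> s)" "\<not> touching N (\<gamma> t)"
  shows "kinetic N (\<gamma> s) = kinetic N (\<gamma> t)"
proof -
  have jump: "\<exists>l. ((\<lambda>\<tau>. kinetic N (\<gamma> \<tau>)) \<longlongrightarrow> l) (at_left \<tau>) \<and>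
      ((\<lambda>\<tau>. kinetic N (\<gamma> \<tau>)) \<longlongrightarrow> l) (at_right \<tau>)" if "touching N (\<gamma> \<tau>)" for \<tau>
    by (rule billiard_jumps[OF that]) blast
  have "kinetic N (\<gamma> s) = kinetic N (\<gamma> t)" if "s \<le> t" "\<not> touching N (\<gamma> s)" "\<not> touching N (\<gamma> t)" for s t
  proof (rule antisym)
    show "kinetic N (\<gamma> s) \<le> kinetic N (\<gamma> t)"
    proof (rule billiard_mono[OF that kinetic_deriv])
      fix \<tau> assume "touching N (\<gamma> \<tau>)"
      from jump[OF this] show "\<exists>l r. ((\<lambda>\<tau>. kinetic N (\<gamma> \<tau>)) \<longlongrightarrow> l) (at_left \<tau>) \<and>
          ((\<lambda>\<tau>. kinetic N (\<gamma> \<tau>)) \<longlongrightarrow> r) (at_right \<tau>) \<and> l \<le> r"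
        by blast
    qed
    have "- kinetic N (\<gamma> s) \<le> - kinetic N (\<gamma> t)"
    proof (rule billiard_mono[OF that, of "\<lambda>\<tau>. - kinetic N (\<gamma> \<tau>)"])
      fix \<tau> assume "touching N (\<gamma> \<tau>)"
      from jump[OF this] show "\<exists>l r. ((\<lambda>\<tau>. - kinetic N (\<gamma> \<tau>)) \<longlongrightarrow> l) (at_left \<tau>) \<and>
          ((\<lambda>\<tau>. - kinetic N (\<gamma> \<tau>)) \<longlongrightarrow> r) (at_right \<tau>) \<and> l \<le> r"
        using tendsto_minus by blast
    qed (use DERIV_minus[OF kinetic_deriv] in simp)
    then show "kinetic N (\<gamma> t) \<le> kinetic N (\<gamma> s)" by simp
  qed
  from this[of s t] this[of t s] assms show ?thesis by (metis linear)
qed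

lemma retarded_le:
  assumes "\<not> touching N (\<gamma> 0)" "\<not> touching N (\<gamma> t)"
  shows "retarded N t (\<gamma> t) \<le> inertia N (\<gamma> 0)"
proof -
  have jump: "\<exists>p l. p \<le> 0 \<and> ((\<lambda>\<tau>. retarded N \<tau> (\<gamma> \<tau>)) \<longlongrightarrow> l) (at_left \<tau>) \<and>
      ((\<lambda>\<tau>. retarded N \<tau> (\<gamma> \<tau>)) \<longlongrightarrow> l + 2 * \<tau> * p) (at_right \<tau>)" if "touching N (\<gamma> \<tau>)" for \<tau>
    by (rule billiard_jumps[OF that]) blast
  have 0: "retarded N 0 (\<gamma> 0) = inertia N (\<gamma> 0)" by (simp add: retarded_def inertia_def)
  show ?thesis
  proof (cases "0 \<le> t")
    case True
    have "- retarded N 0 (\<gamma> 0) \<le> - retarded N t (\<gamma> t)"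
    proof (rule billiard_mono[OF True assms, of "\<lambda>\<tau>. - retarded N \<tau> (\<gamma> \<tau>)"])
      fix \<tau> assume \<tau>: "0 < \<tau>" "touching N (\<gamma> \<tau>)"
      then obtain p l where "p \<le> 0" "((\<lambda>\<tau>. retarded N \<tau> (\<gamma> \<tau>)) \<longlongrightarrow> l) (at_left \<tau>)"
        "((\<lambda>\<tau>. retarded N \<tau> (\<gamma> \<tau>)) \<longlongrightarrow> l + 2 * \<tau> * p) (at_right \<tau>)" using jump by blast
      moreover from this \<tau>(1) have "\<tau> * p \<le> 0" by (simp add: mult_nonneg_nonpos)
      ultimately show "\<exists>l r. ((\<lambda>\<tau>. - retarded N \<tau> (\<gamma> \<tau>)) \<longlongrightarrow> l) (at_left \<tau>) \<and>
          ((\<lambda>\<tau>. - retarded N \<tau> (\<gamma> \<tau>)) \<longlongrightarrow> r) (at_right \<tau>) \<and> l \<le> r"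
        using tendsto_minus by fastforce
    qed (use DERIV_minus[OF retarded_deriv] in simp)
    then show ?thesis using 0 by simp
  next
    case False
    then have "t \<le> 0" by simp
    have "retarded N t (\<gamma> t) \<le> retarded N 0 (\<gamma> 0)"
    proof (rule billiard_mono[OF \<open>t \<le> 0\<close> assms(2,1) retarded_deriv])
      fix \<tau> assume \<tau>: "\<tau> < 0" "touching N (\<gamma> \<tau>)"
      then obtain p l where "p \<le> 0" "((\<lambda>\<tau>. retarded N \<tau> (\<gamma> \<tau>)) \<longlongrightarrow> l) (at_left \<tau>)"
        "((\<lambda>\<tau>. retarded N \<tau> (\<gamma> \<tau>)) \<longlongrightarrow> l + 2 * \<tau> * p) (at_right \<tau>)" using jump by blast
      moreover from this \<tau>(1) have "0 \<le> \<tau> * p" by (simp add: mult_nonpos_nonpos)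
      ultimately show "\<exists>l r. ((\<lambda>\<tau>. retarded N \<tau> (\<gamma> \<tau>)) \<longlongrightarrow> l) (at_left \<tau>) \<and>
          ((\<lambda>\<tau>. retarded N \<tau> (\<gamma> \<tau>)) \<longlongrightarrow> r) (at_right \<tau>) \<and> l \<le> r"
        by fastforce
    qed
    then show ?thesis using 0 by simp
  qed
qed

lemma virial_abs_le:
  assumes "\<not> touching N (\<gamma> 0)" "\<not> touching N (\<gamma> t)"
  shows "\<bar>virial N t (\<gamma> t)\<bar> \<le> sqrt (inertia N (\<gamma> 0)) * sqrt (kinetic N (\<gamma> 0))"
proof -
  have "\<bar>virial N t (\<gamma> t)\<bar> \<le> (\<Sum>k\<in>{1..N}. \<bar>(fst (\<gamma> t k) - t *\<^sub>R snd (\<gamma> t k)) \<bullet> snd (\<gamma> t k)\<bar>)"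
    unfolding virial_def by (rule sum_abs)
  also have "\<dots> \<le> (\<Sum>k\<in>{1..N}. \<bar>norm (fst (\<gamma> t k) - t *\<^sub>R snd (\<gamma> t k))\<bar> * \<bar>norm (snd (\<gamma> t k))\<bar>)"
    by (intro sum_mono) (simp add: Cauchy_Schwarz_ineq2)
  also have "\<dots> \<le> sqrt (retarded N t (\<gamma> t)) * sqrt (kinetic N (\<gamma> t))"
    using L2_set_mult_ineq[of "\<lambda>k. norm (fst (\<gamma> t k) - t *\<^sub>R snd (\<gamma> t k))" "\<lambda>k. norm (snd (\<gamma> t k))" "{1..N}"]
    by (simp add: L2_set_def retarded_def kinetic_def)
  also have "\<dots> \<le> sqrt (inertia N (\<gamma> 0)) * sqrt (kinetic N (\<gamma> 0))"
    unfolding kinetic_eq[OF assms(2,1)] using retarded_le[OF assms]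
    by (intro mult_right_mono) (auto simp: kinetic_def sum_nonneg)
  finally show ?thesis .
qed

text \<open>\<open>Q\<close> is built to have upward jumps only: at a collision the radial sum loses
  at most \<open>2 * \<bar>p\<bar>\<close> for each close pair, while \<open>c\<close> times the
  virial gains \<open>c * \<bar>p\<bar>\<close>. Between collisions the virial is constant, and half
  of the shell sum is at most the derivative of the radial sum plus the error term. The constant
  \<open>c\<close> is left free because it is chosen in two ways, once for all \<open>d\<close> and
  once for small \<open>d\<close>.\<close>

lemma shell_integral_le:
  fixes d c K :: real
  assumes d: "0 < d" and ac: "a < e" "\<not> touching N (\<gamma> a)" "\<not> touching N (\<gamma> e)"
    and c: "\<And>t. a < t \<Longrightarrow> t < e \<Longrightarrow> touching N (\<gamma> t) \<Longrightarrow>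
      2 * real (card {(i, j) \<in> pairs N. norm (fst (\<gamma> t j) - fst (\<gamma> t i)) < 1 + 2 * d}) \<le> c"
  defines "K \<equiv> kinetic N (\<gamma> a)"
  defines "Q \<equiv> \<lambda>t. (\<Sum>(i, j)\<in>pairs N. radial d (fst (\<gamma> t j) - fst (\<gamma> t i)) (snd (\<gamma> t j) - snd (\<gamma> t i)))
      + c * virial N t (\<gamma> t)"
  shows "(\<integral>\<^sup>+t\<in>{a..e}. ennreal (\<Sum>(i, j)\<in>pairs N.
             shell d (fst (\<gamma> t j) - fst (\<gamma> t i)) (snd (\<gamma> t j) - snd (\<gamma> t i))) \<partial>lborel)
     \<le> 2 * (ennreal (Q e - Q a) +
        (\<integral>\<^sup>+t\<in>{a..e}. ennreal (\<Sum>(i, j)\<in>pairs N.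
             if norm (fst (\<gamma> t j) - fst (\<gamma> t i)) < 1 + 2 * d then 4 * K else 0) \<partial>lborel))"
proof -
  define y where "y q t = fst (\<gamma> t (snd q)) - fst (\<gamma> t (fst q))" for q t
  define w where "w q t = snd (\<gamma> t (snd q)) - snd (\<gamma> t (fst q))" for q t
  define E where "E t = (\<Sum>q\<in>pairs N. if norm (y q t) < 1 + 2 * d then 4 * K else 0)" for t
  have K0: "0 \<le> K" by (simp add: K_def kinetic_def sum_nonneg)
  \<comment> \<open>Conservation of energy bounds each speed by \<open>sqrt K\<close>, hence each
    relative speed by twice that.\<close>
  have wK: "(norm (w q t))\<^sup>2 \<le> 4 * K" if q: "q \<in> pairs N" and t: "\<not> touching N (\<gamma> t)" for q t
  proof -
    have "K = kinetic N (\<gamma> t)" unfolding K_def by (rule kinetic_eq[OF ac(2) t])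
    then have k: "norm (snd (\<gamma> t k)) ^ 2 \<le> K" if "k \<in> {1..N}" for k
      using member_le_sum[OF that, of "\<lambda>k. (norm (snd (\<gamma> t k)))\<^sup>2"] by (simp add: kinetic_def)
    have "norm (w q t) \<le> norm (snd (\<gamma> t (snd q))) + norm (snd (\<gamma> t (fst q)))"
      unfolding w_def by (rule norm_triangle_ineq4)
    also have "\<dots> \<le> sqrt K + sqrt K"
      using q k by (intro add_mono real_le_rsqrt) (auto simp: pairs_def)
    finally have "(norm (w q t))\<^sup>2 \<le> (2 * sqrt K)\<^sup>2" by (intro power_mono) auto
    then show ?thesis using K0 by (simp add: power_mult_distrib)
  qed
  have "\<forall>q t. \<exists>D. q \<in> pairs N \<longrightarrow> \<not> touching N (\<gamma> t) \<longrightarrow>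
      ((\<lambda>\<tau>. radial d (y q \<tau>) (w q \<tau>)) has_real_derivative D) (at t) \<and>
     shell d (y q t) (w q t) \<le> 2 * (D + (if norm (y q t) < 1 + 2 * d then (norm (w q t))\<^sup>2 else 0))"
  proof (intro allI)
    fix q t
    show "\<exists>D. q \<in> pairs N \<longrightarrow> \<not> touching N (\<gamma> t) \<longrightarrow>
      ((\<lambda>\<tau>. radial d (y q \<tau>) (w q \<tau>)) has_real_derivative D) (at t) \<and>
     shell d (y q t) (w q t) \<le> 2 * (D + (if norm (y q t) < 1 + 2 * d then (norm (w q t))\<^sup>2 else 0))"
    proof (cases "q \<in> pairs N \<and> \<not> touching N (\<gamma> t)")
      case True
      then have q: "fst q \<in> {1..N}" "snd q \<in> {1..N}" "fst q \<noteq> snd q" by (auto simp: pairs_def)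
      have "(y q has_vector_derivative w q t) (at t)"
        unfolding y_def[abs_def] w_def using True q
        by (intro has_vector_derivative_diff billiardD(4)[OF b]) auto
      moreover have "(w q has_vector_derivative 0) (at t)"
        unfolding w_def[abs_def]
        using has_vector_derivative_diff[OF billiardD(5)[OF b _ q(2)] billiardD(5)[OF b _ q(1)]] True by auto
      ultimately show ?thesis
        using has_real_derivative_radial[OF d, of "y q" "w q" t] billiardD(2)[OF b q, of t]
        by (auto simp: y_def)
    qed auto
  qed
  then obtain D where D': "\<forall>q t. q \<in> pairs N \<longrightarrow> \<not> touching N (\<gamma> t) \<longrightarrow>
      ((\<lambda>\<tau>. radial d (y q \<tau>) (w q \<tau>)) has_real_derivative D q t) (at t) \<and>
     shell d (y q t) (w q t) \<le> 2 * (D q t + (if norm (y q t) < 1 + 2 * d then (norm (w q t))\<^sup>2 else 0))"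
    unfolding choice_iff by (elim exE) (rule that)
  have D: "((\<lambda>\<tau>. radial d (y q \<tau>) (w q \<tau>)) has_real_derivative D q t) (at t)"
    "shell d (y q t) (w q t) \<le> 2 * (D q t + (if norm (y q t) < 1 + 2 * d then (norm (w q t))\<^sup>2 else 0))"
    if "q \<in> pairs N" "\<not> touching N (\<gamma> t)" for q t
    using D' that by blast+
  define f' where "f' t = (\<Sum>q\<in>pairs N. D q t)" for t
  have Q: "Q = (\<lambda>t. (\<Sum>q\<in>pairs N. radial d (y q t) (w q t)) + c * virial N t (\<gamma> t))"
    by (simp add: Q_def y_def w_def case_prod_beta)
  have "\<exists>I. (f' has_integral I) {a..e} \<and> I \<le> Q e - Q a"
  proof (rule billiard_integral_le[OF b ac])
    fix t assume nt: "\<not> touching N (\<gamma> t)"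
    have "((\<lambda>t. \<Sum>q\<in>pairs N. radial d (y q t) (w q t)) has_real_derivative f' t) (at t)"
      unfolding f'_def by (intro DERIV_sum D nt)
    then show "(Q has_real_derivative f' t) (at t)"
      unfolding Q using DERIV_add[OF _ DERIV_cmult[OF virial_deriv[OF nt], of c]] by fastforce
  next
    fix t assume t: "a < t" "t < e" "touching N (\<gamma> t)"
    obtain p lv where *: "p \<le> 0" "((\<lambda>\<tau>. virial N \<tau> (\<gamma> \<tau>)) \<longlongrightarrow> lv) (at_left t)"
      "((\<lambda>\<tau>. virial N \<tau> (\<gamma> \<tau>)) \<longlongrightarrow> lv - p) (at_right t)"
      and ex: "\<exists>l r. ((\<lambda>\<tau>. \<Sum>(a, b)\<in>pairs N. radial d (fst (\<gamma> \<tau> b) - fst (\<gamma> \<tau> a)) (snd (\<gamma> \<tau> b) - snd (\<gamma> \<tau> a))) \<longlongrightarrow> l) (at_left t) \<and>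
       ((\<lambda>\<tau>. \<Sum>(a, b)\<in>pairs N. radial d (fst (\<gamma> \<tau> b) - fst (\<gamma> \<tau> a)) (snd (\<gamma> \<tau> b) - snd (\<gamma> \<tau> a))) \<longlongrightarrow> r) (at_right t) \<and>
       l + 2 * p * real (card {(a, b) \<in> pairs N. norm (fst (\<gamma> t b) - fst (\<gamma> t a)) < 1 + 2 * d}) \<le> r"
      by (rule billiard_jumps[OF t(3)], rule that) (use d in blast)+
    from ex obtain l r where lr:
      "((\<lambda>\<tau>. \<Sum>(a, b)\<in>pairs N. radial d (fst (\<gamma> \<tau> b) - fst (\<gamma> \<tau> a)) (snd (\<gamma> \<tau> b) - snd (\<gamma> \<tau> a))) \<longlongrightarrow> l) (at_left t)"
      "((\<lambda>\<tau>. \<Sum>(a, b)\<in>pairs N. radial d (fst (\<gamma> \<tau> b) - fst (\<gamma> \<tau> a)) (snd (\<gamma> \<tau> b) - snd (\<gamma> \<tau> a))) \<longlongrightarrow> r) (at_right t)"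
      "l + 2 * p * real (card {(a, b) \<in> pairs N. norm (fst (\<gamma> t b) - fst (\<gamma> t a)) < 1 + 2 * d}) \<le> r"
      by blast
    have "p * c \<le> p * (2 * real (card {(i, j) \<in> pairs N. norm (fst (\<gamma> t j) - fst (\<gamma> t i)) < 1 + 2 * d}))"
      using c[OF t] *(1) by (rule mult_left_mono_neg)
    then have "l + c * lv \<le> r + c * (lv - p)" using lr(3) by (simp add: algebra_simps)
    moreover have "(Q \<longlongrightarrow> l + c * lv) (at_left t)" "(Q \<longlongrightarrow> r + c * (lv - p)) (at_right t)"
      unfolding Q_def by (intro tendsto_intros * lr)+
    ultimately show "\<exists>l r. (Q \<longlongrightarrow> l) (at_left t) \<and> (Q \<longlongrightarrow> r) (at_right t) \<and> l \<le> r"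
      by blast
  qed
  then obtain I where I: "(f' has_integral I) {a..e}" "I \<le> Q e - Q a" by blast
  have y_meas: "y q \<in> borel_measurable borel" if "q \<in> pairs N" for q
    unfolding y_def[abs_def] using that billiardD(1)[OF b]
    by (intro borel_measurable_diff borel_measurable_continuous_onI) (auto simp: pairs_def)
  have E_meas: "E \<in> borel_measurable borel"
    unfolding E_def[abs_def] using y_meas[measurable] by measurable
  have E0: "0 \<le> E t" for t unfolding E_def using K0 by (intro sum_nonneg) auto
  \<comment> \<open>Finiteness of the error integral turns it into a gauge integral, which can be
    added to that of \<open>f'\<close>.\<close>
  have "(\<integral>\<^sup>+t. ennreal (E t * indicator {a..e} t) \<partial>lborel) \<le>
      (\<integral>\<^sup>+t. ennreal (real (card (pairs N)) * (4 * K)) * indicator {a..e} t \<partial>lborel)"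
  proof (intro nn_integral_mono)
    fix t
    have "E t \<le> (\<Sum>q\<in>pairs N. 4 * K)" unfolding E_def using K0 by (intro sum_mono) auto
    then show "ennreal (E t * indicator {a..e} t) \<le>
      ennreal (real (card (pairs N)) * (4 * K)) * indicator {a..e} t"
      by (auto simp: indicator_def intro: ennreal_leI)
  qed
  also have "\<dots> < \<infinity>" using ac(1) by (simp add: nn_integral_cmult ennreal_mult_less_top)
  finally have Efin: "(\<integral>\<^sup>+t. ennreal (E t * indicator {a..e} t) \<partial>lborel) < \<infinity>" .
  then obtain J where J: "(\<integral>\<^sup>+t. ennreal (E t * indicator {a..e} t) \<partial>lborel) = ennreal J" "0 \<le> J"
    by (cases "\<integral>\<^sup>+t. ennreal (E t * indicator {a..e} t) \<partial>lborel" rule: ennreal_cases) auto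
  have "((\<lambda>t. E t * indicator {a..e} t) has_integral J) UNIV"
    by (rule nn_integral_has_integral[OF _ _ J]) (use E_meas E0 in auto)
  moreover have "(\<lambda>t. E t * indicator {a..e} t) = (\<lambda>t. if t \<in> {a..e} then E t else 0)"
    by (auto simp: indicator_def)
  ultimately have EJ: "(E has_integral J) {a..e}" by (simp only: has_integral_restrict_UNIV)
  define F where "F = {t \<in> {a..e}. touching N (\<gamma> t)}"
  have F: "finite F" unfolding F_def by (rule billiardD(3)[OF b])
  \<comment> \<open>At contact times nothing is known about \<open>f'\<close>; the value 0 on this
    finite set makes \<open>g\<close> nonnegative on the whole interval.\<close>
  define g where "g t = (if t \<in> F then 0 else f' t + E t)" for t
  have sh: "(\<Sum>q\<in>pairs N. shell d (y q t) (w q t)) \<le> 2 * g t" if "t \<in> {a..e}" "t \<notin> F" for t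
  proof -
    have nt: "\<not> touching N (\<gamma> t)" using that by (auto simp: F_def)
    have "(\<Sum>q\<in>pairs N. shell d (y q t) (w q t)) \<le>
        (\<Sum>q\<in>pairs N. 2 * (D q t + (if norm (y q t) < 1 + 2 * d then 4 * K else 0)))"
    proof (rule sum_mono)
      fix q assume q: "q \<in> pairs N"
      show "shell d (y q t) (w q t) \<le> 2 * (D q t + (if norm (y q t) < 1 + 2 * d then 4 * K else 0))"
        using D(2)[OF q nt] wK[OF q nt] by (auto split: if_splits)
    qed
    also have "\<dots> = 2 * g t"
      using that by (simp add: g_def f'_def E_def sum.distrib sum_distrib_left)
    finally show ?thesis .
  qed
  have sh0: "0 \<le> shell d y w" for y w :: 'a using d by (simp add: shell_def)
  have g0: "0 \<le> g t" if "t \<in> {a..e}" for t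
  proof (cases "t \<in> F")
    case False
    have "0 \<le> (\<Sum>q\<in>pairs N. shell d (y q t) (w q t))" by (intro sum_nonneg sh0)
    then show ?thesis using sh[OF that False] by simp
  qed (simp add: g_def)
  have "(g has_integral (I + J)) {a..e}"
    by (rule has_integral_spike_finite[OF F _ has_integral_add[OF I(1) EJ]]) (auto simp: g_def)
  then have "((\<lambda>t. 2 * g t) has_integral 2 * (I + J)) {a..e}" by (rule has_integral_mult_right)
  \<comment> \<open>For a nonnegative integrand, the gauge integral supplied by the fundamental
    theorem is also the Lebesgue integral.\<close>
  from nn_integral_has_integral_lebesgue'[OF _ this] g0
  have g: "(\<integral>\<^sup>+t. ennreal (2 * g t) * indicator {a..e} t \<partial>lborel) = ennreal (2 * (I + J))" by simp
  have "(\<integral>\<^sup>+t\<in>{a..e}. ennreal (\<Sum>q\<in>pairs N. shell d (y q t) (w q t)) \<partial>lborel)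
      \<le> (\<integral>\<^sup>+t. ennreal (2 * g t) * indicator {a..e} t \<partial>lborel)"
  proof (rule nn_integral_mono_AE)
    have "AE t in lborel. t \<notin> F"
      using F by (intro AE_not_in finite_imp_null_set_lborel)
    then show "AE t in lborel. ennreal (\<Sum>q\<in>pairs N. shell d (y q t) (w q t)) * indicator {a..e} t
        \<le> ennreal (2 * g t) * indicator {a..e} t"
    proof eventually_elim
      fix t assume "t \<notin> F"
      then have "t \<in> {a..e} \<Longrightarrow> ennreal (\<Sum>q\<in>pairs N. shell d (y q t) (w q t)) \<le> ennreal (2 * g t)"
        by (intro ennreal_leI sh)
      then show "ennreal (\<Sum>q\<in>pairs N. shell d (y q t) (w q t)) * indicator {a..e} t
        \<le> ennreal (2 * g t) * indicator {a..e} t"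
        by (auto simp: indicator_def)
    qed
  qed
  also have "\<dots> \<le> 2 * (ennreal (Q e - Q a) + ennreal J)"
  proof -
    \<comment> \<open>\<open>ennreal\<close> sends a negative increment of \<open>Q\<close> to 0,
      hence the maximum.\<close>
    have "ennreal (2 * (I + J)) \<le> ennreal (2 * (max 0 (Q e - Q a) + J))"
      using I(2) by (intro ennreal_leI) auto
    also have "\<dots> = 2 * (ennreal (Q e - Q a) + ennreal J)"
      using J(2) by (simp add: ennreal_mult' ennreal_plus max_def ennreal_neg)
    finally show ?thesis unfolding g .
  qed
  also have "ennreal J = (\<integral>\<^sup>+t\<in>{a..e}. ennreal (E t) \<partial>lborel)"
    unfolding J(1)[symmetric] by (intro nn_integral_cong) (auto simp: indicator_def)
  finally show ?thesis
    unfolding E_def y_def w_def by (simp add: case_prod_beta)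
qed

end

section \<open>Shell integrals over a time window\<close>

definition shells :: "real \<Rightarrow> nat \<Rightarrow> (nat \<Rightarrow> 'a::euclidean_space \<times> 'a) \<Rightarrow> real" where
  "shells d N Z = (\<Sum>(i, j)\<in>pairs N. shell d (fst (Z j) - fst (Z i)) (snd (Z j) - snd (Z i)))"

lemma card_pairs_le: "card (pairs N) \<le> N * N"
proof -
  have "card (pairs N) \<le> card ({1..N} \<times> {1..N})"
    by (rule card_mono) (auto simp: pairs_def)
  then show ?thesis by simp
qed

lemma kinetic_nonneg: "0 \<le> kinetic N Z"
  by (simp add: kinetic_def sum_nonneg)

lemma inertia_nonneg: "0 \<le> inertia N Z"
  by (simp add: inertia_def sum_nonneg)

lemma relative_velocity_le:
  assumes "(i, j) \<in> pairs N"
  shows "norm (snd (Z j) - snd (Z i)) \<le> 2 * sqrt (kinetic N Z)"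
proof -
  have k: "norm (snd (Z k)) \<le> sqrt (kinetic N Z)" if "k \<in> {1..N}" for k
    using member_le_sum[OF that, of "\<lambda>k. (norm (snd (Z k)))\<^sup>2"]
    by (intro real_le_rsqrt) (simp add: kinetic_def)
  have "norm (snd (Z j) - snd (Z i)) \<le> norm (snd (Z j)) + norm (snd (Z i))"
    by (rule norm_triangle_ineq4)
  then show ?thesis using k[of i] k[of j] assms by (simp add: pairs_def)
qed

context
  fixes N :: nat and \<gamma> :: "real \<Rightarrow> nat \<Rightarrow> 'a::euclidean_space \<times> 'a"
  assumes b: "billiard N \<gamma>" and free: "\<not> touching N (\<gamma> 0)"
begin

text \<open>A unit interval is infinite and contains finitely many contact times. The ends of a time
  window are moved outwards to such free times, where \<open>Q\<close> is continuous and the bounds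
  on energy and virial apply.\<close>

lemma billiard_free_time:
  obtains u where "s \<le> u" "u \<le> s + 1" "\<not> touching N (\<gamma> u)"
proof -
  have "infinite ({s..s + 1} - {t \<in> {s..s + 1}. touching N (\<gamma> t)})"
    by (intro Diff_infinite_finite billiardD(3)[OF b] infinite_Icc) simp
  then obtain u where "u \<in> {s..s + 1} - {t \<in> {s..s + 1}. touching N (\<gamma> t)}"
    using infinite_imp_nonempty by blast
  then show ?thesis using that by auto
qed

lemma position_measurable:
  "k \<in> {1..N} \<Longrightarrow> (\<lambda>t. fst (\<gamma> t k)) \<in> borel_measurable borel"
  using billiardD(1)[OF b] by (rule borel_measurable_continuous_onI)

lemma radial_sum_abs_le:
  assumes d: "0 < d" and t: "\<not> touching N (\<gamma> t)"
  shows "\<bar>\<Sum>(i, j)\<in>pairs N. radial d (fst (\<gamma> t j) - fst (\<gamma> t i)) (snd (\<gamma> t j) - snd (\<gamma> t i))\<bar>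
    \<le> real (N * N) * (2 * sqrt (kinetic N (\<gamma> 0)))"
proof -
  have "\<bar>\<Sum>(i, j)\<in>pairs N. radial d (fst (\<gamma> t j) - fst (\<gamma> t i)) (snd (\<gamma> t j) - snd (\<gamma> t i))\<bar>
      \<le> (\<Sum>(i, j)\<in>pairs N. \<bar>radial d (fst (\<gamma> t j) - fst (\<gamma> t i)) (snd (\<gamma> t j) - snd (\<gamma> t i))\<bar>)"
    by (rule order_trans[OF sum_abs]) (simp add: case_prod_beta)
  also have "\<dots> \<le> (\<Sum>q\<in>pairs N. 2 * sqrt (kinetic N (\<gamma> 0)))"
  proof (rule sum_mono, clarify)
    fix i j assume q: "(i, j) \<in> pairs N"
    have "\<bar>radial d (fst (\<gamma> t j) - fst (\<gamma> t i)) (snd (\<gamma> t j) - snd (\<gamma> t i))\<bar>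
        \<le> norm (snd (\<gamma> t j) - snd (\<gamma> t i))"
      using q billiardD(2)[OF b] by (intro radial_abs_le[OF d]) (auto simp: pairs_def)
    also have "\<dots> \<le> 2 * sqrt (kinetic N (\<gamma> 0))"
      using relative_velocity_le[OF q, of "\<gamma> t"] unfolding kinetic_eq[OF b t free] .
    finally show "\<bar>radial d (fst (\<gamma> t j) - fst (\<gamma> t i)) (snd (\<gamma> t j) - snd (\<gamma> t i))\<bar>
        \<le> 2 * sqrt (kinetic N (\<gamma> 0))" .
  qed
  also have "\<dots> \<le> real (N * N) * (2 * sqrt (kinetic N (\<gamma> 0)))"
    unfolding sum_constant using card_pairs_le[of N] kinetic_nonneg[of N "\<gamma> 0"]
    by (intro mult_right_mono) (auto simp del: of_nat_mult)
  finally show ?thesis .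
qed

text \<open>Uniform in \<open>d\<close>, and crude because every pair is treated as close to
  contact. It serves to dominate a sequence of integrals over a fixed window, so its growth in
  \<open>T\<close> does no harm.\<close>

lemma shells_integral_bound:
  assumes d: "0 < d" and T: "0 < T"
  shows "(\<integral>\<^sup>+t\<in>{-T..T}. ennreal (shells d N (\<gamma> t)) \<partial>lborel) \<le>
    ennreal (2 * (real (N * N) * (4 * sqrt (kinetic N (\<gamma> 0))
      + 4 * (sqrt (inertia N (\<gamma> 0)) * sqrt (kinetic N (\<gamma> 0)))
      + 4 * kinetic N (\<gamma> 0) * (2 * T + 2))))"
proof -
  obtain a where a: "- T - 1 \<le> a" "a \<le> - T" "\<not> touching N (\<gamma> a)"
    by (rule billiard_free_time[of "- T - 1"]) simp
  obtain e where e: "T \<le> e" "e \<le> T + 1" "\<not> touching N (\<gamma> e)"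
    by (rule billiard_free_time[of T]) simp
  define K where "K = kinetic N (\<gamma> 0)"
  define V where "V = sqrt (inertia N (\<gamma> 0)) * sqrt (kinetic N (\<gamma> 0))"
  \<comment> \<open>The worst case in \<open>shell_integral_le\<close>: all ordered pairs, at most
    \<open>N * N\<close> of them, are close at a collision.\<close>
  define c where "c = 2 * real (N * N)"
  define S where "S t = (\<Sum>(i, j)\<in>pairs N. radial d (fst (\<gamma> t j) - fst (\<gamma> t i)) (snd (\<gamma> t j) - snd (\<gamma> t i)))" for t
  have ae: "a < e" using a e T by simp
  have Ka: "kinetic N (\<gamma> a) = K" unfolding K_def by (rule kinetic_eq[OF b a(3) free])
  have K0: "0 \<le> K" unfolding K_def by (rule kinetic_nonneg)
  have c: "2 * real (card {(i, j) \<in> pairs N. norm (fst (\<gamma> t j) - fst (\<gamma> t i)) < 1 + 2 * d}) \<le> c" for t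
  proof -
    have "card {(i, j) \<in> pairs N. norm (fst (\<gamma> t j) - fst (\<gamma> t i)) < 1 + 2 * d} \<le> card (pairs N)"
      by (rule card_mono) auto
    also have "\<dots> \<le> N * N" by (rule card_pairs_le)
    finally show ?thesis unfolding c_def by linarith
  qed
  have "(\<integral>\<^sup>+t\<in>{-T..T}. ennreal (shells d N (\<gamma> t)) \<partial>lborel) \<le>
      (\<integral>\<^sup>+t\<in>{a..e}. ennreal (shells d N (\<gamma> t)) \<partial>lborel)"
    using a e by (intro nn_integral_mono) (auto simp: indicator_def)
  also have "\<dots> \<le> 2 * (ennreal ((S e + c * virial N e (\<gamma> e)) - (S a + c * virial N a (\<gamma> a))) +
        (\<integral>\<^sup>+t\<in>{a..e}. ennreal (\<Sum>(i, j)\<in>pairs N.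
             if norm (fst (\<gamma> t j) - fst (\<gamma> t i)) < 1 + 2 * d then 4 * K else 0) \<partial>lborel))"
    using shell_integral_le[OF b d ae a(3) e(3) c] unfolding Ka S_def shells_def .
  also have "\<dots> \<le> 2 * (ennreal (real (N * N) * (4 * sqrt K + 4 * V)) + ennreal (real (N * N) * (4 * K * (2 * T + 2))))"
  proof (intro mult_left_mono add_mono ennreal_leI)
    have "S e + c * virial N e (\<gamma> e) - (S a + c * virial N a (\<gamma> a)) \<le>
        \<bar>S e\<bar> + \<bar>S a\<bar> + c * (\<bar>virial N e (\<gamma> e)\<bar> + \<bar>virial N a (\<gamma> a)\<bar>)"
    proof -
      have "c * virial N e (\<gamma> e) - c * virial N a (\<gamma> a) \<le> c * (\<bar>virial N e (\<gamma> e)\<bar> + \<bar>virial N a (\<gamma> a)\<bar>)"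
        unfolding right_diff_distrib[symmetric] c_def by (intro mult_left_mono) auto
      then show ?thesis by linarith
    qed
    also have "\<dots> \<le> real (N * N) * (2 * sqrt K) + real (N * N) * (2 * sqrt K) + c * (V + V)"
      unfolding S_def K_def V_def c_def
      by (intro add_mono mult_left_mono radial_sum_abs_le d a(3) e(3) virial_abs_le b free) auto
    also have "\<dots> = real (N * N) * (4 * sqrt K + 4 * V)"
      by (simp add: c_def algebra_simps)
    finally show "S e + c * virial N e (\<gamma> e) - (S a + c * virial N a (\<gamma> a)) \<le>
      real (N * N) * (4 * sqrt K + 4 * V)" .
    have "(\<integral>\<^sup>+t\<in>{a..e}. ennreal (\<Sum>(i, j)\<in>pairs N.
             if norm (fst (\<gamma> t j) - fst (\<gamma> t i)) < 1 + 2 * d then 4 * K else 0) \<partial>lborel)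
      \<le> (\<integral>\<^sup>+t. ennreal (real (N * N) * (4 * K)) * indicator {a..e} t \<partial>lborel)"
    proof (intro nn_integral_mono mult_right_mono ennreal_leI)
      fix t
      have "(\<Sum>(i, j)\<in>pairs N. if norm (fst (\<gamma> t j) - fst (\<gamma> t i)) < 1 + 2 * d then 4 * K else 0)
          \<le> (\<Sum>q\<in>pairs N. 4 * K)" using K0 by (intro sum_mono) auto
      also have "\<dots> \<le> real (N * N) * (4 * K)"
        unfolding sum_constant using card_pairs_le[of N] K0
        by (intro mult_right_mono) (auto simp del: of_nat_mult)
      finally show "(\<Sum>(i, j)\<in>pairs N. if norm (fst (\<gamma> t j) - fst (\<gamma> t i)) < 1 + 2 * d then 4 * K else 0)
          \<le> real (N * N) * (4 * K)" .
    qed simp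
    also have "\<dots> = ennreal (real (N * N) * (4 * K) * (e - a))"
      using ae K0 by (simp add: nn_integral_cmult ennreal_mult')
    also have "\<dots> \<le> ennreal (real (N * N) * (4 * K * (2 * T + 2)))"
      unfolding mult.assoc using a e K0 by (intro ennreal_leI mult_left_mono) auto
    finally show "(\<integral>\<^sup>+t\<in>{a..e}. ennreal (\<Sum>(i, j)\<in>pairs N.
             if norm (fst (\<gamma> t j) - fst (\<gamma> t i)) < 1 + 2 * d then 4 * K else 0) \<partial>lborel)
      \<le> ennreal (real (N * N) * (4 * K * (2 * T + 2)))" .
  qed simp
  also have "\<dots> = ennreal (2 * (real (N * N) * (4 * sqrt K + 4 * V + 4 * K * (2 * T + 2))))"
  proof -
    have "0 \<le> V" unfolding V_def using inertia_nonneg kinetic_nonneg by (intro mult_nonneg_nonneg) auto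
    then show ?thesis using K0 T
      by (subst ennreal_plus[symmetric]) (auto simp: ennreal_mult' algebra_simps)
  qed
  finally show ?thesis unfolding K_def V_def .
qed

text \<open>A fixed window contains finitely many collisions, all binary. So at the collision times
  and at both ends, pairs not in contact keep a distance of at least \<open>1 + \<eta>\<close> for
  some positive \<open>\<eta>\<close>. Once \<open>2 * \<delta> n\<close> is at most
  \<open>\<eta>\<close>, only the two orderings of the colliding pair are close, which allows
  \<open>c = 4\<close>, and the radial sums vanish at both ends. The error term disappears in the
  limit. What remains is \<open>2 * (4 * (2 * V))\<close>.\<close>

lemma shells_integral_limsup:
  assumes T: "0 < T"
  shows "limsup (\<lambda>n. \<integral>\<^sup>+t\<in>{-T..T}. ennreal (shells (1 / real (Suc n)) N (\<gamma> t)) \<partial>lborel) \<le>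
    ennreal (16 * (sqrt (inertia N (\<gamma> 0)) * sqrt (kinetic N (\<gamma> 0))))"
proof -
  obtain a where a: "- T - 1 \<le> a" "a \<le> - T" "\<not> touching N (\<gamma> a)"
    by (rule billiard_free_time[of "- T - 1"]) simp
  obtain e where e: "T \<le> e" "e \<le> T + 1" "\<not> touching N (\<gamma> e)"
    by (rule billiard_free_time[of T]) simp
  define K where "K = kinetic N (\<gamma> 0)"
  define V where "V = sqrt (inertia N (\<gamma> 0)) * sqrt (kinetic N (\<gamma> 0))"
  define \<delta> where "\<delta> n = 1 / real (Suc n)" for n
  define S where "S d t = (\<Sum>(i, j)\<in>pairs N. radial d (fst (\<gamma> t j) - fst (\<gamma> t i)) (snd (\<gamma> t j) - snd (\<gamma> t i)))" for d t
  define E where "E n t = (\<Sum>(i, j)\<in>pairs N.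
     if norm (fst (\<gamma> t j) - fst (\<gamma> t i)) < 1 + 2 * \<delta> n then 4 * K else 0)" for n t
  have \<delta>0: "0 < \<delta> n" for n by (simp add: \<delta>_def)
  have \<delta>lim: "\<delta> \<longlonglongrightarrow> 0" unfolding \<delta>_def[abs_def] using LIMSEQ_inverse_real_of_nat
    by (simp add: inverse_eq_divide)
  have ae: "a < e" using a e T by simp
  have Ka: "kinetic N (\<gamma> a) = K" unfolding K_def by (rule kinetic_eq[OF b a(3) free])
  have K0: "0 \<le> K" unfolding K_def by (rule kinetic_nonneg)
  define F where "F = {t \<in> {a..e}. touching N (\<gamma> t)}"
  have F: "finite F" unfolding F_def by (rule billiardD(3)[OF b])
  \<comment> \<open>The nonzero gaps of all pairs at the finitely many relevant times. The 1
    inserted next to them keeps the minimum defined if there are none.\<close>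
  define R where "R = (\<lambda>(t, i, j). norm (fst (\<gamma> t j) - fst (\<gamma> t i)) - 1) ` (insert a (insert e F) \<times> pairs N) - {0}"
  have finR: "finite (insert 1 R)" unfolding R_def using F by auto
  have R0: "0 < x" if "x \<in> R" for x
  proof -
    have "\<exists>t i j. (i, j) \<in> pairs N \<and> x = norm (fst (\<gamma> t j) - fst (\<gamma> t i)) - 1 \<and> x \<noteq> 0"
      using that unfolding R_def by (elim DiffE imageE SigmaE) auto
    then obtain t i j where "(i, j) \<in> pairs N" "x = norm (fst (\<gamma> t j) - fst (\<gamma> t i)) - 1" "x \<noteq> 0"
      by blast
    then show ?thesis using billiardD(2)[OF b, of i j t] by (simp add: pairs_def)
  qed
  define \<eta> where "\<eta> = Min (insert 1 R)"
  have \<eta>: "0 < \<eta>" unfolding \<eta>_def using finR R0 by (subst Min_gr_iff) auto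
  have gap: "norm (fst (\<gamma> t j) - fst (\<gamma> t i)) = 1 \<or> 1 + \<eta> \<le> norm (fst (\<gamma> t j) - fst (\<gamma> t i))"
    if "t \<in> insert a (insert e F)" "(i, j) \<in> pairs N" for t i j
  proof (cases "norm (fst (\<gamma> t j) - fst (\<gamma> t i)) = 1")
    case False
    then have "norm (fst (\<gamma> t j) - fst (\<gamma> t i)) - 1 \<in> R"
      unfolding R_def using that by (intro DiffI image_eqI[of _ _ "(t, i, j)"]) auto
    then have "\<eta> \<le> norm (fst (\<gamma> t j) - fst (\<gamma> t i)) - 1"
      unfolding \<eta>_def using finR by (intro Min_le) auto
    then show ?thesis by simp
  qed simp
  have main: "(\<integral>\<^sup>+t\<in>{-T..T}. ennreal (shells (\<delta> n) N (\<gamma> t)) \<partial>lborel) \<le>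
      2 * (ennreal (8 * V) + (\<integral>\<^sup>+t. ennreal (E n t) * indicator {a..e} t \<partial>lborel))"
    if n: "2 * \<delta> n \<le> \<eta>" for n
  proof -
    have c: "2 * real (card {(i, j) \<in> pairs N. norm (fst (\<gamma> t j) - fst (\<gamma> t i)) < 1 + 2 * \<delta> n}) \<le> 4"
      if t: "a < t" "t < e" "touching N (\<gamma> t)" for t
    proof -
      obtain i j where ij: "\<And>a b. a \<in> {1..N} \<Longrightarrow> b \<in> {1..N} \<Longrightarrow> a \<noteq> b \<Longrightarrow>
         norm (fst (\<gamma> t b) - fst (\<gamma> t a)) = 1 \<Longrightarrow> (a = i \<and> b = j \<or> a = j \<and> b = i)"
        by (rule billiard_collision[OF b t(3)], rule that)
      have "{(i, j) \<in> pairs N. norm (fst (\<gamma> t j) - fst (\<gamma> t i)) < 1 + 2 * \<delta> n} \<subseteq> {(i, j), (j, i)}"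
      proof (rule subsetI)
        fix q assume "q \<in> {(i, j) \<in> pairs N. norm (fst (\<gamma> t j) - fst (\<gamma> t i)) < 1 + 2 * \<delta> n}"
        then obtain k l where kl: "q = (k, l)" "(k, l) \<in> pairs N"
          "norm (fst (\<gamma> t l) - fst (\<gamma> t k)) < 1 + 2 * \<delta> n" by blast
        have "t \<in> F" using t by (simp add: F_def)
        then have "norm (fst (\<gamma> t l) - fst (\<gamma> t k)) = 1" using gap[of t k l] kl n by auto
        then show "q \<in> {(i, j), (j, i)}" using ij[of k l] kl by (auto simp: pairs_def)
      qed
      then have "card {(i, j) \<in> pairs N. norm (fst (\<gamma> t j) - fst (\<gamma> t i)) < 1 + 2 * \<delta> n} \<le> card {(i, j), (j, i)}"
        by (rule card_mono[rotated]) simp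
      also have "\<dots> \<le> 2" by (cases "i = j") simp_all
      finally show ?thesis by linarith
    qed
    have S0: "S (\<delta> n) t = 0" if "t = a \<or> t = e" for t
      unfolding S_def
    proof (rule sum.neutral, clarify)
      fix i j assume ij: "(i, j) \<in> pairs N"
      have "norm (fst (\<gamma> t j) - fst (\<gamma> t i)) \<noteq> 1"
      proof -
        have "\<not> touching N (\<gamma> t)" using that a(3) e(3) by blast
        moreover have "i \<in> {1..N}" "j \<in> {1..N}" "i \<noteq> j" using ij by (auto simp: pairs_def)
        ultimately show ?thesis unfolding touching_def by blast
      qed
      then have "1 + 2 * \<delta> n \<le> norm (fst (\<gamma> t j) - fst (\<gamma> t i))" using gap[OF _ ij, of t] that n by fastforce
      then show "radial (\<delta> n) (fst (\<gamma> t j) - fst (\<gamma> t i)) (snd (\<gamma> t j) - snd (\<gamma> t i)) = 0"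
        using cutoff_eq_0[OF \<delta>0] by (simp add: radial_def)
    qed
    have "(\<integral>\<^sup>+t\<in>{-T..T}. ennreal (shells (\<delta> n) N (\<gamma> t)) \<partial>lborel) \<le>
        (\<integral>\<^sup>+t\<in>{a..e}. ennreal (shells (\<delta> n) N (\<gamma> t)) \<partial>lborel)"
      using a e by (intro nn_integral_mono) (auto simp: indicator_def)
    also have "\<dots> \<le> 2 * (ennreal ((S (\<delta> n) e + 4 * virial N e (\<gamma> e)) - (S (\<delta> n) a + 4 * virial N a (\<gamma> a))) +
        (\<integral>\<^sup>+t. ennreal (E n t) * indicator {a..e} t \<partial>lborel))"
      using shell_integral_le[OF b \<delta>0 ae a(3) e(3) c] unfolding Ka S_def shells_def E_def .
    also have "\<dots> \<le> 2 * (ennreal (8 * V) + (\<integral>\<^sup>+t. ennreal (E n t) * indicator {a..e} t \<partial>lborel))"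
      using S0 virial_abs_le[OF b free a(3)] virial_abs_le[OF b free e(3)]
      by (intro mult_left_mono add_right_mono ennreal_leI) (auto simp: V_def)
    finally show ?thesis .
  qed
  \<comment> \<open>At a time without contact all distances exceed 1, so \<open>E n t\<close> is 0
    for large \<open>n\<close>; the contact times form a null set.\<close>
  have "(\<lambda>n. \<integral>\<^sup>+t. ennreal (E n t) * indicator {a..e} t \<partial>lborel) \<longlonglongrightarrow> (\<integral>\<^sup>+(t::real). 0 \<partial>lborel)"
  proof (rule nn_integral_dominated_convergence[where
        w = "\<lambda>t. ennreal (real (card (pairs N)) * (4 * K)) * indicator {a..e} t"])
    show "(\<lambda>t. ennreal (E n t) * indicator {a..e} t) \<in> borel_measurable lborel" for n
    proof -
      have [measurable]: "(\<lambda>t. fst (\<gamma> t (snd q)) - fst (\<gamma> t (fst q))) \<in> borel_measurable borel"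
        if "q \<in> pairs N" for q
        using that by (intro borel_measurable_diff position_measurable) (auto simp: pairs_def)
      show ?thesis unfolding E_def[abs_def] case_prod_beta by measurable
    qed
    show "(\<integral>\<^sup>+t. ennreal (real (card (pairs N)) * (4 * K)) * indicator {a..e} t \<partial>lborel) < \<infinity>"
      using ae by (simp add: nn_integral_cmult ennreal_mult_less_top)
    show "AE t in lborel. ennreal (E n t) * indicator {a..e} t \<le>
        ennreal (real (card (pairs N)) * (4 * K)) * indicator {a..e} t" for n
    proof (intro AE_I2 mult_right_mono ennreal_leI)
      fix t
      have "E n t \<le> (\<Sum>q\<in>pairs N. 4 * K)" unfolding E_def using K0 by (intro sum_mono) auto
      then show "E n t \<le> real (card (pairs N)) * (4 * K)" by simp
    qed simp
    have "AE t in lborel. t \<notin> F"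
      using F by (intro AE_not_in finite_imp_null_set_lborel)
    then show "AE t in lborel. (\<lambda>n. ennreal (E n t) * indicator {a..e} t) \<longlonglongrightarrow> 0"
    proof eventually_elim
      fix t assume t: "t \<notin> F"
      show "(\<lambda>n. ennreal (E n t) * indicator {a..e} t) \<longlonglongrightarrow> 0"
      proof (cases "t \<in> {a..e}")
        case True
        then have nt: "\<not> touching N (\<gamma> t)" using t by (simp add: F_def)
        have "\<forall>\<^sub>F n in sequentially. \<forall>q\<in>pairs N. 1 + 2 * \<delta> n < norm (fst (\<gamma> t (snd q)) - fst (\<gamma> t (fst q)))"
        proof (subst eventually_ball_finite_distrib)
          show "\<forall>q\<in>pairs N. \<forall>\<^sub>F n in sequentially. 1 + 2 * \<delta> n < norm (fst (\<gamma> t (snd q)) - fst (\<gamma> t (fst q)))"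
          proof
            fix q assume q: "q \<in> pairs N"
            have "1 < norm (fst (\<gamma> t (snd q)) - fst (\<gamma> t (fst q)))"
            proof -
              have q': "fst q \<in> {1..N}" "snd q \<in> {1..N}" "fst q \<noteq> snd q"
                using q by (auto simp: pairs_def)
              then have "norm (fst (\<gamma> t (snd q)) - fst (\<gamma> t (fst q))) \<noteq> 1"
                using nt unfolding touching_def by blast
              then show ?thesis using billiardD(2)[OF b q', of t] by simp
            qed
            moreover have "(\<lambda>n. 1 + 2 * \<delta> n) \<longlonglongrightarrow> 1 + 2 * 0" by (intro tendsto_intros \<delta>lim)
            ultimately show "\<forall>\<^sub>F n in sequentially. 1 + 2 * \<delta> n < norm (fst (\<gamma> t (snd q)) - fst (\<gamma> t (fst q)))"
              by (intro order_tendstoD(2)) auto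
          qed
        qed simp
        then have "\<forall>\<^sub>F n in sequentially. E n t = 0"
        proof eventually_elim
          case (elim n)
          then show ?case unfolding E_def by (intro sum.neutral) fastforce
        qed
        then show ?thesis by (intro tendsto_eventually) (auto elim: eventually_mono)
      qed simp
    qed
  qed auto
  then have "(\<lambda>n. 2 * (ennreal (8 * V) + (\<integral>\<^sup>+t. ennreal (E n t) * indicator {a..e} t \<partial>lborel)))
      \<longlonglongrightarrow> 2 * (ennreal (8 * V) + 0)"
    by (intro tendsto_intros ennreal_tendsto_cmult tendsto_add) auto
  then have lim: "limsup (\<lambda>n. 2 * (ennreal (8 * V) + (\<integral>\<^sup>+t. ennreal (E n t) * indicator {a..e} t \<partial>lborel)))
      = 2 * (ennreal (8 * V) + 0)"
    by (rule lim_imp_Limsup[OF sequentially_bot])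
  have "\<forall>\<^sub>F n in sequentially. \<delta> n < \<eta> / 2"
    using \<delta>lim \<eta> by (intro order_tendstoD(2)) auto
  then have "\<forall>\<^sub>F n in sequentially. (\<integral>\<^sup>+t\<in>{-T..T}. ennreal (shells (\<delta> n) N (\<gamma> t)) \<partial>lborel) \<le>
      2 * (ennreal (8 * V) + (\<integral>\<^sup>+t. ennreal (E n t) * indicator {a..e} t \<partial>lborel))"
    by eventually_elim (rule main, simp)
  then have "limsup (\<lambda>n. \<integral>\<^sup>+t\<in>{-T..T}. ennreal (shells (\<delta> n) N (\<gamma> t)) \<partial>lborel) \<le> 2 * (ennreal (8 * V) + 0)"
    unfolding lim[symmetric] by (rule Limsup_mono)
  also have "\<dots> = ennreal (16 * V)"
  proof -
    have "0 \<le> V" unfolding V_def using inertia_nonneg kinetic_nonneg by (intro mult_nonneg_nonneg) auto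
    then show ?thesis by (simp add: ennreal_mult' mult.assoc[symmetric])
  qed
  finally show ?thesis unfolding V_def \<delta>_def .
qed

end

section \<open>Polar coordinates\<close>

lemma nn_integral_lborel_scaleR:
  fixes f :: "'a::euclidean_space \<Rightarrow> ennreal"
  assumes [measurable]: "f \<in> borel_measurable borel" and c: "0 < c"
  shows "(\<integral>\<^sup>+x. f (c *\<^sub>R x) \<partial>lborel) = ennreal (1 / c ^ DIM('a)) * (\<integral>\<^sup>+x. f x \<partial>lborel)"
proof -
  have "(\<integral>\<^sup>+x. f x \<partial>lborel) =
      (\<integral>\<^sup>+x. f x \<partial>density (distr lborel borel (\<lambda>x. 0 + c *\<^sub>R x)) (\<lambda>_. ennreal (\<bar>c\<bar> ^ DIM('a))))"
    using lborel_affine[of c "0::'a"] c by simp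
  also have "\<dots> = ennreal (c ^ DIM('a)) * (\<integral>\<^sup>+x. f (c *\<^sub>R x) \<partial>lborel)"
    using c by (simp add: nn_integral_density nn_integral_distr nn_integral_cmult)
  finally have "ennreal (1 / c ^ DIM('a)) * (\<integral>\<^sup>+x. f x \<partial>lborel) =
      (ennreal (1 / c ^ DIM('a)) * ennreal (c ^ DIM('a))) * (\<integral>\<^sup>+x. f (c *\<^sub>R x) \<partial>lborel)"
    by (simp add: mult.assoc)
  also have "ennreal (1 / c ^ DIM('a)) * ennreal (c ^ DIM('a)) = 1"
    using c by (simp add: ennreal_mult[symmetric])
  finally show ?thesis by simp
qed

lemma nn_integral_lborel_translate:
  fixes f :: "'a::euclidean_space \<Rightarrow> ennreal"
  assumes [measurable]: "f \<in> borel_measurable borel"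
  shows "(\<integral>\<^sup>+x. f (a + x) \<partial>lborel) = (\<integral>\<^sup>+x. f x \<partial>lborel)"
proof -
  have "(\<integral>\<^sup>+x. f x \<partial>lborel) = (\<integral>\<^sup>+x. f x \<partial>distr lborel borel ((+) a))"
    by (simp add: lborel_distr_plus)
  then show ?thesis by (simp add: nn_integral_distr)
qed

lemma sets_sphere_measure [measurable_cong, simp]:
  "sets (sphere_measure :: 'a::euclidean_space measure) = sets borel"
  by (simp add: sphere_measure_def)

lemma space_sphere_measure [simp]: "space (sphere_measure :: 'a::euclidean_space measure) = UNIV"
  by (simp add: sphere_measure_def space_scale_measure)

lemma nn_integral_sphere_measure:
  fixes f :: "'a::euclidean_space \<Rightarrow> ennreal"
  assumes [measurable]: "f \<in> borel_measurable borel"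
  shows "(\<integral>\<^sup>+\<omega>. f \<omega> \<partial>sphere_measure) =
     of_nat DIM('a) * (\<integral>\<^sup>+z. f (sgn z) * indicator (ball 0 1 - {0}) z \<partial>lborel)"
proof -
  have [measurable]: "sgn \<in> borel_measurable (restrict_space lborel (ball 0 1 - {0::'a}))"
    by (intro measurable_restrict_space1) (simp add: sgn_div_norm[abs_def])
  show ?thesis
    unfolding sphere_measure_def
    by (simp add: nn_integral_scale_measure nn_integral_distr nn_integral_restrict_space)
qed

lemma finite_measure_sphere: "finite_measure (sphere_measure :: 'a::euclidean_space measure)"
proof
  have "emeasure (sphere_measure :: 'a measure) UNIV = (\<integral>\<^sup>+\<omega>. 1 \<partial>(sphere_measure :: 'a measure))"
    by simp
  also have "\<dots> = of_nat DIM('a) * emeasure lborel (ball 0 1 - {0::'a})"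
    by (subst nn_integral_sphere_measure) auto
  also have "\<dots> \<le> of_nat DIM('a) * emeasure lborel (ball (0::'a) 1)"
    by (intro mult_left_mono emeasure_mono) auto
  also have "\<dots> < \<infinity>"
    using emeasure_bounded_finite[OF bounded_ball, of "0::'a" 1]
    by (simp add: ennreal_mult_less_top of_nat_less_top less_top)
  finally show "emeasure (sphere_measure :: 'a measure) (space sphere_measure) \<noteq> \<infinity>" by simp
qed

lemma AE_sphere_norm: "AE \<omega> in (sphere_measure :: 'a::euclidean_space measure). norm \<omega> = 1"
proof -
  have "(\<integral>\<^sup>+\<omega>. indicator {\<omega>. norm \<omega> \<noteq> 1} \<omega> \<partial>(sphere_measure :: 'a measure)) = 0"
  proof (subst nn_integral_sphere_measure)
    have "(\<lambda>z. indicator {\<omega>. norm \<omega> \<noteq> 1} (sgn z) * indicator (ball 0 1 - {0::'a}) z) = (\<lambda>_. 0::ennreal)"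
      by (auto simp: indicator_def norm_sgn fun_eq_iff)
    then show "of_nat DIM('a) * (\<integral>\<^sup>+z. indicator {\<omega>. norm \<omega> \<noteq> 1} (sgn z) *
        indicator (ball 0 1 - {0::'a}) z \<partial>lborel) = (0::ennreal)" by simp
  qed simp
  then show ?thesis
    by (intro AE_I[of _ _ "{\<omega>. norm \<omega> \<noteq> 1}"]) auto
qed

lemma nn_integral_power_tail:
  assumes "0 < R" "0 < d"
  shows "(\<integral>\<^sup>+\<rho>. ennreal (1 / \<rho> ^ Suc d) * indicator {R..} \<rho> \<partial>lborel) = ennreal (1 / (real d * R ^ d))"
proof -
  have "(\<integral>\<^sup>+\<rho>. ennreal (1 / \<rho> ^ Suc d) * indicator {R..} \<rho> \<partial>lborel) = ennreal (0 - (- 1 / (real d * R ^ d)))"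
  proof (rule nn_integral_FTC_atLeast)
    fix x :: real assume x: "R \<le> x"
    then have x0: "0 < x" using assms by simp
    show "((\<lambda>x. - 1 / (real d * x ^ d)) has_real_derivative 1 / x ^ Suc d) (at x)"
      using x0 assms(2)
      by (auto intro!: derivative_eq_intros simp: field_simps power_Suc[symmetric] power_add[symmetric]
          simp del: power_Suc)
    show "0 \<le> 1 / x ^ Suc d" using x0 by simp
  next
    have "filterlim (\<lambda>x::real. real d * x ^ d) at_top at_top"
      using assms(2) by (intro filterlim_tendsto_pos_mult_at_top[OF tendsto_const]
          filterlim_pow_at_top filterlim_ident) auto
    then show "((\<lambda>x. - 1 / (real d * x ^ d)) \<longlongrightarrow> 0) at_top"
      by (intro tendsto_divide_0[OF tendsto_const] filterlim_at_top_imp_at_infinity)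
  qed simp
  then show ?thesis by simp
qed

text \<open>The exact formula has the Jacobian \<open>r ^ (DIM('a) - 1)\<close> under the integral
  on the left. It is at least 1 where \<open>r\<close> exceeds 1, and dropping it gives the
  inequality. As \<open>sphere_measure\<close> is an image of volume in the unit ball, the proof
  substitutes \<open>r = norm z * \<rho>\<close> and \<open>y = \<rho> *\<^sub>R z\<close> and
  integrates out \<open>\<rho>\<close>.\<close>

lemma sphere_shell_nn_integral_le:
  fixes h :: "'a::euclidean_space \<Rightarrow> ennreal"
  assumes [measurable]: "h \<in> borel_measurable borel"
  shows "(\<integral>\<^sup>+\<omega>. (\<integral>\<^sup>+r. h (r *\<^sub>R \<omega>) * indicator {1<..<1 + \<delta>} r \<partial>lborel) \<partial>sphere_measure)
     \<le> (\<integral>\<^sup>+y. h y * indicator {y. 1 < norm y \<and> norm y < 1 + \<delta>} y \<partial>lborel)"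
proof -
  define D where "D = DIM('a)"
  have D: "0 < D" by (simp add: D_def)
  let ?I = "indicator {1<..<1 + \<delta>} :: real \<Rightarrow> ennreal"
  define S where "S = ball 0 1 - {0::'a}"
  have [measurable]: "S \<in> sets borel" by (simp add: S_def)
  let ?B = "indicator S :: 'a \<Rightarrow> ennreal"
  \<comment> \<open>With \<open>r = norm z * \<rho>\<close> the argument
    \<open>r *\<^sub>R sgn z\<close> becomes \<open>\<rho> *\<^sub>R z\<close>, to which the scaling
    of Lebesgue measure applies once \<open>\<rho>\<close> is held fixed.\<close>
  have "(\<integral>\<^sup>+z. (\<integral>\<^sup>+r. h (r *\<^sub>R sgn z) * ?I r \<partial>lborel) * ?B z \<partial>lborel) =
      (\<integral>\<^sup>+z. (\<integral>\<^sup>+\<rho>. ennreal (norm z) * h (\<rho> *\<^sub>R z) * ?I (norm z * \<rho>) * ?B z \<partial>lborel) \<partial>lborel)"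
  proof (rule nn_integral_cong)
    fix z :: 'a
    show "(\<integral>\<^sup>+r. h (r *\<^sub>R sgn z) * ?I r \<partial>lborel) * ?B z =
      (\<integral>\<^sup>+\<rho>. ennreal (norm z) * h (\<rho> *\<^sub>R z) * ?I (norm z * \<rho>) * ?B z \<partial>lborel)"
    proof (cases "z = 0")
      case False
      have "(\<integral>\<^sup>+r. h (r *\<^sub>R sgn z) * ?I r \<partial>lborel) =
          \<bar>norm z\<bar> * (\<integral>\<^sup>+\<rho>. h ((0 + norm z * \<rho>) *\<^sub>R sgn z) * ?I (0 + norm z * \<rho>) \<partial>lborel)"
        using False by (intro nn_integral_real_affine) auto
      also have "\<dots> = (\<integral>\<^sup>+\<rho>. ennreal (norm z) * (h (\<rho> *\<^sub>R z) * ?I (norm z * \<rho>)) \<partial>lborel)"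
      proof -
        have "(norm z * \<rho>) *\<^sub>R sgn z = \<rho> *\<^sub>R z" for \<rho>
          using False by (simp add: sgn_div_norm)
        then show ?thesis by (subst nn_integral_cmult) auto
      qed
      finally show ?thesis
        by (simp add: nn_integral_multc[symmetric] mult.assoc)
    qed (simp add: S_def)
  qed
  also have "\<dots> = (\<integral>\<^sup>+\<rho>. (\<integral>\<^sup>+z. ennreal (norm z) * h (\<rho> *\<^sub>R z) * ?I (norm z * \<rho>) * ?B z \<partial>lborel) \<partial>lborel)"
    by (rule lborel_pair.Fubini') measurable
  also have "\<dots> = (\<integral>\<^sup>+\<rho>. (\<integral>\<^sup>+y. ennreal (1 / \<rho> ^ Suc D) * (if norm y < \<rho> then 1 else 0) *
      (ennreal (norm y) * h y * ?I (norm y)) \<partial>lborel) \<partial>lborel)"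
  proof (rule nn_integral_cong)
    fix \<rho> :: real
    show "(\<integral>\<^sup>+z. ennreal (norm z) * h (\<rho> *\<^sub>R z) * ?I (norm z * \<rho>) * ?B z \<partial>lborel) =
      (\<integral>\<^sup>+y. ennreal (1 / \<rho> ^ Suc D) * (if norm y < \<rho> then 1 else 0) *
        (ennreal (norm y) * h y * ?I (norm y)) \<partial>lborel)"
    proof (cases "0 < \<rho>")
      case True
      \<comment> \<open>The integrand in the variable \<open>y = \<rho> *\<^sub>R z\<close>: the
        factor \<open>norm z\<close> is \<open>norm y / \<rho>\<close>, and the unit ball becomes
        the condition \<open>norm y < \<rho>\<close>.\<close>
      define F where "F y = ennreal (norm y / \<rho>) * h y * ?I (norm y) * (if norm y < \<rho> then 1 else 0)" for y
      have [measurable]: "F \<in> borel_measurable borel" unfolding F_def[abs_def] by measurable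
      have "(\<integral>\<^sup>+z. ennreal (norm z) * h (\<rho> *\<^sub>R z) * ?I (norm z * \<rho>) * ?B z \<partial>lborel) =
          (\<integral>\<^sup>+z. F (\<rho> *\<^sub>R z) \<partial>lborel)"
      proof (rule nn_integral_cong)
        fix z :: 'a
        show "ennreal (norm z) * h (\<rho> *\<^sub>R z) * ?I (norm z * \<rho>) * ?B z = F (\<rho> *\<^sub>R z)"
          using True by (cases "z = 0") (auto simp: F_def S_def indicator_def mult.commute)
      qed
      also have "\<dots> = ennreal (1 / \<rho> ^ D) * (\<integral>\<^sup>+y. F y \<partial>lborel)"
        unfolding D_def by (rule nn_integral_lborel_scaleR[OF _ True]) simp
      also have "\<dots> = (\<integral>\<^sup>+y. ennreal (1 / \<rho> ^ D) * F y \<partial>lborel)"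
        by (rule nn_integral_cmult[symmetric]) simp
      also have "\<dots> = (\<integral>\<^sup>+y. ennreal (1 / \<rho> ^ Suc D) * (if norm y < \<rho> then 1 else 0) *
        (ennreal (norm y) * h y * ?I (norm y)) \<partial>lborel)"
      proof (rule nn_integral_cong)
        fix y :: 'a
        have "ennreal (1 / \<rho> ^ D) * ennreal (norm y / \<rho>) = ennreal (1 / \<rho> ^ Suc D) * ennreal (norm y)"
          using True by (simp add: ennreal_mult[symmetric])
        then show "ennreal (1 / \<rho> ^ D) * F y = ennreal (1 / \<rho> ^ Suc D) * (if norm y < \<rho> then 1 else 0) *
          (ennreal (norm y) * h y * ?I (norm y))"
          unfolding F_def by (simp add: mult_ac) (metis mult.assoc mult.commute)
      qed
      finally show ?thesis .
    next
      case False
      have "norm z * \<rho> \<le> 0" for z :: 'a using False by (simp add: mult_nonneg_nonpos)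
      moreover have "\<rho> \<le> norm y" for y :: 'a using False norm_ge_zero[of y] by linarith
      ultimately have "?I (norm z * \<rho>) = 0" "(if norm z < \<rho> then 1 else 0 :: ennreal) = 0" for z :: 'a
        by (auto simp: indicator_def not_less intro: order_trans[of _ 0])
      then show ?thesis by simp
    qed
  qed
  also have "\<dots> = (\<integral>\<^sup>+y. (\<integral>\<^sup>+\<rho>. ennreal (1 / \<rho> ^ Suc D) * (if norm y < \<rho> then 1 else 0) *
      (ennreal (norm y) * h y * ?I (norm y)) \<partial>lborel) \<partial>lborel)"
    by (rule lborel_pair.Fubini') measurable
  also have "\<dots> \<le> (\<integral>\<^sup>+y. ennreal (1 / real D) * (h y * ?I (norm y)) \<partial>lborel)"
  proof (rule nn_integral_mono)
    fix y :: 'a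
    show "(\<integral>\<^sup>+\<rho>. ennreal (1 / \<rho> ^ Suc D) * (if norm y < \<rho> then 1 else 0) *
        (ennreal (norm y) * h y * ?I (norm y)) \<partial>lborel) \<le> ennreal (1 / real D) * (h y * ?I (norm y))"
    proof (cases "1 < norm y")
      case True
      have "(\<integral>\<^sup>+\<rho>. ennreal (1 / \<rho> ^ Suc D) * (if norm y < \<rho> then 1 else 0) \<partial>lborel) \<le>
          (\<integral>\<^sup>+\<rho>. ennreal (1 / \<rho> ^ Suc D) * indicator {norm y..} \<rho> \<partial>lborel)"
        by (intro nn_integral_mono mult_left_mono) (auto simp: indicator_def)
      also have "\<dots> = ennreal (1 / (real D * norm y ^ D))"
        using True D by (intro nn_integral_power_tail) auto
      finally have "(\<integral>\<^sup>+\<rho>. ennreal (1 / \<rho> ^ Suc D) * (if norm y < \<rho> then 1 else 0) \<partial>lborel) * ennreal (norm y)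
        \<le> ennreal (1 / (real D * norm y ^ D)) * ennreal (norm y)"
        by (rule mult_right_mono) simp
      also have "\<dots> = ennreal (norm y / (real D * norm y ^ D))"
        by (simp add: ennreal_mult[symmetric])
      \<comment> \<open>The inverse Jacobian \<open>norm y / norm y ^ D\<close> is discarded here.
        The remaining \<open>1 / D\<close> cancels the dimension factor of
        \<open>sphere_measure\<close>.\<close>
      also have "\<dots> \<le> ennreal (1 / real D)"
      proof (rule ennreal_leI)
        have "norm y \<le> norm y ^ D" using True D by (intro self_le_power) auto
        then show "norm y / (real D * norm y ^ D) \<le> 1 / real D"
          using D True by (simp add: field_simps)
      qed
      finally show ?thesis
        by (simp add: nn_integral_multc mult.assoc[symmetric] mult_right_mono)
    qed (simp add: indicator_def)
  qed
  finally have *: "(\<integral>\<^sup>+z. (\<integral>\<^sup>+r. h (r *\<^sub>R sgn z) * ?I r \<partial>lborel) * ?B z \<partial>lborel) \<le>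
      (\<integral>\<^sup>+y. ennreal (1 / real D) * (h y * ?I (norm y)) \<partial>lborel)" .
  have "(\<integral>\<^sup>+\<omega>. (\<integral>\<^sup>+r. h (r *\<^sub>R \<omega>) * ?I r \<partial>lborel) \<partial>sphere_measure) =
      of_nat D * (\<integral>\<^sup>+z. (\<integral>\<^sup>+r. h (r *\<^sub>R sgn z) * ?I r \<partial>lborel) * ?B z \<partial>lborel)"
    unfolding D_def S_def by (rule nn_integral_sphere_measure) simp
  also have "\<dots> \<le> of_nat D * (\<integral>\<^sup>+y. ennreal (1 / real D) * (h y * ?I (norm y)) \<partial>lborel)"
    by (intro mult_left_mono *) simp
  also have "\<dots> = (ennreal (real D) * ennreal (1 / real D)) * (\<integral>\<^sup>+y. h y * ?I (norm y) \<partial>lborel)"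
    by (subst nn_integral_cmult) (auto simp: ennreal_of_nat_eq_real_of_nat mult.assoc)
  also have "ennreal (real D) * ennreal (1 / real D) = 1"
    using D by (simp add: ennreal_mult[symmetric])
  finally show ?thesis by (simp add: indicator_def cong: nn_integral_cong)
qed

section \<open>Traces and marginals\<close>

lemma product_sigma_finite_lborel: "product_sigma_finite (\<lambda>_. lborel :: 'b::euclidean_space measure)"
  by (intro product_sigma_finite.intro lborel.sigma_finite_measure_axioms)

lemma sigma_finite_PiM_lborel:
  "finite I \<Longrightarrow> sigma_finite_measure (\<Pi>\<^sub>M k\<in>I. lborel :: 'b::euclidean_space measure)"
  by (rule product_sigma_finite.sigma_finite[OF product_sigma_finite_lborel])

lemma measurable_upd_const:
  "(\<lambda>Z. Z(i := z)) \<in> (\<Pi>\<^sub>M k\<in>I. lborel :: 'b::euclidean_space measure) \<rightarrow>\<^sub>M (\<Pi>\<^sub>M k\<in>insert i I. lborel)"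
  by (rule measurable_fun_upd[of _ I]) auto

lemma borel_measurable_PiM_prod:
  fixes f :: "('i \<Rightarrow> 'a::euclidean_space \<times> 'b::euclidean_space) \<Rightarrow> ennreal"
  assumes "f \<in> borel_measurable (\<Pi>\<^sub>M k\<in>I. lborel)"
    and "\<And>k. k \<in> I \<Longrightarrow> (\<lambda>p. X p k) \<in> borel_measurable M"
    and "\<And>k. k \<in> I \<Longrightarrow> (\<lambda>p. V p k) \<in> borel_measurable M"
  shows "(\<lambda>p. f (\<lambda>k\<in>I. (X p k, V p k))) \<in> borel_measurable M"
  using assms(2,3)
  by (intro measurable_compose[OF _ assms(1)] measurable_restrict) (simp add: borel_measurable_Pair)

lemma borel_measurable_PiM_prod_upd:
  fixes f :: "('i \<Rightarrow> 'a::euclidean_space \<times> 'b::euclidean_space) \<Rightarrow> ennreal"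
  assumes "f \<in> borel_measurable (\<Pi>\<^sub>M k\<in>insert i I. lborel)"
    and X: "X \<in> M \<rightarrow>\<^sub>M (\<Pi>\<^sub>M k\<in>I. lborel)" and V: "V \<in> M \<rightarrow>\<^sub>M (\<Pi>\<^sub>M k\<in>I. lborel)"
    and z: "z \<in> borel_measurable M"
  shows "(\<lambda>p. f ((\<lambda>k\<in>I. (X p k, V p k))(i := z p))) \<in> borel_measurable M"
proof (rule measurable_compose[OF _ assms(1)])
  have "(\<lambda>p. (X p k, V p k)) \<in> borel_measurable M" if "k \<in> I" for k
    using measurable_compose[OF X measurable_component_singleton[OF that]]
      measurable_compose[OF V measurable_component_singleton[OF that]]
    by (intro borel_measurable_Pair) simp_all
  then have "(\<lambda>p. \<lambda>k\<in>I. (X p k, V p k)) \<in> M \<rightarrow>\<^sub>M (\<Pi>\<^sub>M k\<in>I. lborel)"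
    by (intro measurable_restrict) simp
  then show "(\<lambda>p. (\<lambda>k\<in>I. (X p k, V p k))(i := z p)) \<in> M \<rightarrow>\<^sub>M (\<Pi>\<^sub>M k\<in>insert i I. lborel)"
    using z by (intro measurable_fun_upd[of _ I]) auto
qed

text \<open>Phase space measure is a product over particles, whereas the surface integral separates
  velocities from positions. The induction splits one particle at a time and sorts the variables by
  Tonelli's theorem.\<close>

lemma nn_integral_PiM_lborel_prod:
  fixes f :: "('i \<Rightarrow> 'a::euclidean_space \<times> 'b::euclidean_space) \<Rightarrow> ennreal"
  assumes "finite I" "f \<in> borel_measurable (\<Pi>\<^sub>M k\<in>I. lborel)"
  shows "(\<integral>\<^sup>+Z. f Z \<partial>(\<Pi>\<^sub>M k\<in>I. lborel)) =
    (\<integral>\<^sup>+V. (\<integral>\<^sup>+X. f (\<lambda>k\<in>I. (X k, V k)) \<partial>(\<Pi>\<^sub>M k\<in>I. lborel)) \<partial>(\<Pi>\<^sub>M k\<in>I. lborel))"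
  using assms
proof (induction I arbitrary: f rule: finite_induct)
  case empty
  show ?case
    by (simp add: PiM_empty nn_integral_count_space_finite restrict_def)
next
  case (insert i I)
  interpret A: product_sigma_finite "\<lambda>_::'i. lborel :: ('a \<times> 'b) measure" by (rule product_sigma_finite_lborel)
  interpret B: product_sigma_finite "\<lambda>_::'i. lborel :: 'a measure" by (rule product_sigma_finite_lborel)
  interpret C: product_sigma_finite "\<lambda>_::'i. lborel :: 'b measure" by (rule product_sigma_finite_lborel)
  interpret BI: sigma_finite_measure "\<Pi>\<^sub>M k\<in>I. lborel :: 'a measure"
    by (rule sigma_finite_PiM_lborel[OF insert.hyps(1)])
  interpret CI: sigma_finite_measure "\<Pi>\<^sub>M k\<in>I. lborel :: 'b measure"
    by (rule sigma_finite_PiM_lborel[OF insert.hyps(1)])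
  interpret P: pair_sigma_finite "lborel :: 'a measure" "\<Pi>\<^sub>M k\<in>I. lborel :: 'b measure" ..
  note [measurable] = insert.prems
  have g2: "(\<lambda>p. \<integral>\<^sup>+X. f ((\<lambda>k\<in>I. (X k, V p k))(i := z p)) \<partial>(\<Pi>\<^sub>M k\<in>I. lborel)) \<in> borel_measurable M"
    if "V \<in> M \<rightarrow>\<^sub>M (\<Pi>\<^sub>M k\<in>I. lborel)" "z \<in> borel_measurable M" for V z M
    using measurable_compose[OF measurable_fst that(1)] measurable_compose[OF measurable_fst that(2)]
    by (intro BI.borel_measurable_nn_integral, unfold case_prod_beta',
        intro borel_measurable_PiM_prod_upd[OF insert.prems]) auto
  have g1: "(\<lambda>z. \<integral>\<^sup>+V. (\<integral>\<^sup>+X. f ((\<lambda>k\<in>I. (X k, V k))(i := z)) \<partial>(\<Pi>\<^sub>M k\<in>I. lborel)) \<partial>(\<Pi>\<^sub>M k\<in>I. lborel))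
      \<in> borel_measurable borel"
    by (intro CI.borel_measurable_nn_integral, unfold case_prod_beta', intro g2) auto
  have "(\<integral>\<^sup>+Z. f Z \<partial>(\<Pi>\<^sub>M k\<in>insert i I. lborel)) =
      (\<integral>\<^sup>+z. (\<integral>\<^sup>+Z. f (Z(i := z)) \<partial>(\<Pi>\<^sub>M k\<in>I. lborel)) \<partial>lborel)"
    by (rule A.product_nn_integral_insert_rev[OF insert.hyps insert.prems])
  also have "\<dots> = (\<integral>\<^sup>+z. (\<integral>\<^sup>+V. (\<integral>\<^sup>+X. f ((\<lambda>k\<in>I. (X k, V k))(i := z)) \<partial>(\<Pi>\<^sub>M k\<in>I. lborel))
      \<partial>(\<Pi>\<^sub>M k\<in>I. lborel)) \<partial>lborel)"
    by (intro nn_integral_cong insert.IH measurable_compose[OF measurable_upd_const insert.prems])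
  also have "\<dots> = (\<integral>\<^sup>+v. (\<integral>\<^sup>+x. (\<integral>\<^sup>+V. (\<integral>\<^sup>+X. f ((\<lambda>k\<in>I. (X k, V k))(i := (x, v))) \<partial>(\<Pi>\<^sub>M k\<in>I. lborel))
      \<partial>(\<Pi>\<^sub>M k\<in>I. lborel)) \<partial>lborel) \<partial>lborel)"
    unfolding lborel_prod[symmetric]
    by (rule lborel_pair.nn_integral_snd[symmetric]) (use g1 in \<open>simp add: lborel_prod\<close>)
  \<comment> \<open>The position of the new particle is moved past the velocities of the old
    ones.\<close>
  also have "\<dots> = (\<integral>\<^sup>+v. (\<integral>\<^sup>+V. (\<integral>\<^sup>+x. (\<integral>\<^sup>+X. f ((\<lambda>k\<in>I. (X k, V k))(i := (x, v))) \<partial>(\<Pi>\<^sub>M k\<in>I. lborel))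
      \<partial>lborel) \<partial>(\<Pi>\<^sub>M k\<in>I. lborel)) \<partial>lborel)"
    by (intro nn_integral_cong P.Fubini'[symmetric], unfold case_prod_beta', intro g2 borel_measurable_Pair) auto
  also have "\<dots> = (\<integral>\<^sup>+v. (\<integral>\<^sup>+V. (\<integral>\<^sup>+x. (\<integral>\<^sup>+X. f (\<lambda>k\<in>insert i I. ((X(i := x)) k, (V(i := v)) k))
      \<partial>(\<Pi>\<^sub>M k\<in>I. lborel)) \<partial>lborel) \<partial>(\<Pi>\<^sub>M k\<in>I. lborel)) \<partial>lborel)"
  proof -
    have eq: "(\<lambda>k\<in>insert i I. ((X(i := x)) k, (V(i := v)) k)) = (\<lambda>k\<in>I. (X k, V k))(i := (x, v))" for X V x v
      using insert.hyps(2) by (auto simp: restrict_def fun_eq_iff)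
    show ?thesis unfolding eq by (rule refl)
  qed
  also have "\<dots> = (\<integral>\<^sup>+v. (\<integral>\<^sup>+V. (\<integral>\<^sup>+X. f (\<lambda>k\<in>insert i I. (X k, (V(i := v)) k))
      \<partial>(\<Pi>\<^sub>M k\<in>insert i I. lborel)) \<partial>(\<Pi>\<^sub>M k\<in>I. lborel)) \<partial>lborel)"
    by (intro nn_integral_cong B.product_nn_integral_insert_rev[OF insert.hyps, symmetric])
       (rule borel_measurable_PiM_prod[OF insert.prems], auto)
  also have "\<dots> = (\<integral>\<^sup>+V. (\<integral>\<^sup>+X. f (\<lambda>k\<in>insert i I. (X k, V k)) \<partial>(\<Pi>\<^sub>M k\<in>insert i I. lborel))
      \<partial>(\<Pi>\<^sub>M k\<in>insert i I. lborel))"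
  proof (rule C.product_nn_integral_insert_rev[OF insert.hyps, symmetric])
    interpret BI': sigma_finite_measure "\<Pi>\<^sub>M k\<in>insert i I. lborel :: 'a measure"
      by (rule sigma_finite_PiM_lborel) (simp add: insert.hyps)
    show "(\<lambda>V. \<integral>\<^sup>+X. f (\<lambda>k\<in>insert i I. (X k, V k)) \<partial>(\<Pi>\<^sub>M k\<in>insert i I. lborel)) \<in>
        borel_measurable (\<Pi>\<^sub>M k\<in>insert i I. lborel)"
      by (rule BI'.borel_measurable_nn_integral, unfold case_prod_beta',
          rule borel_measurable_PiM_prod[OF insert.prems]) auto
  qed
  finally show ?case .
qed

lemma borel_measurable_pair_config:
  fixes H :: "(nat \<Rightarrow> 'a::euclidean_space \<times> 'a) \<Rightarrow> 'c::topological_space"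
  assumes "H \<in> borel_measurable (\<Pi>\<^sub>M k\<in>{1..s}. lborel)" "i \<in> {1..s}" "i \<noteq> j"
    and X: "X \<in> M \<rightarrow>\<^sub>M (\<Pi>\<^sub>M k\<in>{1..s} - {j}. lborel)" and V: "V \<in> M \<rightarrow>\<^sub>M (\<Pi>\<^sub>M k\<in>{1..s}. lborel)"
    and \<omega>: "\<omega> \<in> borel_measurable M" and r: "r \<in> borel_measurable M"
  shows "(\<lambda>p. H (pair_config s i j (X p) (V p) (\<omega> p) (r p))) \<in> borel_measurable M"
  unfolding pair_config_def
proof (rule measurable_compose[OF measurable_restrict assms(1)])
  fix k assume k: "k \<in> {1..s}"
  have x: "(\<lambda>p. X p l) \<in> borel_measurable M" if "l \<in> {1..s} - {j}" for l
    using measurable_compose[OF X measurable_component_singleton[OF that]] by simp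
  have v: "(\<lambda>p. V p k) \<in> borel_measurable M"
    using measurable_compose[OF V measurable_component_singleton[OF k]] by simp
  have "(\<lambda>p. if k = j then X p i + r p *\<^sub>R \<omega> p else X p k) \<in> borel_measurable M"
    using x[of i] x[of k] \<omega> r k assms(2,3) by (cases "k = j") auto
  then show "(\<lambda>p. (if k = j then X p i + r p *\<^sub>R \<omega> p else X p k, V p k)) \<in> M \<rightarrow>\<^sub>M lborel"
    using v by (simp add: borel_measurable_Pair)
qed

lemma shell_eq:
  "0 < d \<Longrightarrow> ennreal (shell d y w) = ennreal ((sgn y \<bullet> w)\<^sup>2) * ennreal (1 / d) *
     indicator {y. 1 < norm y \<and> norm y < 1 + d} y"
  by (auto simp: shell_def indicator_def ennreal_mult'[symmetric])

lemma borel_measurable_shell [measurable (raw)]: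
  assumes [measurable]: "f \<in> borel_measurable M" "g \<in> borel_measurable M"
  shows "(\<lambda>x. shell d (f x) (g x)) \<in> borel_measurable M"
  unfolding shell_def sgn_div_norm by measurable

lemma measurable_position_velocity:
  assumes "k \<in> I"
  shows "(\<lambda>Z. fst (Z k)) \<in> borel_measurable (\<Pi>\<^sub>M k\<in>I. lborel :: ('a::euclidean_space \<times> 'a) measure)"
    and "(\<lambda>Z. snd (Z k)) \<in> borel_measurable (\<Pi>\<^sub>M k\<in>I. lborel :: ('a::euclidean_space \<times> 'a) measure)"
  by (rule measurable_compose[OF measurable_component_singleton[OF assms]];
      simp add: borel_measurable_continuous_onI continuous_on_fst continuous_on_snd)+

lemma measurable_pair_shell:
  assumes "i \<in> I" "j \<in> I"
  shows "(\<lambda>Z. shell d (fst (Z j) - fst (Z i)) (snd (Z j) - snd (Z i))) \<in>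
    borel_measurable (\<Pi>\<^sub>M k\<in>I. lborel :: ('a::euclidean_space \<times> 'a) measure)"
  by (intro borel_measurable_shell borel_measurable_diff measurable_position_velocity assms)

text \<open>With the velocities and the other positions fixed, the left side integrates a function
  of the separation \<open>r *\<^sub>R \<omega>\<close>, so
  \<open>sphere_shell_nn_integral_le\<close> bounds it by a volume integral over the separation
  \<open>y\<close>. Translation by the position of \<open>i\<close> makes this an integral over the
  position of \<open>j\<close>, and recombining the variables gives phase space.\<close>

lemma surface_integral_le:
  fixes H :: "(nat \<Rightarrow> 'a::euclidean_space \<times> 'a) \<Rightarrow> ennreal"
  assumes H: "H \<in> borel_measurable (\<Pi>\<^sub>M k\<in>{1..s}. lborel)"
    and ij: "i \<in> {1..s}" "j \<in> {1..s}" "i \<noteq> j" and d: "0 < d"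
  shows "(\<integral>\<^sup>+(V, X, \<omega>). ennreal ((\<omega> \<bullet> (V j - V i))\<^sup>2) *
       ((\<integral>\<^sup>+r. H (pair_config s i j X V \<omega> r) * indicator {1<..<1 + d} r \<partial>lborel) * ennreal (1 / d))
      \<partial>((\<Pi>\<^sub>M k\<in>{1..s}. lborel) \<Otimes>\<^sub>M (\<Pi>\<^sub>M k\<in>{1..s} - {j}. lborel) \<Otimes>\<^sub>M sphere_measure))
    \<le> (\<integral>\<^sup>+Z. ennreal (shell d (fst (Z j) - fst (Z i)) (snd (Z j) - snd (Z i))) * H Z \<partial>(\<Pi>\<^sub>M k\<in>{1..s}. lborel))"
    and surface_integrand_measurable: "(\<lambda>(V, X, \<omega>). ennreal ((\<omega> \<bullet> (V j - V i))\<^sup>2) *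
       ((\<integral>\<^sup>+r. H (pair_config s i j X V \<omega> r) * indicator {1<..<1 + d} r \<partial>lborel) * ennreal (1 / d))) \<in>
      borel_measurable ((\<Pi>\<^sub>M k\<in>{1..s}. lborel) \<Otimes>\<^sub>M (\<Pi>\<^sub>M k\<in>{1..s} - {j}. lborel) \<Otimes>\<^sub>M sphere_measure)"
proof -
  let ?V = "\<Pi>\<^sub>M k\<in>{1..s}. lborel :: 'a measure"
  let ?X = "\<Pi>\<^sub>M k\<in>{1..s} - {j}. lborel :: 'a measure"
  interpret B: product_sigma_finite "\<lambda>_::nat. lborel :: 'a measure" by (rule product_sigma_finite_lborel)
  interpret S: finite_measure "sphere_measure :: 'a measure" by (rule finite_measure_sphere)
  interpret MX: sigma_finite_measure ?X by (rule sigma_finite_PiM_lborel) simp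
  interpret MXS: pair_sigma_finite ?X "sphere_measure :: 'a measure" ..
  \<comment> \<open>The separation \<open>y\<close> takes the place of the direction and the radius
    is set to 1, so that \<open>h\<close> depends on direction and radius through \<open>y\<close>
    alone.\<close>
  define h where "h X V y = ennreal ((sgn y \<bullet> (V j - V i))\<^sup>2) * (H (pair_config s i j X V y 1) * ennreal (1 / d))"
    for X V y
  define G where "G V X \<omega> = ennreal ((\<omega> \<bullet> (V j - V i))\<^sup>2) *
       ((\<integral>\<^sup>+r. H (pair_config s i j X V \<omega> r) * indicator {1<..<1 + d} r \<partial>lborel) * ennreal (1 / d))" for V X \<omega>
  have comp: "(\<lambda>V. V k) \<in> borel_measurable ?V" if "k \<in> {1..s}" for k
    using measurable_component_singleton[OF that, of "\<lambda>_. lborel :: 'a measure"] by simp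
  note [measurable] = comp[OF ij(1)] comp[OF ij(2)]
  have Gm: "(\<lambda>(V, X, \<omega>). G V X \<omega>) \<in> borel_measurable (?V \<Otimes>\<^sub>M ?X \<Otimes>\<^sub>M sphere_measure)"
  proof -
    have [measurable]: "(\<lambda>p. H (pair_config s i j (fst (snd (fst p))) (fst (fst p)) (snd (snd (fst p))) (snd p)))
        \<in> borel_measurable ((?V \<Otimes>\<^sub>M ?X \<Otimes>\<^sub>M sphere_measure) \<Otimes>\<^sub>M borel)"
      by (intro borel_measurable_pair_config[OF H ij(1,3)]) measurable
    show ?thesis unfolding G_def case_prod_beta' by measurable
  qed
  then show "(\<lambda>(V, X, \<omega>). ennreal ((\<omega> \<bullet> (V j - V i))\<^sup>2) *
       ((\<integral>\<^sup>+r. H (pair_config s i j X V \<omega> r) * indicator {1<..<1 + d} r \<partial>lborel) * ennreal (1 / d))) \<in>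
      borel_measurable (?V \<Otimes>\<^sub>M ?X \<Otimes>\<^sub>M sphere_measure)" unfolding G_def .
  have conf: "pair_config s i j X V y 1 = (\<lambda>k\<in>{1..s}. ((X(j := X i + y)) k, V k))" for X V and y :: 'a
    by (auto simp: pair_config_def restrict_def fun_eq_iff)
  have inner: "(\<integral>\<^sup>+\<omega>. G V X \<omega> \<partial>sphere_measure) \<le>
     (\<integral>\<^sup>+x. ennreal (shell d (x - X i) (V j - V i)) * H (\<lambda>k\<in>{1..s}. ((X(j := x)) k, V k)) \<partial>lborel)"
    if X: "X \<in> space ?X" and V: "V \<in> space ?V" for X V
  proof -
    have Hm: "(\<lambda>x. H (\<lambda>k\<in>{1..s}. ((X(j := x)) k, V k))) \<in> borel_measurable borel"
      by (rule borel_measurable_PiM_prod[OF H]) auto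
    have hm [measurable]: "h X V \<in> borel_measurable borel"
    proof -
      have [measurable]: "(\<lambda>y. H (pair_config s i j X V y 1)) \<in> borel_measurable borel"
        using X V by (intro borel_measurable_pair_config[OF H ij(1,3)]) auto
      show ?thesis unfolding h_def[abs_def] sgn_div_norm by measurable
    qed
    have "(\<integral>\<^sup>+\<omega>. G V X \<omega> \<partial>sphere_measure) =
        (\<integral>\<^sup>+\<omega>. (\<integral>\<^sup>+r. h X V (r *\<^sub>R \<omega>) * indicator {1<..<1 + d} r \<partial>lborel) \<partial>sphere_measure)"
    \<comment> \<open>\<open>sphere_measure\<close> lives on the whole space. Off a null set
      \<open>\<omega>\<close> has norm 1, and then it is the direction of
      \<open>r *\<^sub>R \<omega>\<close>.\<close>
    proof (rule nn_integral_cong_AE, use AE_sphere_norm in eventually_elim)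
      fix \<omega> :: 'a assume \<omega>: "norm \<omega> = 1"
      have [measurable]: "(\<lambda>r. H (pair_config s i j X V \<omega> r)) \<in> borel_measurable borel"
        using X V by (intro borel_measurable_pair_config[OF H ij(1,3)]) auto
      have "G V X \<omega> = (\<integral>\<^sup>+r. ennreal ((\<omega> \<bullet> (V j - V i))\<^sup>2) *
         ((H (pair_config s i j X V \<omega> r) * indicator {1<..<1 + d} r) * ennreal (1 / d)) \<partial>lborel)"
        unfolding G_def by (subst nn_integral_cmult) (auto simp: nn_integral_multc)
      also have "\<dots> = (\<integral>\<^sup>+r. h X V (r *\<^sub>R \<omega>) * indicator {1<..<1 + d} r \<partial>lborel)"
      proof (rule nn_integral_cong)
        fix r :: real
        show "ennreal ((\<omega> \<bullet> (V j - V i))\<^sup>2) *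
         ((H (pair_config s i j X V \<omega> r) * indicator {1<..<1 + d} r) * ennreal (1 / d)) =
          h X V (r *\<^sub>R \<omega>) * indicator {1<..<1 + d} r"
        proof (cases "1 < r")
          case True
          then have "sgn (r *\<^sub>R \<omega>) = \<omega>" using \<omega> by (simp add: sgn_scaleR) (simp add: sgn_div_norm)
          then show ?thesis by (simp add: h_def pair_config_def mult_ac cong: if_cong)
        qed simp
      qed
      finally show "G V X \<omega> = (\<integral>\<^sup>+r. h X V (r *\<^sub>R \<omega>) * indicator {1<..<1 + d} r \<partial>lborel)" .
    qed
    also have "\<dots> \<le> (\<integral>\<^sup>+y. h X V y * indicator {y. 1 < norm y \<and> norm y < 1 + d} y \<partial>lborel)"
      by (rule sphere_shell_nn_integral_le) simp
    also have "\<dots> = (\<integral>\<^sup>+y. ennreal (shell d ((X i + y) - X i) (V j - V i)) *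
        H (\<lambda>k\<in>{1..s}. ((X(j := X i + y)) k, V k)) \<partial>lborel)"
      by (intro nn_integral_cong) (simp add: h_def shell_eq[OF d] conf mult_ac)
    also have "\<dots> = (\<integral>\<^sup>+x. ennreal (shell d (x - X i) (V j - V i)) * H (\<lambda>k\<in>{1..s}. ((X(j := x)) k, V k)) \<partial>lborel)"
      using Hm by (intro nn_integral_lborel_translate) measurable
    finally show ?thesis .
  qed
  define \<Phi> where "\<Phi> V X = ennreal (shell d (X j - X i) (V j - V i)) * H (\<lambda>k\<in>{1..s}. (X k, V k))" for V X
  have \<Phi>m: "(\<lambda>X. \<Phi> V X) \<in> borel_measurable ?V" for V
  proof -
    have [measurable]: "(\<lambda>X. H (\<lambda>k\<in>{1..s}. (X k, V k))) \<in> borel_measurable ?V"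
      by (intro borel_measurable_PiM_prod[OF H] comp borel_measurable_const)
    show ?thesis unfolding \<Phi>_def[abs_def] by measurable
  qed
  have Gm': "(\<lambda>p. G (fst p) (fst (snd p)) (snd (snd p))) \<in> borel_measurable (?V \<Otimes>\<^sub>M ?X \<Otimes>\<^sub>M sphere_measure)"
    using Gm by (simp add: case_prod_beta')
  have "(\<integral>\<^sup>+(V, X, \<omega>). G V X \<omega> \<partial>(?V \<Otimes>\<^sub>M ?X \<Otimes>\<^sub>M sphere_measure)) =
      (\<integral>\<^sup>+V. (\<integral>\<^sup>+p. G V (fst p) (snd p) \<partial>(?X \<Otimes>\<^sub>M sphere_measure)) \<partial>?V)"
    using MXS.P.nn_integral_fst[OF Gm'] by (simp add: case_prod_beta')
  also have "\<dots> = (\<integral>\<^sup>+V. (\<integral>\<^sup>+X. (\<integral>\<^sup>+\<omega>. G V X \<omega> \<partial>sphere_measure) \<partial>?X) \<partial>?V)"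
  proof (rule nn_integral_cong)
    fix V assume V: "V \<in> space ?V"
    have "(\<lambda>p. G V (fst p) (snd p)) \<in> borel_measurable (?X \<Otimes>\<^sub>M sphere_measure)"
      using measurable_compose[OF measurable_Pair1'[OF V] Gm'] by simp
    from S.nn_integral_fst[OF this]
    show "(\<integral>\<^sup>+p. G V (fst p) (snd p) \<partial>(?X \<Otimes>\<^sub>M sphere_measure)) =
      (\<integral>\<^sup>+X. (\<integral>\<^sup>+\<omega>. G V X \<omega> \<partial>sphere_measure) \<partial>?X)" by simp
  qed
  also have "\<dots> \<le> (\<integral>\<^sup>+V. (\<integral>\<^sup>+X. (\<integral>\<^sup>+x. \<Phi> V (X(j := x)) \<partial>lborel) \<partial>?X) \<partial>?V)"
    using ij(3) by (intro nn_integral_mono order_trans[OF inner]) (auto simp: \<Phi>_def)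
  also have "\<dots> = (\<integral>\<^sup>+V. (\<integral>\<^sup>+X. \<Phi> V X \<partial>?V) \<partial>?V)"
  proof (rule nn_integral_cong)
    fix V
    have "insert j ({1..s} - {j}) = {1..s}" using ij(2) by auto
    then show "(\<integral>\<^sup>+X. (\<integral>\<^sup>+x. \<Phi> V (X(j := x)) \<partial>lborel) \<partial>?X) = (\<integral>\<^sup>+X. \<Phi> V X \<partial>?V)"
      using B.product_nn_integral_insert[of "{1..s} - {j}" j "\<Phi> V"] \<Phi>m[of V] by simp
  qed
  also have "\<dots> = (\<integral>\<^sup>+Z. ennreal (shell d (fst (Z j) - fst (Z i)) (snd (Z j) - snd (Z i))) * H Z \<partial>(\<Pi>\<^sub>M k\<in>{1..s}. lborel))"
  proof -
    have "(\<lambda>Z. ennreal (shell d (fst (Z j) - fst (Z i)) (snd (Z j) - snd (Z i))) * H Z) \<in>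
        borel_measurable (\<Pi>\<^sub>M k\<in>{1..s}. lborel)"
      using H measurable_pair_shell[OF ij(1,2), of d]
      by (intro borel_measurable_times_ennreal measurable_compose[OF _ measurable_ennreal]) auto
    from nn_integral_PiM_lborel_prod[OF _ this] show ?thesis
      using ij by (simp add: \<Phi>_def)
  qed
  finally show "(\<integral>\<^sup>+(V, X, \<omega>). ennreal ((\<omega> \<bullet> (V j - V i))\<^sup>2) *
       ((\<integral>\<^sup>+r. H (pair_config s i j X V \<omega> r) * indicator {1<..<1 + d} r \<partial>lborel) * ennreal (1 / d))
      \<partial>(?V \<Otimes>\<^sub>M ?X \<Otimes>\<^sub>M sphere_measure))
    \<le> (\<integral>\<^sup>+Z. ennreal (shell d (fst (Z j) - fst (Z i)) (snd (Z j) - snd (Z i))) * H Z \<partial>(\<Pi>\<^sub>M k\<in>{1..s}. lborel))"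
    unfolding G_def .
qed

section \<open>Traces as limits of shell averages\<close>

lemma trace_average:
  assumes "0 < \<delta>" and le: "\<And>r. ennreal c \<le> f r"
  shows "ennreal c \<le> (\<integral>\<^sup>+r\<in>{1<..<1 + \<delta>}. f r \<partial>lborel) * ennreal (1 / \<delta>)"
proof -
  have "ennreal c = (ennreal c * ennreal \<delta>) * ennreal (1 / \<delta>)"
    using assms(1) by (simp add: mult.assoc ennreal_mult[symmetric])
  also have "ennreal c * ennreal \<delta> = (\<integral>\<^sup>+r. ennreal c * indicator {1<..<1 + \<delta>} r \<partial>lborel)"
    using assms(1) by (subst nn_integral_cmult_indicator) auto
  also have "\<dots> \<le> (\<integral>\<^sup>+r\<in>{1<..<1 + \<delta>}. f r \<partial>lborel)"
    using le by (intro nn_integral_mono mult_right_mono) auto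
  finally show ?thesis by (simp add: mult_right_mono)
qed

lemma has_trace_sequence:
  assumes "has_trace F s i j X V \<omega> g"
  shows "(\<lambda>n. (\<integral>\<^sup>+r\<in>{1<..<1 + 1 / real (Suc n)}. ennreal \<bar>F (pair_config s i j X V \<omega> r) - g\<bar> \<partial>lborel)
      * ennreal (real (Suc n))) \<longlonglongrightarrow> 0"
proof -
  have "filterlim (\<lambda>n. 1 / real (Suc n)) (at_right 0) sequentially"
    unfolding filterlim_at using LIMSEQ_inverse_real_of_nat by (simp add: inverse_eq_divide)
  from filterlim_compose[OF assms[unfolded has_trace_def] this]
  have "(\<lambda>n. (\<integral>\<^sup>+r\<in>{1<..<1 + 1 / real (Suc n)}. ennreal \<bar>F (pair_config s i j X V \<omega> r) - g\<bar> \<partial>lborel)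
      / ennreal (1 / real (Suc n))) \<longlonglongrightarrow> 0" .
  moreover have "x / ennreal (1 / real (Suc n)) = x * ennreal (real (Suc n))" for x n
    by (simp add: divide_ennreal_def inverse_ennreal del: of_nat_Suc)
  ultimately show ?thesis by (simp only:)
qed

lemma mult_liminf_le:
  fixes c :: ennreal
  shows "c * liminf X \<le> liminf (\<lambda>n. c * X n)"
proof -
  have "c * liminf X = (SUP n. c * (INF m\<in>{n..}. X m))"
    unfolding liminf_SUP_INF by (rule SUP_mult_left_ennreal)
  also have "\<dots> \<le> (SUP n. INF m\<in>{n..}. c * X m)"
    by (intro SUP_mono' INF_greatest mult_left_mono INF_lower) auto
  finally show ?thesis unfolding liminf_SUP_INF .
qed

text \<open>The distance of \<open>g\<close> and \<open>g'\<close> is at most the sum of their mean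
  deviations from \<open>F\<close>, which both tend to 0. Measurability along the normal is what
  allows the average of a sum to be split.\<close>

lemma has_trace_unique:
  fixes F :: "(nat \<Rightarrow> 'a::euclidean_space \<times> 'a) \<Rightarrow> real"
  assumes [measurable]: "(\<lambda>r. F (pair_config s i j X V \<omega> r)) \<in> borel_measurable borel"
    and t: "has_trace F s i j X V \<omega> g" "has_trace F s i j X V \<omega> g'"
  shows "g = g'"
proof -
  define A where "A g n = (\<integral>\<^sup>+r\<in>{1<..<1 + 1 / real (Suc n)}.
      ennreal \<bar>F (pair_config s i j X V \<omega> r) - g\<bar> \<partial>lborel) * ennreal (real (Suc n))" for g n
  have "ennreal \<bar>g - g'\<bar> \<le> A g n + A g' n" for n
  proof -
    have "ennreal \<bar>g - g'\<bar> \<le> (\<integral>\<^sup>+r\<in>{1<..<1 + 1 / real (Suc n)}.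
      (ennreal \<bar>F (pair_config s i j X V \<omega> r) - g\<bar> + ennreal \<bar>F (pair_config s i j X V \<omega> r) - g'\<bar>) \<partial>lborel)
      * ennreal (1 / (1 / real (Suc n)))"
      by (rule trace_average) (auto simp: ennreal_plus[symmetric] simp del: ennreal_plus intro!: ennreal_leI)
    also have "\<dots> = A g n + A g' n"
      unfolding A_def by (simp add: distrib_right nn_integral_add)
    finally show ?thesis .
  qed
  moreover have "(\<lambda>n. A g n + A g' n) \<longlonglongrightarrow> 0 + 0"
    unfolding A_def by (intro tendsto_add has_trace_sequence t)
  ultimately have "ennreal \<bar>g - g'\<bar> \<le> 0"
    by (intro LIMSEQ_le_const[of "\<lambda>n. A g n + A g' n"]) auto
  then show ?thesis by (simp add: ennreal_eq_0_iff)
qed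

text \<open>Averaging \<open>g \<le> \<bar>F - g\<bar> + F\<close> over a thin shell bounds a trace
  by the mean of \<open>F\<close> up to a mean deviation that vanishes in the limit. Uniqueness
  identifies the value chosen by \<open>THE\<close>.\<close>

lemma boundary_trace_le:
  fixes F :: "(nat \<Rightarrow> 'a::euclidean_space \<times> 'a) \<Rightarrow> real"
  assumes m [measurable]: "(\<lambda>r. F (pair_config s i j X V \<omega> r)) \<in> borel_measurable borel"
    and nn: "\<And>r. 0 \<le> F (pair_config s i j X V \<omega> r)"
  shows "ennreal (boundary_trace F s i j X V \<omega>) \<le>
    liminf (\<lambda>n. (\<integral>\<^sup>+r\<in>{1<..<1 + 1 / real (Suc n)}. ennreal (F (pair_config s i j X V \<omega> r)) \<partial>lborel)
      * ennreal (real (Suc n)))"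
proof (cases "\<exists>g. has_trace F s i j X V \<omega> g")
  case True
  then obtain g where g: "has_trace F s i j X V \<omega> g" by blast
  then have "(THE g. has_trace F s i j X V \<omega> g) = g"
    using has_trace_unique[OF m] by blast
  then have b: "boundary_trace F s i j X V \<omega> = g" using True by (simp add: boundary_trace_def)
  define A where "A n = (\<integral>\<^sup>+r\<in>{1<..<1 + 1 / real (Suc n)}. ennreal (F (pair_config s i j X V \<omega> r)) \<partial>lborel)
      * ennreal (real (Suc n))" for n
  define B where "B n = (\<integral>\<^sup>+r\<in>{1<..<1 + 1 / real (Suc n)}.
      ennreal \<bar>F (pair_config s i j X V \<omega> r) - g\<bar> \<partial>lborel) * ennreal (real (Suc n))" for n
  have "ennreal g \<le> B n + A n" for n
  proof -
    have "ennreal g \<le> (\<integral>\<^sup>+r\<in>{1<..<1 + 1 / real (Suc n)}.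
      (ennreal \<bar>F (pair_config s i j X V \<omega> r) - g\<bar> + ennreal (F (pair_config s i j X V \<omega> r))) \<partial>lborel)
      * ennreal (1 / (1 / real (Suc n)))"
      using nn by (intro trace_average)
        (auto simp: ennreal_plus[symmetric] simp del: ennreal_plus intro!: ennreal_leI)
    also have "\<dots> = B n + A n"
      unfolding A_def B_def by (simp add: distrib_right nn_integral_add)
    finally show ?thesis .
  qed
  then have AB: "ennreal g - B n \<le> A n" for n by (simp add: ennreal_minus_le_iff)
  have "(\<lambda>n. ennreal g - B n) \<longlonglongrightarrow> ennreal g - 0"
    unfolding B_def by (intro tendsto_diff_ennreal tendsto_const has_trace_sequence g) auto
  then have "ennreal g = liminf (\<lambda>n. ennreal g - B n)"
    using lim_imp_Liminf[OF sequentially_bot] by force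
  also have "\<dots> \<le> liminf A" by (intro Liminf_mono always_eventually allI AB)
  finally show ?thesis unfolding b A_def .
\<comment> \<open>Where no trace exists, the default value 0 makes the bound trivial.\<close>
qed (simp add: boundary_trace_def)

text \<open>\<open>marginal\<close> is a Bochner integral and defaults to 0 on a fibre where
  \<open>F\<close> is not integrable. It therefore lies below the nonnegative integral over the
  fibre, which is the quantity that Tonelli's theorem handles.\<close>

lemma
  fixes F :: "(nat \<Rightarrow> 'a::euclidean_space \<times> 'a) \<Rightarrow> real"
  assumes F: "F \<in> borel_measurable (phase_measure N)" and nn: "\<And>Z. 0 \<le> F Z" and s: "s \<le> N"
  shows marginal_measurable: "marginal N s F \<in> borel_measurable (\<Pi>\<^sub>M k\<in>{1..s}. lborel)"
    and marginal_nonneg: "0 \<le> marginal N s F Z"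
    and marginal_le: "Z \<in> space (\<Pi>\<^sub>M k\<in>{1..s}. lborel :: ('a \<times> 'a) measure) \<Longrightarrow> ennreal (marginal N s F Z) \<le>
          (\<integral>\<^sup>+Y. ennreal (F (merge {1..s} {s+1..N} (Z, Y))) \<partial>(\<Pi>\<^sub>M k\<in>{s+1..N}. lborel))"
    and marginal_nn_measurable: "(\<lambda>Z. \<integral>\<^sup>+Y. ennreal (F (merge {1..s} {s+1..N} (Z, Y))) \<partial>(\<Pi>\<^sub>M k\<in>{s+1..N}. lborel))
          \<in> borel_measurable (\<Pi>\<^sub>M k\<in>{1..s}. lborel)"
proof -
  interpret J: sigma_finite_measure "\<Pi>\<^sub>M k\<in>{s+1..N}. lborel :: ('a \<times> 'a) measure"
    by (rule sigma_finite_PiM_lborel) simp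
  have un: "{1..s} \<union> {s+1..N} = {1..N}" using s by auto
  have m: "(\<lambda>p. F (merge {1..s} {s+1..N} p)) \<in>
      borel_measurable ((\<Pi>\<^sub>M k\<in>{1..s}. lborel) \<Otimes>\<^sub>M (\<Pi>\<^sub>M k\<in>{s+1..N}. lborel))"
    using measurable_compose[OF measurable_merge, of F "{1..s}" "{s+1..N}" "\<lambda>_. lborel"] F
    unfolding un phase_measure_def by auto
  show "marginal N s F \<in> borel_measurable (\<Pi>\<^sub>M k\<in>{1..s}. lborel)"
    unfolding marginal_def[abs_def]
    by (rule J.borel_measurable_lebesgue_integral) (use m in \<open>simp add: case_prod_beta'\<close>)
  show "(\<lambda>Z. \<integral>\<^sup>+Y. ennreal (F (merge {1..s} {s+1..N} (Z, Y))) \<partial>(\<Pi>\<^sub>M k\<in>{s+1..N}. lborel))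
          \<in> borel_measurable (\<Pi>\<^sub>M k\<in>{1..s}. lborel)"
    by (rule J.borel_measurable_nn_integral) (use m in \<open>simp add: case_prod_beta'\<close>)
  show "0 \<le> marginal N s F Z"
    unfolding marginal_def by (intro integral_nonneg_AE AE_I2 nn)
  show "ennreal (marginal N s F Z) \<le>
          (\<integral>\<^sup>+Y. ennreal (F (merge {1..s} {s+1..N} (Z, Y))) \<partial>(\<Pi>\<^sub>M k\<in>{s+1..N}. lborel))"
  proof (cases "integrable (\<Pi>\<^sub>M k\<in>{s+1..N}. lborel) (\<lambda>Y. F (merge {1..s} {s+1..N} (Z, Y)))")
    case True
    then show ?thesis unfolding marginal_def
      by (subst nn_integral_eq_integral) (auto simp: nn)
  qed (simp add: marginal_def not_integrable_integral_eq)
qed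

text \<open>The pointwise bound on the trace comes first, so that Fatou's lemma is applied to the
  measurable shell averages \<open>U n\<close> and not to the trace itself. The surface integral of
  \<open>U n\<close> is then bounded by an integral over \<open>s\<close> particles, and the
  integrated-out particles are restored.\<close>

lemma trace_integral_le:
  fixes F :: "(nat \<Rightarrow> 'a::euclidean_space \<times> 'a) \<Rightarrow> real"
  assumes F: "F \<in> borel_measurable (phase_measure N)" and nn: "\<And>Z. 0 \<le> F Z" and s: "s \<le> N"
    and ij: "i \<in> {1..s}" "j \<in> {1..s}" "i \<noteq> j"
  shows "(\<integral>\<^sup>+(V, X, \<omega>). ennreal (\<bar>\<omega> \<bullet> (V j - V i)\<bar>\<^sup>2 * boundary_trace (marginal N s F) s i j X V \<omega>)
      \<partial>((\<Pi>\<^sub>M k\<in>{1..s}. lborel) \<Otimes>\<^sub>M (\<Pi>\<^sub>M k\<in>{1..s} - {j}. lborel) \<Otimes>\<^sub>M sphere_measure)) \<le>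
    liminf (\<lambda>n. \<integral>\<^sup>+Z. ennreal (shell (1 / real (Suc n)) (fst (Z j) - fst (Z i)) (snd (Z j) - snd (Z i)))
      * ennreal (F Z) \<partial>phase_measure N)"
proof -
  interpret A: product_sigma_finite "\<lambda>_::nat. lborel :: ('a \<times> 'a) measure" by (rule product_sigma_finite_lborel)
  let ?P = "(\<Pi>\<^sub>M k\<in>{1..s}. lborel :: 'a measure) \<Otimes>\<^sub>M (\<Pi>\<^sub>M k\<in>{1..s} - {j}. lborel :: 'a measure) \<Otimes>\<^sub>M
    (sphere_measure :: 'a measure)"
  define H where "H Z = (\<integral>\<^sup>+Y. ennreal (F (merge {1..s} {s+1..N} (Z, Y))) \<partial>(\<Pi>\<^sub>M k\<in>{s+1..N}. lborel))" for Z
  define U where "U n = (\<lambda>(V, X, \<omega>). ennreal ((\<omega> \<bullet> (V j - V i))\<^sup>2) *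
       ((\<integral>\<^sup>+r. H (pair_config s i j X V \<omega> r) * indicator {1<..<1 + 1 / real (Suc n)} r \<partial>lborel)
        * ennreal (1 / (1 / real (Suc n)))))" for n
  have H: "H \<in> borel_measurable (\<Pi>\<^sub>M k\<in>{1..s}. lborel)"
    unfolding H_def[abs_def] by (rule marginal_nn_measurable[OF F nn s])
  have U: "U n \<in> borel_measurable ?P" for n
    unfolding U_def by (rule surface_integrand_measurable[OF H ij]) simp
  have "(\<integral>\<^sup>+(V, X, \<omega>). ennreal (\<bar>\<omega> \<bullet> (V j - V i)\<bar>\<^sup>2 * boundary_trace (marginal N s F) s i j X V \<omega>) \<partial>?P)
      \<le> (\<integral>\<^sup>+p. liminf (\<lambda>n. U n p) \<partial>?P)"
  proof (rule nn_integral_mono, clarify)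
    fix V X and \<omega> :: 'a assume "(V, X, \<omega>) \<in> space ?P"
    then have sp: "V \<in> space (\<Pi>\<^sub>M k\<in>{1..s}. lborel :: 'a measure)"
      "X \<in> space (\<Pi>\<^sub>M k\<in>{1..s} - {j}. lborel :: 'a measure)" by (auto simp: space_pair_measure)
    have mm: "(\<lambda>r. marginal N s F (pair_config s i j X V \<omega> r)) \<in> borel_measurable borel"
      using sp by (intro borel_measurable_pair_config[OF marginal_measurable[OF F nn s] ij(1,3)]) auto
    define c where "c = ennreal ((\<omega> \<bullet> (V j - V i))\<^sup>2)"
    have "ennreal (\<bar>\<omega> \<bullet> (V j - V i)\<bar>\<^sup>2 * boundary_trace (marginal N s F) s i j X V \<omega>) =
        c * ennreal (boundary_trace (marginal N s F) s i j X V \<omega>)"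
      unfolding c_def by (subst ennreal_mult'[symmetric]) auto
    also have "\<dots> \<le> c * liminf (\<lambda>n. (\<integral>\<^sup>+r\<in>{1<..<1 + 1 / real (Suc n)}.
        ennreal (marginal N s F (pair_config s i j X V \<omega> r)) \<partial>lborel) * ennreal (real (Suc n)))"
      by (intro mult_left_mono boundary_trace_le mm marginal_nonneg[OF F nn s]) auto
    also have "\<dots> \<le> liminf (\<lambda>n. c * ((\<integral>\<^sup>+r\<in>{1<..<1 + 1 / real (Suc n)}.
        ennreal (marginal N s F (pair_config s i j X V \<omega> r)) \<partial>lborel) * ennreal (real (Suc n))))"
      by (rule mult_liminf_le)
    also have "\<dots> \<le> liminf (\<lambda>n. U n (V, X, \<omega>))"
    proof (intro Liminf_mono always_eventually allI)
      fix n
      have "ennreal (marginal N s F (pair_config s i j X V \<omega> r)) \<le> H (pair_config s i j X V \<omega> r)" for r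
        unfolding H_def by (rule marginal_le[OF F nn s]) (auto simp: pair_config_def space_PiM)
      then show "c * ((\<integral>\<^sup>+r\<in>{1<..<1 + 1 / real (Suc n)}.
        ennreal (marginal N s F (pair_config s i j X V \<omega> r)) \<partial>lborel) * ennreal (real (Suc n))) \<le> U n (V, X, \<omega>)"
        unfolding U_def c_def prod.case
        by (intro mult_left_mono mult_mono nn_integral_mono) auto
    qed
    finally show "ennreal (\<bar>\<omega> \<bullet> (V j - V i)\<bar>\<^sup>2 * boundary_trace (marginal N s F) s i j X V \<omega>)
      \<le> liminf (\<lambda>n. U n (V, X, \<omega>))" .
  qed
  also have "\<dots> \<le> liminf (\<lambda>n. \<integral>\<^sup>+p. U n p \<partial>?P)"
    by (rule nn_integral_liminf[OF U])
  also have "\<dots> \<le> liminf (\<lambda>n. \<integral>\<^sup>+Z. ennreal (shell (1 / real (Suc n)) (fst (Z j) - fst (Z i)) (snd (Z j) - snd (Z i)))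
      * ennreal (F Z) \<partial>phase_measure N)"
  proof (intro Liminf_mono always_eventually allI)
    fix n
    let ?\<phi> = "\<lambda>Z. ennreal (shell (1 / real (Suc n)) (fst (Z j) - fst (Z i)) (snd (Z j) - snd (Z i)))"
    have un: "{1..s} \<union> {s+1..N} = {1..N}" using s by auto
    have "(\<integral>\<^sup>+p. U n p \<partial>?P) \<le> (\<integral>\<^sup>+Z. ?\<phi> Z * H Z \<partial>(\<Pi>\<^sub>M k\<in>{1..s}. lborel))"
      unfolding U_def by (rule surface_integral_le[OF H ij]) simp
    also have "\<dots> = (\<integral>\<^sup>+Z. (\<integral>\<^sup>+Y. ?\<phi> (merge {1..s} {s+1..N} (Z, Y)) *
        ennreal (F (merge {1..s} {s+1..N} (Z, Y))) \<partial>(\<Pi>\<^sub>M k\<in>{s+1..N}. lborel)) \<partial>(\<Pi>\<^sub>M k\<in>{1..s}. lborel))"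
    proof (rule nn_integral_cong)
      fix Z :: "nat \<Rightarrow> 'a \<times> 'a" assume Z: "Z \<in> space (\<Pi>\<^sub>M k\<in>{1..s}. lborel)"
      have "(\<lambda>p. F (merge {1..s} {s+1..N} p)) \<in>
          borel_measurable ((\<Pi>\<^sub>M k\<in>{1..s}. lborel) \<Otimes>\<^sub>M (\<Pi>\<^sub>M k\<in>{s+1..N}. lborel))"
        using measurable_compose[OF measurable_merge, of F "{1..s}" "{s+1..N}" "\<lambda>_. lborel"] F
        unfolding un phase_measure_def by auto
      from measurable_compose[OF measurable_Pair1'[OF Z] this]
      have m: "(\<lambda>Y. ennreal (F (merge {1..s} {s+1..N} (Z, Y)))) \<in> borel_measurable (\<Pi>\<^sub>M k\<in>{s+1..N}. lborel)"
        by (rule measurable_compose[OF _ measurable_ennreal])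
      \<comment> \<open>The pair belongs to the first \<open>s\<close> particles, so the weight is
        constant in the remaining variables.\<close>
      have "?\<phi> (merge {1..s} {s+1..N} (Z, Y)) = ?\<phi> Z" for Y using ij by (simp add: merge_def)
      then show "?\<phi> Z * H Z = (\<integral>\<^sup>+Y. ?\<phi> (merge {1..s} {s+1..N} (Z, Y)) *
        ennreal (F (merge {1..s} {s+1..N} (Z, Y))) \<partial>(\<Pi>\<^sub>M k\<in>{s+1..N}. lborel))"
        unfolding H_def by (simp only: nn_integral_cmult[OF m])
    qed
    also have "\<dots> = (\<integral>\<^sup>+Z. ?\<phi> Z * ennreal (F Z) \<partial>phase_measure N)"
    proof -
      have "(\<lambda>Z. ?\<phi> Z * ennreal (F Z)) \<in> borel_measurable (\<Pi>\<^sub>M k\<in>{1..N}. lborel)"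
        using F ij s measurable_pair_shell[of i "{1..N}" j "1 / real (Suc n)"]
        by (intro borel_measurable_times_ennreal measurable_compose[OF _ measurable_ennreal])
           (auto simp: phase_measure_def)
      then show ?thesis
        unfolding phase_measure_def un[symmetric]
        by (intro A.product_nn_integral_fold[symmetric]) auto
    qed
    finally show "(\<integral>\<^sup>+p. U n p \<partial>?P) \<le> (\<integral>\<^sup>+Z. ?\<phi> Z * ennreal (F Z) \<partial>phase_measure N)" .
  qed
  finally show ?thesis .
qed

section \<open>The flow\<close>

lemma space_phase_measure: "space (phase_measure N :: (nat \<Rightarrow> 'a::euclidean_space \<times> 'a) measure) = extensional {1..N}"
  by (auto simp: phase_measure_def space_PiM PiE_def)

lemma hs_domain_iff:
  "Z \<in> hs_domain N \<longleftrightarrow> Z \<in> extensional {1..N} \<and>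
     (\<forall>(i, j)\<in>pairs N. 1 < norm (fst (Z j) - fst (Z i)))"
proof -
  have "(\<forall>i j. 1 \<le> i \<and> i < j \<and> j \<le> N \<longrightarrow> norm (fst (Z i) - fst (Z j)) > 1) \<longleftrightarrow>
     (\<forall>(i, j)\<in>pairs N. 1 < norm (fst (Z j) - fst (Z i)))"
  proof safe
    fix i j assume h: "\<forall>i j. 1 \<le> i \<and> i < j \<and> j \<le> N \<longrightarrow> norm (fst (Z i) - fst (Z j)) > 1"
      and ij: "(i, j) \<in> pairs N"
    show "1 < norm (fst (Z j) - fst (Z i))"
      using h[rule_format, of i j] h[rule_format, of j i] ij
      by (cases "i < j") (auto simp: pairs_def norm_minus_commute)
  next
    fix i j assume h: "\<forall>(i, j)\<in>pairs N. 1 < norm (fst (Z j) - fst (Z i))" and "1 \<le> i" "i < j" "j \<le> N"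
    then have "(i, j) \<in> pairs N" by (auto simp: pairs_def)
    then show "norm (fst (Z i) - fst (Z j)) > 1" using h by (auto simp: norm_minus_commute)
  qed
  then show ?thesis by (simp add: hs_domain_def)
qed

lemma hs_domain_extensional: "Z \<in> hs_domain N \<Longrightarrow> Z \<in> extensional {1..N}"
  by (simp add: hs_domain_def)

lemma hs_domain_not_touching: "Z \<in> hs_domain N \<Longrightarrow> \<not> touching N Z"
  unfolding hs_domain_iff touching_def by (fastforce simp: pairs_def)

lemma hs_domain_sets [measurable]: "hs_domain N \<in> sets (phase_measure N :: (nat \<Rightarrow> 'a::euclidean_space \<times> 'a) measure)"
proof -
  have "{Z \<in> space (phase_measure N). 1 < norm (fst (Z j) - fst (Z i) :: 'a)} \<in>
      sets (phase_measure N :: (nat \<Rightarrow> 'a \<times> 'a) measure)" if "(i, j) \<in> pairs N" for i j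
  proof -
    have ij: "i \<in> {1..N}" "j \<in> {1..N}" using that by (auto simp: pairs_def)
    note [measurable] = measurable_position_velocity(1)[OF ij(1)] measurable_position_velocity(1)[OF ij(2)]
    show ?thesis unfolding phase_measure_def by measurable
  qed
  then have "{Z \<in> space (phase_measure N). \<forall>q\<in>pairs N. 1 < norm (fst (Z (snd q)) - fst (Z (fst q)) :: 'a)} \<in>
      sets (phase_measure N :: (nat \<Rightarrow> 'a \<times> 'a) measure)"
    by (intro sets.sets_Collect_finite_All) auto
  moreover have "{Z \<in> space (phase_measure N). \<forall>q\<in>pairs N. 1 < norm (fst (Z (snd q)) - fst (Z (fst q)) :: 'a)} =
      hs_domain N"
    by (simp add: set_eq_iff hs_domain_iff space_phase_measure case_prod_beta)
  ultimately show ?thesis by simp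
qed

section \<open>Invariance of phase space under relabelling\<close>

lemma permute_extensional:
  fixes Z :: "nat \<Rightarrow> 'b"
  assumes "\<sigma> permutes {1..N}"
  shows "Z \<circ> \<sigma> \<in> extensional {1..N} \<longleftrightarrow> Z \<in> extensional {1..N}"
proof -
  have *: "Z \<circ> \<sigma> \<in> extensional {1..N}" if "Z \<in> extensional {1..N}" "\<sigma> permutes {1..N}" for Z :: "nat \<Rightarrow> 'b" and \<sigma>
    using that permutes_not_in by (fastforce simp: extensional_def)
  show ?thesis
    using *[of Z \<sigma>] *[of "Z \<circ> \<sigma>" "inv \<sigma>"] assms permutes_inv[OF assms]
    by (auto simp: comp_assoc permutes_inv_o[OF assms])
qed

lemma permute_hs_domain:
  assumes \<sigma>: "\<sigma> permutes {1..N}"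
  shows "Z \<circ> \<sigma> \<in> hs_domain N \<longleftrightarrow> Z \<in> hs_domain N"
proof -
  have *: "Z \<circ> \<sigma> \<in> hs_domain N" if Z: "Z \<in> hs_domain N" and \<sigma>: "\<sigma> permutes {1..N}"
    for Z :: "nat \<Rightarrow> 'a \<times> 'a" and \<sigma>
  proof -
    have "(\<sigma> i, \<sigma> j) \<in> pairs N" if "(i, j) \<in> pairs N" for i j
      using that permutes_in_image[OF \<sigma>] permutes_inj[OF \<sigma>] by (auto simp: pairs_def dest: injD)
    then show ?thesis
      using Z permute_extensional[OF \<sigma>, of Z] by (fastforce simp: hs_domain_iff)
  qed
  show ?thesis
    using *[of Z \<sigma>] *[of "Z \<circ> \<sigma>" "inv \<sigma>"] \<sigma> permutes_inv[OF \<sigma>]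
    by (auto simp: comp_assoc permutes_inv_o[OF \<sigma>])
qed

lemma measurable_permute:
  assumes \<sigma>: "\<sigma> permutes {1..N}"
  shows "(\<lambda>Z. Z \<circ> \<sigma>) \<in> phase_measure N \<rightarrow>\<^sub>M (phase_measure N :: (nat \<Rightarrow> 'a::euclidean_space \<times> 'a) measure)"
proof -
  have "(\<lambda>Z. \<lambda>k\<in>{1..N}. Z (\<sigma> k)) \<in> phase_measure N \<rightarrow>\<^sub>M (phase_measure N :: (nat \<Rightarrow> 'a \<times> 'a) measure)"
    unfolding phase_measure_def
    using permutes_in_image[OF \<sigma>] by (intro measurable_restrict measurable_component_singleton) auto
  moreover have "Z \<circ> \<sigma> = (\<lambda>k\<in>{1..N}. Z (\<sigma> k))" if "Z \<in> space (phase_measure N)" for Z :: "nat \<Rightarrow> 'a \<times> 'a"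
    using that permutes_not_in[OF \<sigma>] by (auto simp: space_phase_measure extensional_def restrict_def fun_eq_iff)
  ultimately show ?thesis by (subst measurable_cong) auto
qed

text \<open>Boxes determine the product measure, and the preimage of a box is the box with its sides
  permuted, which has the same volume.\<close>

lemma distr_permute:
  assumes \<sigma>: "\<sigma> permutes {1..N}"
  shows "distr (phase_measure N) (phase_measure N) (\<lambda>Z. Z \<circ> \<sigma>) =
    (phase_measure N :: (nat \<Rightarrow> 'a::euclidean_space \<times> 'a) measure)"
proof -
  interpret A: product_sigma_finite "\<lambda>_::nat. lborel :: ('a \<times> 'a) measure" by (rule product_sigma_finite_lborel)
  let ?P = "\<Pi>\<^sub>M k\<in>{1..N}. lborel :: ('a \<times> 'a) measure"
  note m = measurable_permute[OF \<sigma>, where 'a = 'a, unfolded phase_measure_def]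
  have \<rho>: "inv \<sigma> permutes {1..N}" by (rule permutes_inv[OF \<sigma>])
  have "distr ?P ?P (\<lambda>Z. Z \<circ> \<sigma>) = ?P"
  proof (rule A.PiM_eqI)
    fix A :: "nat \<Rightarrow> ('a \<times> 'a) set" assume A: "\<And>i. i \<in> {1..N} \<Longrightarrow> A i \<in> sets lborel"
    have *: "(\<lambda>Z. Z \<circ> \<sigma>) -` Pi\<^sub>E {1..N} A \<inter> space ?P = Pi\<^sub>E {1..N} (\<lambda>k. A (inv \<sigma> k))"
    proof (intro set_eqI iffI)
      fix Z assume Z: "Z \<in> (\<lambda>Z. Z \<circ> \<sigma>) -` Pi\<^sub>E {1..N} A \<inter> space ?P"
      have "Z k \<in> A (inv \<sigma> k)" if k: "k \<in> {1..N}" for k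
      proof -
        have "inv \<sigma> k \<in> {1..N}" using permutes_in_image[OF \<rho>] k by simp
        then have "(Z \<circ> \<sigma>) (inv \<sigma> k) \<in> A (inv \<sigma> k)" using Z by (auto simp: PiE_iff)
        then show ?thesis using permutes_inverses(1)[OF \<sigma>] by simp
      qed
      then show "Z \<in> Pi\<^sub>E {1..N} (\<lambda>k. A (inv \<sigma> k))" using Z by (auto simp: space_PiM PiE_iff)
    next
      fix Z assume Z: "Z \<in> Pi\<^sub>E {1..N} (\<lambda>k. A (inv \<sigma> k))"
      then have "Z \<in> extensional {1..N}" by (auto simp: PiE_iff)
      then have e: "Z \<circ> \<sigma> \<in> extensional {1..N}" using permute_extensional[OF \<sigma>] by blast
      have "(Z \<circ> \<sigma>) k \<in> A k" if k: "k \<in> {1..N}" for k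
      proof -
        have "\<sigma> k \<in> {1..N}" using permutes_in_image[OF \<sigma>] k by simp
        then have "Z (\<sigma> k) \<in> A (inv \<sigma> (\<sigma> k))" using Z by (auto simp: PiE_iff)
        then show ?thesis using permutes_inverses(2)[OF \<sigma>] by simp
      qed
      then show "Z \<in> (\<lambda>Z. Z \<circ> \<sigma>) -` Pi\<^sub>E {1..N} A \<inter> space ?P"
        using Z e by (auto simp: space_PiM PiE_iff)
    qed
    have A': "A (inv \<sigma> k) \<in> sets lborel" if "k \<in> {1..N}" for k
      using A permutes_in_image[OF \<rho>] that by blast
    have "Pi\<^sub>E {1..N} A \<in> sets ?P" using A by (intro sets_PiM_I_finite) auto
    then have "emeasure (distr ?P ?P (\<lambda>Z. Z \<circ> \<sigma>)) (Pi\<^sub>E {1..N} A) = emeasure ?P (Pi\<^sub>E {1..N} (\<lambda>k. A (inv \<sigma> k)))"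
      by (simp only: emeasure_distr[OF m] *)
    also have "\<dots> = (\<Prod>k\<in>{1..N}. emeasure lborel (A (inv \<sigma> k)))"
      using A' by (intro A.emeasure_PiM) auto
    also have "\<dots> = (\<Prod>k\<in>{1..N}. emeasure lborel (A k))"
      using prod.permute[OF \<rho>, of "\<lambda>k. emeasure lborel (A k)"] by (simp add: o_def)
    finally show "emeasure (distr ?P ?P (\<lambda>Z. Z \<circ> \<sigma>)) (Pi\<^sub>E {1..N} A) = (\<Prod>k\<in>{1..N}. emeasure lborel (A k))" .
  qed simp_all
  then show ?thesis by (simp add: phase_measure_def)
qed

lemma nn_integral_permute:
  fixes f :: "(nat \<Rightarrow> 'a::euclidean_space \<times> 'a) \<Rightarrow> ennreal"
  assumes \<sigma>: "\<sigma> permutes {1..N}" and f: "f \<in> borel_measurable (phase_measure N)"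
  shows "(\<integral>\<^sup>+Z. f (Z \<circ> \<sigma>) \<partial>phase_measure N) = (\<integral>\<^sup>+Z. f Z \<partial>phase_measure N)"
  using nn_integral_distr[OF measurable_permute[OF \<sigma>] , of f] f by (simp add: distr_permute[OF \<sigma>])

lemma AE_permute:
  assumes \<sigma>: "\<sigma> permutes {1..N}"
    and "AE Z in (phase_measure N :: (nat \<Rightarrow> 'a::euclidean_space \<times> 'a) measure). P Z"
  shows "AE Z in phase_measure N. P (Z \<circ> \<sigma>)"
proof -
  obtain B :: "(nat \<Rightarrow> 'a \<times> 'a) set" where
    B: "{Z \<in> space (phase_measure N). \<not> P Z} \<subseteq> B" "B \<in> null_sets (phase_measure N)"
    using assms(2) by (auto simp: eventually_ae_filter)
  have "(\<lambda>Z. Z \<circ> \<sigma>) -` B \<inter> space (phase_measure N) \<in> null_sets (phase_measure N)"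
  proof -
    have "emeasure (distr (phase_measure N) (phase_measure N) (\<lambda>Z. Z \<circ> \<sigma>)) B = 0"
      using B(2) by (simp add: distr_permute[OF \<sigma>] null_setsD1)
    then show ?thesis
      using B(2) measurable_sets[OF measurable_permute[OF \<sigma>]]
      by (subst (asm) emeasure_distr[OF measurable_permute[OF \<sigma>]]) (auto simp: null_sets_def)
  qed
  then show ?thesis
    by (rule AE_I') (use B(1) measurable_space[OF measurable_permute[OF \<sigma>]] in auto)
qed

definition regular :: "nat \<Rightarrow> (real \<Rightarrow> (nat \<Rightarrow> 'a::euclidean_space \<times> 'a) \<Rightarrow> nat \<Rightarrow> 'a \<times> 'a) \<Rightarrow>
    (nat \<Rightarrow> 'a \<times> 'a) \<Rightarrow> bool" where
  "regular N \<psi> Z \<longleftrightarrow> \<psi> 0 Z = Z \<and> billiard N (\<lambda>t. \<psi> t Z)"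

lemma density_extensional_zero:
  assumes f: "hs_initial_density N f0" and Z: "Z \<in> extensional {1..N}" "Z \<notin> hs_domain N"
  shows "f0 Z = 0"
  using assms unfolding hs_initial_density_def by blast

lemma density_measurable: "hs_initial_density N f0 \<Longrightarrow> f0 \<in> borel_measurable (phase_measure N)"
  unfolding hs_initial_density_def by auto

lemma density_nonneg: "hs_initial_density N f0 \<Longrightarrow> Z \<in> extensional {1..N} \<Longrightarrow> 0 \<le> f0 Z"
  unfolding hs_initial_density_def by blast

text \<open>The shell weight of one pair at time \<open>t\<close>, averaged over the initial
  density. The indicator at time \<open>t\<close> is kept because preservation of measure is given
  for sets inside the domain.\<close>

definition pair_flux :: "nat \<Rightarrow> (real \<Rightarrow> (nat \<Rightarrow> 'a::euclidean_space \<times> 'a) \<Rightarrow> nat \<Rightarrow> 'a \<times> 'a) \<Rightarrow>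
    ((nat \<Rightarrow> 'a \<times> 'a) \<Rightarrow> real) \<Rightarrow> real \<Rightarrow> real \<Rightarrow> nat \<Rightarrow> nat \<Rightarrow> ennreal" where
  "pair_flux N \<psi> f0 d t i j = (\<integral>\<^sup>+Y. ennreal (shell d (fst (\<psi> t Y j) - fst (\<psi> t Y i)) (snd (\<psi> t Y j) - snd (\<psi> t Y i)))
      * indicator (hs_domain N) (\<psi> t Y) * ennreal (f0 Y) * indicator (hs_domain N) Y \<partial>phase_measure N)"

lemma exists_permutation:
  assumes "(i, j) \<in> pairs N" "(a, b) \<in> pairs N"
  obtains \<sigma> where "\<sigma> permutes {1..N}" "\<sigma> i = a" "\<sigma> j = b"
proof -
  \<comment> \<open>The first transposition sends \<open>i\<close> to \<open>a\<close>. The second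
    sends the image of \<open>j\<close> to \<open>b\<close> and fixes \<open>a\<close>, which is
    neither of the two points that it exchanges.\<close>
  define \<tau> where "\<tau> = Transposition.transpose i a"
  define \<rho> where "\<rho> = Transposition.transpose (\<tau> j) b"
  have \<tau>: "\<tau> permutes {1..N}" unfolding \<tau>_def using assms by (intro permutes_swap_id) (auto simp: pairs_def)
  have "\<tau> j \<in> {1..N}" using permutes_in_image[OF \<tau>] assms by (auto simp: pairs_def)
  then have \<rho>: "\<rho> permutes {1..N}" unfolding \<rho>_def using assms by (intro permutes_swap_id) (auto simp: pairs_def)
  have "\<tau> j \<noteq> \<tau> i" using assms permutes_inj[OF \<tau>] by (auto simp: pairs_def dest: injD)
  then have "\<tau> j \<noteq> a" by (simp add: \<tau>_def)
  moreover have "a \<noteq> b" using assms by (simp add: pairs_def)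
  ultimately have "(\<rho> \<circ> \<tau>) i = a" "(\<rho> \<circ> \<tau>) j = b"
    by (simp_all add: \<tau>_def \<rho>_def transpose_apply_other)
  then show ?thesis using that[OF permutes_compose[OF \<tau> \<rho>]] by simp
qed

lemma card_pairs_real: "1 \<le> N \<Longrightarrow> real (card (pairs N)) = real N * (real N - 1)"
proof -
  assume N: "1 \<le> N"
  have "pairs N = {1..N} \<times> {1..N} - (\<lambda>i. (i, i)) ` {1..N}" by (auto simp: pairs_def)
  then have "card (pairs N) = card ({1..N} \<times> {1..N}) - card ((\<lambda>i. (i, i)) ` {1..N})"
    by (simp add: card_Diff_subset image_subset_iff)
  also have "\<dots> = N * N - N" by (simp add: card_image inj_on_def)
  finally show ?thesis using N by (simp add: of_nat_diff algebra_simps)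
qed

text \<open>The flow is measurable for each time only. This version is jointly measurable and agrees with it
  at the times without contact.\<close>

definition sampled :: "(real \<Rightarrow> (nat \<Rightarrow> 'a::euclidean_space \<times> 'a) \<Rightarrow> nat \<Rightarrow> 'a \<times> 'a) \<Rightarrow> real \<Rightarrow> (nat \<Rightarrow> 'a \<times> 'a) \<Rightarrow> nat \<Rightarrow> 'a \<times> 'a" where
  "sampled \<psi> t Y k = (lim (\<lambda>m. fst (\<psi> (of_int \<lfloor>t * real (Suc m)\<rfloor> / real (Suc m)) Y k)),
     lim (\<lambda>m. snd (\<psi> (of_int \<lfloor>t * real (Suc m)\<rfloor> / real (Suc m)) Y k)))"

lemma floor_sample_tendsto: "(\<lambda>m. of_int \<lfloor>t * real (Suc m)\<rfloor> / real (Suc m)) \<longlonglongrightarrow> t"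
proof -
  have "(\<lambda>m. t - 1 / real (Suc m)) \<longlonglongrightarrow> t - 0"
    using LIMSEQ_inverse_real_of_nat by (intro tendsto_diff tendsto_const) (simp add: inverse_eq_divide)
  then have lower: "(\<lambda>m. t - 1 / real (Suc m)) \<longlonglongrightarrow> t" by simp
  show ?thesis
  proof (rule tendsto_sandwich[OF _ _ lower tendsto_const])
    show "\<forall>\<^sub>F m in sequentially. t - 1 / real (Suc m) \<le> of_int \<lfloor>t * real (Suc m)\<rfloor> / real (Suc m)"
    proof (intro always_eventually allI)
      fix m
      have "t * real (Suc m) - 1 \<le> of_int \<lfloor>t * real (Suc m)\<rfloor>" by linarith
      then have "(t * real (Suc m) - 1) / real (Suc m) \<le> of_int \<lfloor>t * real (Suc m)\<rfloor> / real (Suc m)"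
        by (rule divide_right_mono) simp
      then show "t - 1 / real (Suc m) \<le> of_int \<lfloor>t * real (Suc m)\<rfloor> / real (Suc m)"
        by (simp add: diff_divide_distrib del: of_nat_Suc)
    qed
    show "\<forall>\<^sub>F m in sequentially. of_int \<lfloor>t * real (Suc m)\<rfloor> / real (Suc m) \<le> t"
    proof (intro always_eventually allI)
      fix m
      have "of_int \<lfloor>t * real (Suc m)\<rfloor> \<le> t * real (Suc m)" by linarith
      then have "of_int \<lfloor>t * real (Suc m)\<rfloor> / real (Suc m) \<le> t * real (Suc m) / real (Suc m)"
        by (rule divide_right_mono) simp
      then show "of_int \<lfloor>t * real (Suc m)\<rfloor> / real (Suc m) \<le> t" by (simp del: of_nat_Suc)
    qed
  qed
qed

section \<open>Consequences of the flow axioms\<close>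

context
  fixes N :: nat and \<psi> :: "real \<Rightarrow> (nat \<Rightarrow> 'a::euclidean_space \<times> 'a) \<Rightarrow> nat \<Rightarrow> 'a \<times> 'a"
  assumes flow: "hard_sphere_flow N \<psi>"
begin

lemma flow_measurable [measurable]: "\<psi> t \<in> phase_measure N \<rightarrow>\<^sub>M phase_measure N"
  using flow by (simp add: hard_sphere_flow_def)

lemma flow_extensional: "Z \<in> hs_domain N \<Longrightarrow> \<psi> t Z \<in> extensional {1..N}"
  using measurable_space[OF flow_measurable, of Z t] hs_domain_extensional[of Z N]
  by (simp add: space_phase_measure)

lemma AE_regular: "AE Z in phase_measure N. Z \<in> hs_domain N \<longrightarrow> regular N \<psi> Z"
proof -
  have "AE Z in phase_measure N. Z \<in> hs_domain N \<longrightarrow> \<psi> 0 Z = Z \<and> hs_trajectory N (\<lambda>t. \<psi> t Z)"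
    using flow by (simp add: hard_sphere_flow_def)
  then show ?thesis
    by eventually_elim (auto simp: regular_def intro: billiard_of_hs_trajectory)
qed

lemma flow_emeasure: "A \<in> sets (phase_measure N) \<Longrightarrow> A \<subseteq> hs_domain N \<Longrightarrow> emeasure (phase_measure N) (\<psi> t -` A \<inter> hs_domain N) = emeasure (phase_measure N) A"
  using flow by (simp add: hard_sphere_flow_def)

text \<open>By preservation of measure the exceptional null set pulls back to a null set. Hence
  almost every trajectory can be restarted at time \<open>t\<close> from a regular point.\<close>

lemma AE_flow_regular: "AE Z in phase_measure N. Z \<in> hs_domain N \<longrightarrow> \<psi> t Z \<in> hs_domain N \<longrightarrow> regular N \<psi> (\<psi> t Z)"
proof -
  obtain B where B: "{Z \<in> space (phase_measure N). \<not> (Z \<in> hs_domain N \<longrightarrow> regular N \<psi> Z)} \<subseteq> B" "B \<in> null_sets (phase_measure N)"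
    using AE_regular by (auto simp: eventually_ae_filter)
  have BD: "B \<inter> hs_domain N \<in> sets (phase_measure N)" using B(2) by auto
  have "emeasure (phase_measure N) (B \<inter> hs_domain N) = 0" using B(2) hs_domain_sets by (meson null_setsD1 null_set_Int2)
  then have "emeasure (phase_measure N) (\<psi> t -` (B \<inter> hs_domain N) \<inter> hs_domain N) = 0" using flow_emeasure[OF BD] by simp
  moreover have "\<psi> t -` (B \<inter> hs_domain N) \<inter> hs_domain N \<in> sets (phase_measure N)"
  proof -
    have "\<psi> t -` (B \<inter> hs_domain N) \<inter> hs_domain N = (\<psi> t -` (B \<inter> hs_domain N) \<inter> space (phase_measure N)) \<inter> hs_domain N"
      using sets.sets_into_space[OF hs_domain_sets] by blast
    then show ?thesis using measurable_sets[OF flow_measurable BD] by (metis hs_domain_sets sets.Int)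
  qed
  ultimately have "\<psi> t -` (B \<inter> hs_domain N) \<inter> hs_domain N \<in> null_sets (phase_measure N)" by (simp add: null_sets_def)
  then show ?thesis
    by (rule AE_I')
      (use B(1) flow_extensional in \<open>auto simp: space_phase_measure hs_domain_extensional\<close>)
qed

text \<open>Preservation of measure says that the image measure \<open>\<nu>\<close> and the phase
  measure agree on subsets of the domain. Outside the domain nothing is known about
  \<open>\<nu>\<close>, whence the condition on the support.\<close>

lemma flow_nn_integral:
  assumes H [measurable]: "H \<in> borel_measurable (phase_measure N)"
    and supp: "\<And>Z. Z \<in> space (phase_measure N) \<Longrightarrow> Z \<notin> hs_domain N \<Longrightarrow> H Z = 0"
  shows "(\<integral>\<^sup>+Z. H (\<psi> t Z) * indicator (hs_domain N) Z \<partial>phase_measure N) = (\<integral>\<^sup>+Z. H Z \<partial>phase_measure N)"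
proof -
  define \<nu> where "\<nu> = distr (density (phase_measure N) (indicator (hs_domain N))) (phase_measure N) (\<psi> t)"
  have [measurable_cong, simp]: "sets \<nu> = sets (phase_measure N)" by (simp add: \<nu>_def)
  have HD: "H Z = indicator (hs_domain N) Z * H Z" if "Z \<in> space (phase_measure N)" for Z
    using supp[OF that] by (auto simp: indicator_def)
  have "density (phase_measure N) (indicator (hs_domain N)) = density \<nu> (indicator (hs_domain N))"
  proof (rule measure_eqI)
    fix A :: "(nat \<Rightarrow> 'a \<times> 'a) set" assume "A \<in> sets (density (phase_measure N) (indicator (hs_domain N)))"
    then have A [measurable]: "A \<in> sets (phase_measure N)" by simp
    have "emeasure (density \<nu> (indicator (hs_domain N))) A = emeasure \<nu> (hs_domain N \<inter> A)"
      by (rule emeasure_restricted) auto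
    also have "\<dots> = emeasure (density (phase_measure N) (indicator (hs_domain N))) (\<psi> t -` (hs_domain N \<inter> A) \<inter> space (phase_measure N))"
      unfolding \<nu>_def by (subst emeasure_distr) auto
    also have "\<dots> = emeasure (phase_measure N) (hs_domain N \<inter> (\<psi> t -` (hs_domain N \<inter> A) \<inter> space (phase_measure N)))"
      by (rule emeasure_restricted) auto
    also have "hs_domain N \<inter> (\<psi> t -` (hs_domain N \<inter> A) \<inter> space (phase_measure N)) = \<psi> t -` (hs_domain N \<inter> A) \<inter> hs_domain N"
      using sets.sets_into_space[OF hs_domain_sets] by blast
    also have "emeasure (phase_measure N) \<dots> = emeasure (phase_measure N) (hs_domain N \<inter> A)"
      by (rule flow_emeasure) auto
    also have "\<dots> = emeasure (density (phase_measure N) (indicator (hs_domain N))) A"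
      by (rule emeasure_restricted[symmetric]) auto
    finally show "emeasure (density (phase_measure N) (indicator (hs_domain N))) A = emeasure (density \<nu> (indicator (hs_domain N))) A" ..
  qed simp
  have "(\<integral>\<^sup>+Z. H (\<psi> t Z) * indicator (hs_domain N) Z \<partial>phase_measure N) = (\<integral>\<^sup>+Z. H Z \<partial>\<nu>)"
    unfolding \<nu>_def by (simp add: nn_integral_distr nn_integral_density mult.commute)
  also have "\<dots> = (\<integral>\<^sup>+Z. indicator (hs_domain N) Z * H Z \<partial>\<nu>)"
    using HD sets_eq_imp_space_eq[of \<nu> "phase_measure N"] by (intro nn_integral_cong) auto
  also have "\<dots> = (\<integral>\<^sup>+Z. H Z \<partial>density \<nu> (indicator (hs_domain N)))"
    by (simp add: nn_integral_density)
  also have "\<dots> = (\<integral>\<^sup>+Z. H Z \<partial>density (phase_measure N) (indicator (hs_domain N)))"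
    by (simp add: \<open>density (phase_measure N) (indicator (hs_domain N)) = density \<nu> (indicator (hs_domain N))\<close>)
  also have "\<dots> = (\<integral>\<^sup>+Z. indicator (hs_domain N) Z * H Z \<partial>phase_measure N)"
    by (simp add: nn_integral_density)
  also have "\<dots> = (\<integral>\<^sup>+Z. H Z \<partial>phase_measure N)"
    using HD by (intro nn_integral_cong) auto
  finally show ?thesis .
qed

text \<open>The trajectory started at \<open>\<psi> (- t) Z\<close> and the trajectory of
  \<open>Z\<close> shifted in time have the same data at time 0, so uniqueness identifies them; at
  time \<open>t\<close> the shifted one is back at \<open>Z\<close>. That
  \<open>\<psi> (- t) Z\<close> lies in the domain gives the start without contact.\<close>

lemma flow_inverse: "AE Z in phase_measure N. Z \<in> hs_domain N \<longrightarrow> \<psi> (- t) Z \<in> hs_domain N \<longrightarrow> \<psi> t (\<psi> (- t) Z) = Z"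
  using AE_regular AE_flow_regular[of "- t"]
proof eventually_elim
  case (elim Z)
  show ?case
  proof (intro impI)
    assume Z: "Z \<in> hs_domain N" and Y: "\<psi> (- t) Z \<in> hs_domain N"
    define Y where "Y = \<psi> (- t) Z"
    have rZ: "billiard N (\<lambda>t. \<psi> t Z)" "\<psi> 0 Z = Z" and rY: "billiard N (\<lambda>t. \<psi> t Y)" "\<psi> 0 Y = Y"
      using elim Z Y by (auto simp: regular_def Y_def)
    have "\<psi> t Y k = (\<lambda>s. \<psi> (s + - t) Z) t k" if "k \<in> {1..N}" for k
    proof (rule billiard_unique[OF rY(1) billiard_shift[OF rZ(1)] _ _ _ that])
      show "\<not> touching N (\<psi> 0 Y)" using Y rY(2) by (simp add: Y_def hs_domain_not_touching)
      show "\<psi> 0 Y k = \<psi> (0 + - t) Z k" for k using rY(2) by (simp add: Y_def)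
      show "\<not> touching N (\<psi> t Y) \<or> \<not> touching N (\<psi> (t + - t) Z)"
        using Z rZ(2) by (simp add: hs_domain_not_touching)
    qed
    then have "\<psi> t Y k = Z k" if "k \<in> {1..N}" for k using rZ(2) that by simp
    then show "\<psi> t (\<psi> (- t) Z) = Z"
      using flow_extensional[OF Y, of t] hs_domain_extensional[OF Z]
      by (intro extensionalityI) (auto simp: Y_def)
  qed
qed

text \<open>A relabelled trajectory is a trajectory of the relabelled data, so uniqueness applies.
  One of the two points must lie in the domain, as the velocities at a contact are not
  determined.\<close>

lemma flow_permute:
  assumes \<sigma>: "\<sigma> permutes {1..N}"
  shows "AE Z in phase_measure N. Z \<in> hs_domain N \<longrightarrow> \<psi> t Z \<in> hs_domain N \<or> \<psi> t (Z \<circ> \<sigma>) \<in> hs_domain N \<longrightarrow> \<psi> t (Z \<circ> \<sigma>) = \<psi> t Z \<circ> \<sigma>"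
  using AE_regular AE_permute[OF \<sigma> AE_regular]
proof eventually_elim
  case (elim Z)
  show ?case
  proof (intro impI)
    assume Z: "Z \<in> hs_domain N" and t: "\<psi> t Z \<in> hs_domain N \<or> \<psi> t (Z \<circ> \<sigma>) \<in> hs_domain N"
    have Z\<sigma>: "Z \<circ> \<sigma> \<in> hs_domain N" using Z permute_hs_domain[OF \<sigma>] by blast
    have r: "billiard N (\<lambda>t. \<psi> t Z)" "\<psi> 0 Z = Z" "billiard N (\<lambda>t. \<psi> t (Z \<circ> \<sigma>))" "\<psi> 0 (Z \<circ> \<sigma>) = Z \<circ> \<sigma>"
      using elim Z Z\<sigma> by (auto simp: regular_def)
    have "\<psi> t (Z \<circ> \<sigma>) k = (\<lambda>t. \<psi> t Z \<circ> \<sigma>) t k" if "k \<in> {1..N}" for k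
    proof (rule billiard_unique[OF r(3) billiard_permute[OF r(1) \<sigma>] _ _ _ that])
      show "\<not> touching N (\<psi> 0 (Z \<circ> \<sigma>))" using r(4) hs_domain_not_touching[OF Z\<sigma>] by simp
      show "\<psi> 0 (Z \<circ> \<sigma>) k = (\<psi> 0 Z \<circ> \<sigma>) k" for k using r by simp
      show "\<not> touching N (\<psi> t (Z \<circ> \<sigma>)) \<or> \<not> touching N (\<psi> t Z \<circ> \<sigma>)"
        using t by (auto simp: touching_comp[OF \<sigma>] dest: hs_domain_not_touching)
    qed
    then show "\<psi> t (Z \<circ> \<sigma>) = \<psi> t Z \<circ> \<sigma>"
      using flow_extensional[OF Z\<sigma>, of t] flow_extensional[OF Z, of t] permute_extensional[OF \<sigma>, of "\<psi> t Z"]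
      by (intro extensionalityI[of _ "{1..N}"]) auto
  qed
qed

lemma evolve_measurable:
  assumes f: "hs_initial_density N f0"
  shows "evolve N \<psi> f0 t \<in> borel_measurable (phase_measure N)"
proof -
  note [measurable] = density_measurable[OF f]
  show ?thesis unfolding evolve_def[abs_def] by measurable
qed

lemma evolve_nonneg:
  assumes f: "hs_initial_density N f0"
  shows "0 \<le> evolve N \<psi> f0 t Z"
  using density_nonneg[OF f flow_extensional] by (simp add: evolve_def)

text \<open>\<open>H\<close> is the integrand carried back to the initial data. By
  \<open>flow_inverse\<close>, \<open>H (\<psi> (- t) Z)\<close> is the integrand on the left
  wherever both \<open>Z\<close> and \<open>\<psi> (- t) Z\<close> lie in the domain; elsewhere the
  evolved density is 0.\<close>

lemma evolve_integral_le:
  assumes f: "hs_initial_density N f0" and \<phi> [measurable]: "\<phi> \<in> borel_measurable (phase_measure N)"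
  shows "(\<integral>\<^sup>+Z. \<phi> Z * ennreal (evolve N \<psi> f0 t Z) \<partial>phase_measure N) \<le>
     (\<integral>\<^sup>+Y. \<phi> (\<psi> t Y) * indicator (hs_domain N) (\<psi> t Y) * ennreal (f0 Y) * indicator (hs_domain N) Y \<partial>phase_measure N)"
proof -
  note [measurable] = density_measurable[OF f]
  define H where "H Y = \<phi> (\<psi> t Y) * indicator (hs_domain N) (\<psi> t Y) * ennreal (f0 Y) * indicator (hs_domain N) Y" for Y
  have [measurable]: "H \<in> borel_measurable (phase_measure N)" unfolding H_def[abs_def] by measurable
  have "(\<integral>\<^sup>+Z. \<phi> Z * ennreal (evolve N \<psi> f0 t Z) \<partial>phase_measure N) \<le> (\<integral>\<^sup>+Z. H (\<psi> (- t) Z) * indicator (hs_domain N) Z \<partial>phase_measure N)"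
  proof (rule nn_integral_mono_AE, use flow_inverse[of t] in eventually_elim)
    fix Z assume inv: "Z \<in> hs_domain N \<longrightarrow> \<psi> (- t) Z \<in> hs_domain N \<longrightarrow> \<psi> t (\<psi> (- t) Z) = Z"
    show "\<phi> Z * ennreal (evolve N \<psi> f0 t Z) \<le> H (\<psi> (- t) Z) * indicator (hs_domain N) Z"
    proof (cases "Z \<in> hs_domain N \<and> \<psi> (- t) Z \<in> hs_domain N")
      case True
      then show ?thesis using inv by (simp add: evolve_def H_def)
    next
      case False
      then have "evolve N \<psi> f0 t Z = 0"
        using density_extensional_zero[OF f flow_extensional] by (auto simp: evolve_def)
      then show ?thesis by simp
    qed
  qed
  also have "\<dots> = (\<integral>\<^sup>+Y. H Y \<partial>phase_measure N)"
    by (rule flow_nn_integral) (auto simp: H_def)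
  finally show ?thesis unfolding H_def .
qed

lemma shell_flow_measurable:
  assumes "(i, j) \<in> pairs N"
  shows "(\<lambda>Y. shell d (fst (\<psi> t Y j) - fst (\<psi> t Y i)) (snd (\<psi> t Y j) - snd (\<psi> t Y i))) \<in> borel_measurable (phase_measure N)"
  using assms measurable_compose[OF flow_measurable[of t, unfolded phase_measure_def] measurable_pair_shell[of i _ j d]]
  by (auto simp: pairs_def phase_measure_def)

text \<open>A relabelling that carries one pair to the other preserves phase measure, domain and
  initial density, and commutes with the flow almost everywhere. A single pair can thus be replaced
  by the average over all ordered pairs, which is where the decay in \<open>N\<close> comes
  from.\<close>

lemma pair_flux_symmetric:
  assumes f: "hs_initial_density N f0" and ij: "(i, j) \<in> pairs N" and ab: "(a, b) \<in> pairs N"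
  shows "pair_flux N \<psi> f0 d t i j = pair_flux N \<psi> f0 d t a b"
proof -
  obtain \<sigma> where \<sigma>: "\<sigma> permutes {1..N}" "\<sigma> i = a" "\<sigma> j = b"
    using exists_permutation[OF ij ab] .
  note [measurable] = density_measurable[OF f] shell_flow_measurable[OF ij] shell_flow_measurable[OF ab]
  define G where "G i j Y = ennreal (shell d (fst (\<psi> t Y j) - fst (\<psi> t Y i)) (snd (\<psi> t Y j) - snd (\<psi> t Y i)))
      * indicator (hs_domain N) (\<psi> t Y) * ennreal (f0 Y) * indicator (hs_domain N) Y" for i j Y
  have [measurable]: "G i j \<in> borel_measurable (phase_measure N)" unfolding G_def[abs_def] by measurable
  have "pair_flux N \<psi> f0 d t i j = (\<integral>\<^sup>+Y. G i j Y \<partial>phase_measure N)"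
    unfolding pair_flux_def G_def ..
  also have "\<dots> = (\<integral>\<^sup>+Y. G i j (Y \<circ> \<sigma>) \<partial>phase_measure N)"
    by (rule nn_integral_permute[OF \<sigma>(1), symmetric]) simp
  also have "\<dots> = (\<integral>\<^sup>+Y. G a b Y \<partial>phase_measure N)"
  proof (rule nn_integral_cong_AE, use flow_permute[OF \<sigma>(1), of t] in eventually_elim)
    fix Y assume e: "Y \<in> hs_domain N \<longrightarrow> \<psi> t Y \<in> hs_domain N \<or> \<psi> t (Y \<circ> \<sigma>) \<in> hs_domain N \<longrightarrow> \<psi> t (Y \<circ> \<sigma>) = \<psi> t Y \<circ> \<sigma>"
    show "G i j (Y \<circ> \<sigma>) = G a b Y"
    proof (cases "Y \<in> hs_domain N \<and> (\<psi> t Y \<in> hs_domain N \<or> \<psi> t (Y \<circ> \<sigma>) \<in> hs_domain N)")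
      case True
      then have *: "\<psi> t (Y \<circ> \<sigma>) = \<psi> t Y \<circ> \<sigma>" using e by blast
      have "f0 (Y \<circ> \<sigma>) = f0 Y"
        using f \<sigma>(1) True hs_domain_extensional unfolding hs_initial_density_def by blast
      moreover have "(\<psi> t Y \<circ> \<sigma> \<in> hs_domain N) = (\<psi> t Y \<in> hs_domain N)" "(Y \<circ> \<sigma> \<in> hs_domain N) = (Y \<in> hs_domain N)"
        by (rule permute_hs_domain[OF \<sigma>(1)])+
      ultimately show ?thesis unfolding G_def * using \<sigma>(2,3) by (simp add: indicator_def)
    next
      case False
      moreover have "(Y \<circ> \<sigma> \<in> hs_domain N) = (Y \<in> hs_domain N)" by (rule permute_hs_domain[OF \<sigma>(1)])
      ultimately show ?thesis unfolding G_def by (auto simp: indicator_def)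
    qed
  qed
  finally show ?thesis unfolding pair_flux_def G_def .
qed

lemma sampled_eq:
  assumes "regular N \<psi> Y" "\<not> touching N (\<psi> t Y)" "k \<in> {1..N}"
  shows "sampled \<psi> t Y k = \<psi> t Y k"
proof -
  have b: "billiard N (\<lambda>t. \<psi> t Y)" using assms(1) by (simp add: regular_def)
  have "isCont (\<lambda>t. fst (\<psi> t Y k)) t" by (rule billiard_isCont[OF b assms(3)])
  moreover have "isCont (\<lambda>t. snd (\<psi> t Y k)) t"
    using billiardD(5)[OF b assms(2,3)] by (rule has_vector_derivative_continuous)
  ultimately show ?thesis
    unfolding sampled_def
    using limI[OF isCont_tendsto_compose[OF _ floor_sample_tendsto], of t "\<lambda>t. fst (\<psi> t Y k)"]
      limI[OF isCont_tendsto_compose[OF _ floor_sample_tendsto], of t "\<lambda>t. snd (\<psi> t Y k)"]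
    by (simp only: prod.collapse)
qed

text \<open>At sampling level \<open>m\<close> the flow is evaluated at one of countably many times,
  and at each of them it is measurable in the initial datum. The limit in \<open>m\<close> preserves
  joint measurability.\<close>

lemma sampled_measurable:
  assumes k: "k \<in> {1..N}"
  shows "(\<lambda>p. fst (sampled \<psi> (fst p) (snd p) k)) \<in> borel_measurable (lborel \<Otimes>\<^sub>M phase_measure N)"
    and "(\<lambda>p. snd (sampled \<psi> (fst p) (snd p) k)) \<in> borel_measurable (lborel \<Otimes>\<^sub>M phase_measure N)"
proof -
  have m: "(\<lambda>p. g (\<psi> (of_int \<lfloor>fst p * real (Suc m)\<rfloor> / real (Suc m)) (snd p))) \<in> borel_measurable (lborel \<Otimes>\<^sub>M phase_measure N)"
    if g: "g \<in> borel_measurable (phase_measure N)" for g :: "(nat \<Rightarrow> 'a \<times> 'a) \<Rightarrow> 'a" and m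
  proof -
    define h where "h z p = g (\<psi> (of_int z / real (Suc m)) (snd p))" for z :: int and p :: "real \<times> (nat \<Rightarrow> 'a \<times> 'a)"
    have "(\<lambda>p. h \<lfloor>fst p * real (Suc m)\<rfloor> p) \<in> borel_measurable (lborel \<Otimes>\<^sub>M phase_measure N)"
    proof (rule measurable_compose_countable)
      show "h z \<in> borel_measurable (lborel \<Otimes>\<^sub>M phase_measure N)" for z
        unfolding h_def[abs_def]
        by (rule measurable_compose[OF measurable_compose[OF measurable_snd flow_measurable] g])
      show "(\<lambda>p. \<lfloor>fst p * real (Suc m)\<rfloor>) \<in> lborel \<Otimes>\<^sub>M phase_measure N \<rightarrow>\<^sub>M count_space UNIV" by measurable
    qed
    then show ?thesis unfolding h_def .
  qed
  have g: "(\<lambda>Z. fst (Z k)) \<in> borel_measurable (phase_measure N)" "(\<lambda>Z. snd (Z k)) \<in> borel_measurable (phase_measure N)"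
    unfolding phase_measure_def by (rule measurable_position_velocity[OF k])+
  show "(\<lambda>p. fst (sampled \<psi> (fst p) (snd p) k)) \<in> borel_measurable (lborel \<Otimes>\<^sub>M phase_measure N)"
    unfolding sampled_def fst_conv by (intro borel_measurable_lim_metric m[OF g(1)])
  show "(\<lambda>p. snd (sampled \<psi> (fst p) (snd p) k)) \<in> borel_measurable (lborel \<Otimes>\<^sub>M phase_measure N)"
    unfolding sampled_def snd_conv by (intro borel_measurable_lim_metric m[OF g(2)])
qed

lemma shells_sampled_measurable:
  "(\<lambda>p. shells d N (sampled \<psi> (fst p) (snd p))) \<in> borel_measurable (lborel \<Otimes>\<^sub>M phase_measure N)"
  unfolding shells_def case_prod_beta
  by (intro borel_measurable_sum borel_measurable_shell borel_measurable_diff sampled_measurable)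
     (auto simp: pairs_def)

text \<open>All ordered pairs have the same flux, so the multiple on the left is the flux of the
  whole sum. In the domain there is no contact, and the flow may be replaced by its jointly
  measurable version.\<close>

lemma pair_flux_total_le:
  assumes f: "hs_initial_density N f0" and ij: "(i, j) \<in> pairs N" and d: "0 < d"
  shows "of_nat (card (pairs N)) * pair_flux N \<psi> f0 d t i j \<le>
    (\<integral>\<^sup>+Y. ennreal (shells d N (sampled \<psi> t Y)) * (ennreal (f0 Y) * indicator (hs_domain N) Y) \<partial>phase_measure N)"
proof -
  have "of_nat (card (pairs N)) * pair_flux N \<psi> f0 d t i j = (\<Sum>q\<in>pairs N. pair_flux N \<psi> f0 d t i j)"
    by simp
  also have "\<dots> = (\<Sum>(a, b)\<in>pairs N. pair_flux N \<psi> f0 d t a b)"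
    by (intro sum.cong) (auto intro: pair_flux_symmetric[OF f ij])
  also have "\<dots> = (\<integral>\<^sup>+Y. (\<Sum>(a, b)\<in>pairs N. ennreal (shell d (fst (\<psi> t Y b) - fst (\<psi> t Y a)) (snd (\<psi> t Y b) - snd (\<psi> t Y a)))
      * indicator (hs_domain N) (\<psi> t Y) * ennreal (f0 Y) * indicator (hs_domain N) Y) \<partial>phase_measure N)"
    unfolding pair_flux_def case_prod_beta
  proof (rule nn_integral_sum[symmetric])
    fix q assume "q \<in> pairs N"
    then have q: "(fst q, snd q) \<in> pairs N" by simp
    note [measurable] = density_measurable[OF f] shell_flow_measurable[OF q]
    show "(\<lambda>Y. ennreal (shell d (fst (\<psi> t Y (snd q)) - fst (\<psi> t Y (fst q))) (snd (\<psi> t Y (snd q)) - snd (\<psi> t Y (fst q))))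
      * indicator (hs_domain N) (\<psi> t Y) * ennreal (f0 Y) * indicator (hs_domain N) Y) \<in> borel_measurable (phase_measure N)" by measurable
  qed
  also have "\<dots> \<le> (\<integral>\<^sup>+Y. ennreal (shells d N (sampled \<psi> t Y)) * (ennreal (f0 Y) * indicator (hs_domain N) Y) \<partial>phase_measure N)"
  proof (rule nn_integral_mono_AE, use AE_regular in eventually_elim)
    fix Y assume r: "Y \<in> hs_domain N \<longrightarrow> regular N \<psi> Y"
    show "(\<Sum>(a, b)\<in>pairs N. ennreal (shell d (fst (\<psi> t Y b) - fst (\<psi> t Y a)) (snd (\<psi> t Y b) - snd (\<psi> t Y a)))
      * indicator (hs_domain N) (\<psi> t Y) * ennreal (f0 Y) * indicator (hs_domain N) Y)
      \<le> ennreal (shells d N (sampled \<psi> t Y)) * (ennreal (f0 Y) * indicator (hs_domain N) Y)"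
    proof (cases "Y \<in> hs_domain N \<and> \<psi> t Y \<in> hs_domain N")
      case True
      then have eq: "sampled \<psi> t Y k = \<psi> t Y k" if "k \<in> {1..N}" for k
        using that r hs_domain_not_touching by (intro sampled_eq) auto
      have "shells d N (sampled \<psi> t Y) = shells d N (\<psi> t Y)"
        unfolding shells_def by (intro sum.cong refl) (auto simp: pairs_def eq)
      also have "ennreal \<dots> = (\<Sum>q\<in>pairs N.
          ennreal (shell d (fst (\<psi> t Y (snd q)) - fst (\<psi> t Y (fst q))) (snd (\<psi> t Y (snd q)) - snd (\<psi> t Y (fst q)))))"
        unfolding shells_def case_prod_beta using d
        by (intro sum_ennreal[symmetric]) (auto simp: shell_def)
      finally have "ennreal (shells d N (sampled \<psi> t Y)) = (\<Sum>q\<in>pairs N.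
          ennreal (shell d (fst (\<psi> t Y (snd q)) - fst (\<psi> t Y (fst q))) (snd (\<psi> t Y (snd q)) - snd (\<psi> t Y (fst q)))))" .
      then show ?thesis using True by (simp add: case_prod_beta sum_distrib_right mult.assoc)
    next
      case False
      then show ?thesis by (auto simp: case_prod_beta)
    qed
  qed
  finally show ?thesis .
qed

end

section \<open>The estimate\<close>

text \<open>This turns \<open>shells_integral_bound\<close> into one constant valid for almost all
  initial data.\<close>

lemma density_support_bound:
  fixes f0 :: "(nat \<Rightarrow> 'a::euclidean_space \<times> 'a) \<Rightarrow> real"
  assumes f: "hs_initial_density N f0"
  obtains C where "0 \<le> C"
    "\<And>Z. Z \<in> extensional {1..N} \<Longrightarrow> f0 Z \<noteq> 0 \<Longrightarrow> inertia N Z \<le> C \<and> kinetic N Z \<le> C"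
proof -
  obtain K where K: "compact K" "\<And>Z. Z \<in> extensional {1..N} - K \<Longrightarrow> f0 Z = 0"
    using f unfolding hs_initial_density_def by blast
  have c: "continuous_on K (\<lambda>Z. Z k)" for k by (rule continuous_on_product_coordinates[THEN continuous_on_subset]) simp
  have "continuous_on K (\<lambda>Z. inertia N Z + kinetic N Z)"
    unfolding inertia_def kinetic_def by (intro continuous_intros c)
  then have "bounded ((\<lambda>Z. inertia N Z + kinetic N Z) ` K)"
    using K(1) by (intro compact_imp_bounded compact_continuous_image)
  then obtain B where B: "\<And>Z. Z \<in> K \<Longrightarrow> \<bar>inertia N Z + kinetic N Z\<bar> \<le> B"
    by (auto simp: bounded_iff)
  show ?thesis
  proof (rule that[of "max 0 B"])
    fix Z :: "nat \<Rightarrow> 'a \<times> 'a" assume "Z \<in> extensional {1..N}" "f0 Z \<noteq> 0"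
    then have "Z \<in> K" using K(2) by blast
    then show "inertia N Z \<le> max 0 B \<and> kinetic N Z \<le> max 0 B"
      using B[of Z] inertia_nonneg[of N Z] kinetic_nonneg[of N Z] by auto
  qed simp
qed

lemma norm_square_measurable:
  assumes "k \<in> {1..N}"
  shows "(\<lambda>Z. (norm (fst (Z k)))\<^sup>2) \<in> borel_measurable (phase_measure N :: (nat \<Rightarrow> 'a::euclidean_space \<times> 'a) measure)"
    and "(\<lambda>Z. (norm (snd (Z k)))\<^sup>2) \<in> borel_measurable (phase_measure N :: (nat \<Rightarrow> 'a::euclidean_space \<times> 'a) measure)"
proof -
  note [measurable] = measurable_position_velocity[OF assms, where 'a = 'a]
  show "(\<lambda>Z. (norm (fst (Z k)))\<^sup>2) \<in> borel_measurable (phase_measure N :: (nat \<Rightarrow> 'a \<times> 'a) measure)"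
    "(\<lambda>Z. (norm (snd (Z k)))\<^sup>2) \<in> borel_measurable (phase_measure N :: (nat \<Rightarrow> 'a \<times> 'a) measure)"
    unfolding phase_measure_def by measurable
qed

lemma inertia_kinetic_measurable:
  "inertia N \<in> borel_measurable (phase_measure N :: (nat \<Rightarrow> 'a::euclidean_space \<times> 'a) measure)"
  "kinetic N \<in> borel_measurable (phase_measure N :: (nat \<Rightarrow> 'a::euclidean_space \<times> 'a) measure)"
  unfolding inertia_def[abs_def] kinetic_def[abs_def]
  by (intro borel_measurable_sum norm_square_measurable; simp)+

lemma sigma_finite_phase_measure: "sigma_finite_measure (phase_measure N :: (nat \<Rightarrow> 'a::euclidean_space \<times> 'a) measure)"
  unfolding phase_measure_def by (rule sigma_finite_PiM_lborel) simp

lemma density_nn_integral: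
  fixes f0 :: "(nat \<Rightarrow> 'a::euclidean_space \<times> 'a) \<Rightarrow> real"
  assumes f: "hs_initial_density N f0"
  shows "(\<integral>\<^sup>+Z. ennreal (f0 Z) \<partial>phase_measure N) = 1"
proof -
  have h: "has_bochner_integral (phase_measure N) f0 1" using f by (simp add: hs_initial_density_def)
  have "(\<integral>\<^sup>+Z. ennreal (f0 Z) \<partial>phase_measure N) = ennreal (\<integral>Z. f0 Z \<partial>phase_measure N)"
    using h density_nonneg[OF f]
    by (intro nn_integral_eq_integral) (auto intro: integrable.intros simp: space_phase_measure)
  then show ?thesis using has_bochner_integral_integral_eq[OF h] by simp
qed

lemma nn_integral_exhaust_le:
  fixes f :: "real \<Rightarrow> ennreal"
  assumes [measurable]: "f \<in> borel_measurable lborel"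
    and le: "\<And>T. 0 < T \<Longrightarrow> (\<integral>\<^sup>+t\<in>{-T..T}. f t \<partial>lborel) \<le> B"
  shows "(\<integral>\<^sup>+t. f t \<partial>lborel) \<le> B"
proof -
  have "(\<integral>\<^sup>+t. f t \<partial>lborel) = (\<integral>\<^sup>+t. (SUP m. f t * indicator {- real (Suc m)..real (Suc m)} t) \<partial>lborel)"
  proof (rule nn_integral_cong)
    fix t :: real
    obtain m :: nat where "\<bar>t\<bar> \<le> real m" using real_arch_simple by blast
    then have "f t = f t * indicator {- real (Suc m)..real (Suc m)} t" by (auto simp: indicator_def)
    then show "f t = (SUP m. f t * indicator {- real (Suc m)..real (Suc m)} t)"
      by (intro antisym SUP_upper2[of m] SUP_least) (auto simp: indicator_def)
  qed
  also have "\<dots> = (SUP m. \<integral>\<^sup>+t\<in>{- real (Suc m)..real (Suc m)}. f t \<partial>lborel)"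
    by (intro nn_integral_monotone_convergence_SUP)
       (auto simp: incseq_def le_fun_def indicator_def)
  also have "\<dots> \<le> B" by (intro SUP_least le) simp
  finally show ?thesis .
qed

context
  fixes N :: nat and \<psi> :: "real \<Rightarrow> (nat \<Rightarrow> 'a::euclidean_space \<times> 'a) \<Rightarrow> nat \<Rightarrow> 'a \<times> 'a"
    and f0 :: "(nat \<Rightarrow> 'a \<times> 'a) \<Rightarrow> real"
  assumes flow: "hard_sphere_flow N \<psi>" and f: "hs_initial_density N f0"
begin

lemma sampled_time_integral:
  assumes "regular N \<psi> Y"
  shows "(\<integral>\<^sup>+t\<in>{-T..T}. ennreal (shells d N (sampled \<psi> t Y)) \<partial>lborel) =
    (\<integral>\<^sup>+t\<in>{-T..T}. ennreal (shells d N (\<psi> t Y)) \<partial>lborel)"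
proof (rule nn_integral_cong_AE)
  have b: "billiard N (\<lambda>t. \<psi> t Y)" using assms by (simp add: regular_def)
  have "AE t in lborel. t \<notin> {t \<in> {-T..T}. touching N (\<psi> t Y)}"
    using billiardD(3)[OF b] by (intro AE_not_in finite_imp_null_set_lborel)
  then show "AE t in lborel. ennreal (shells d N (sampled \<psi> t Y)) * indicator {-T..T} t =
    ennreal (shells d N (\<psi> t Y)) * indicator {-T..T} t"
  proof eventually_elim
    case (elim t)
    show ?case
    proof (cases "t \<in> {-T..T}")
      case True
      then have "sampled \<psi> t Y k = \<psi> t Y k" if "k \<in> {1..N}" for k
        using elim assms that by (intro sampled_eq[OF flow]) auto
      then have "shells d N (sampled \<psi> t Y) = shells d N (\<psi> t Y)"
        unfolding shells_def by (intro sum.cong refl) (auto simp: pairs_def)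
      then show ?thesis by simp
    qed simp
  qed
qed

lemma flux_time_integral_le:
  assumes ij: "(i, j) \<in> pairs N"
    and L: "\<And>t. L t \<le> liminf (\<lambda>n. pair_flux N \<psi> f0 (1 / real (Suc n)) t i j)"
  shows "(\<integral>\<^sup>+t. L t \<partial>lborel) \<le> ennreal (1 / real (card (pairs N))) *
    (\<integral>\<^sup>+Y. ennreal (16 * (sqrt (inertia N Y) * sqrt (kinetic N Y))) * ennreal (f0 Y) \<partial>phase_measure N)"
proof -
  let ?P = "phase_measure N :: (nat \<Rightarrow> 'a \<times> 'a) measure"
  interpret P: sigma_finite_measure ?P by (rule sigma_finite_phase_measure)
  interpret LP: pair_sigma_finite "lborel :: real measure" ?P ..
  note [measurable] = density_measurable[OF f]
  define c where "c = card (pairs N)"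
  have c: "0 < c" using ij by (auto simp: c_def card_gt_0_iff)
  define \<rho> where "\<rho> Y = ennreal (f0 Y) * indicator (hs_domain N) Y" for Y
  have [measurable]: "\<rho> \<in> borel_measurable ?P" unfolding \<rho>_def[abs_def] by measurable
  define \<mu> where "\<mu> = density ?P \<rho>"
  define S where "S n p = ennreal (shells (1 / real (Suc n)) N (sampled \<psi> (fst p) (snd p)))" for n p
  have S [measurable]: "S n \<in> borel_measurable (lborel \<Otimes>\<^sub>M ?P)" for n
    unfolding S_def[abs_def]
    by (rule measurable_compose[OF shells_sampled_measurable[OF flow] measurable_ennreal])
  define g where "g n t = (\<integral>\<^sup>+Y. S n (t, Y) * \<rho> Y \<partial>?P)" for n t
  have g [measurable]: "g n \<in> borel_measurable lborel" for n
    unfolding g_def[abs_def] by measurable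
  have Lg: "L t \<le> ennreal (1 / real c) * liminf (\<lambda>n. g n t)" for t
  proof -
    have "of_nat c * L t \<le> of_nat c * liminf (\<lambda>n. pair_flux N \<psi> f0 (1 / real (Suc n)) t i j)"
      by (intro mult_left_mono L) simp
    also have "\<dots> \<le> liminf (\<lambda>n. of_nat c * pair_flux N \<psi> f0 (1 / real (Suc n)) t i j)"
      by (rule mult_liminf_le)
    also have "\<dots> \<le> liminf (\<lambda>n. g n t)"
      using pair_flux_total_le[OF flow f ij] unfolding g_def S_def \<rho>_def c_def fst_conv snd_conv
      by (intro Liminf_mono always_eventually allI) simp
    finally have "ennreal (1 / real c) * (ennreal (real c) * L t) \<le> ennreal (1 / real c) * liminf (\<lambda>n. g n t)"
      by (intro mult_left_mono) (simp_all add: ennreal_of_nat_eq_real_of_nat)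
    also have "ennreal (1 / real c) * (ennreal (real c) * L t) = L t"
      using c by (simp add: mult.assoc[symmetric] ennreal_mult[symmetric])
    finally show ?thesis .
  qed
  obtain C where C: "0 \<le> C"
    "\<And>Z. Z \<in> extensional {1..N} \<Longrightarrow> f0 Z \<noteq> 0 \<Longrightarrow> inertia N Z \<le> C \<and> kinetic N Z \<le> C"
    using density_support_bound[OF f] by blast
  have AE_\<mu>: "AE Y in \<mu>. Y \<in> hs_domain N \<and> regular N \<psi> Y \<and> inertia N Y \<le> C \<and> kinetic N Y \<le> C"
    unfolding \<mu>_def
  proof (subst AE_density, simp, use AE_regular[OF flow] in eventually_elim, intro impI)
    fix Y assume r: "Y \<in> hs_domain N \<longrightarrow> regular N \<psi> Y" and "0 < \<rho> Y"
    then have "Y \<in> hs_domain N" "f0 Y \<noteq> 0" by (cases "Y \<in> hs_domain N"; auto simp: \<rho>_def)+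
    then show "Y \<in> hs_domain N \<and> regular N \<psi> Y \<and> inertia N Y \<le> C \<and> kinetic N Y \<le> C"
      using r C(2)[OF hs_domain_extensional] by blast
  qed
  have window: "(\<integral>\<^sup>+t\<in>{-T..T}. liminf (\<lambda>n. g n t) \<partial>lborel) \<le>
      (\<integral>\<^sup>+Y. ennreal (16 * (sqrt (inertia N Y) * sqrt (kinetic N Y))) * ennreal (f0 Y) \<partial>?P)"
    if T: "0 < T" for T
  proof -
    define A where "A n Y = (\<integral>\<^sup>+t\<in>{-T..T}. S n (t, Y) \<partial>lborel)" for n Y
    have A [measurable]: "A n \<in> borel_measurable ?P" for n
      unfolding A_def[abs_def] by measurable
    \<comment> \<open>The bound of \<open>shells_integral_bound\<close> with energy and inertia
      replaced by their common bound on the support.\<close>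
    define W where "W = 2 * (real (N * N) * (4 * sqrt C + 4 * (sqrt C * sqrt C) + 4 * C * (2 * T + 2)))"
    have "(\<integral>\<^sup>+t\<in>{-T..T}. liminf (\<lambda>n. g n t) \<partial>lborel) \<le>
        (\<integral>\<^sup>+t. liminf (\<lambda>n. g n t * indicator {-T..T} t) \<partial>lborel)"
      by (intro nn_integral_mono) (auto simp: indicator_def)
    also have "\<dots> \<le> liminf (\<lambda>n. \<integral>\<^sup>+t\<in>{-T..T}. g n t \<partial>lborel)"
      by (rule nn_integral_liminf) measurable
    also have "(\<lambda>n. \<integral>\<^sup>+t\<in>{-T..T}. g n t \<partial>lborel) = (\<lambda>n. \<integral>\<^sup>+Y. A n Y \<partial>\<mu>)"
    proof
      fix n
      have "(\<integral>\<^sup>+t\<in>{-T..T}. g n t \<partial>lborel) =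
          (\<integral>\<^sup>+t. (\<integral>\<^sup>+Y. S n (t, Y) * indicator {-T..T} t * \<rho> Y \<partial>?P) \<partial>lborel)"
      proof (rule nn_integral_cong)
        fix t
        show "g n t * indicator {-T..T} t = (\<integral>\<^sup>+Y. S n (t, Y) * indicator {-T..T} t * \<rho> Y \<partial>?P)"
          unfolding g_def by (simp add: indicator_def)
      qed
      also have "\<dots> = (\<integral>\<^sup>+Y. (\<integral>\<^sup>+t. S n (t, Y) * indicator {-T..T} t * \<rho> Y \<partial>lborel) \<partial>?P)"
        by (rule LP.Fubini'[symmetric]) measurable
      also have "\<dots> = (\<integral>\<^sup>+Y. \<rho> Y * A n Y \<partial>?P)"
      proof (rule nn_integral_cong)
        fix Y assume [measurable]: "Y \<in> space ?P"
        show "(\<integral>\<^sup>+t. S n (t, Y) * indicator {-T..T} t * \<rho> Y \<partial>lborel) = \<rho> Y * A n Y"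
          unfolding A_def by (subst nn_integral_multc) (auto simp: mult.commute)
      qed
      also have "\<dots> = (\<integral>\<^sup>+Y. A n Y \<partial>\<mu>)"
        unfolding \<mu>_def by (simp add: nn_integral_density)
      finally show "(\<integral>\<^sup>+t\<in>{-T..T}. g n t \<partial>lborel) = (\<integral>\<^sup>+Y. A n Y \<partial>\<mu>)" .
    qed
    also have "liminf (\<lambda>n. \<integral>\<^sup>+Y. A n Y \<partial>\<mu>) \<le> limsup (\<lambda>n. \<integral>\<^sup>+Y. A n Y \<partial>\<mu>)"
      by (rule Liminf_le_Limsup) simp
    also have "\<dots> \<le> (\<integral>\<^sup>+Y. limsup (\<lambda>n. A n Y) \<partial>\<mu>)"
    proof (rule nn_integral_limsup[where w = "\<lambda>_. ennreal W"])
      show "A n \<in> borel_measurable \<mu>" for n using A by (simp add: \<mu>_def)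
      show "AE Y in \<mu>. A n Y \<le> ennreal W" for n
        using AE_\<mu>
      proof eventually_elim
        case (elim Y)
        then have b: "billiard N (\<lambda>t. \<psi> t Y)" "\<psi> 0 Y = Y" by (auto simp: regular_def)
        have nt: "\<not> touching N (\<psi> 0 Y)" using elim b(2) by (simp add: hs_domain_not_touching)
        have "A n Y = (\<integral>\<^sup>+t\<in>{-T..T}. ennreal (shells (1 / real (Suc n)) N (\<psi> t Y)) \<partial>lborel)"
          unfolding A_def S_def fst_conv snd_conv using elim by (intro sampled_time_integral) auto
        also have "\<dots> \<le> ennreal (2 * (real (N * N) * (4 * sqrt (kinetic N Y)
          + 4 * (sqrt (inertia N Y) * sqrt (kinetic N Y)) + 4 * kinetic N Y * (2 * T + 2))))"
          using shells_integral_bound[OF b(1) nt _ T, of "1 / real (Suc n)"] b(2) by simp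
        also have "\<dots> \<le> ennreal W"
          unfolding W_def using elim T C(1) kinetic_nonneg[of N Y] inertia_nonneg[of N Y]
          by (intro ennreal_leI mult_left_mono add_mono mult_mono real_sqrt_le_mono) auto
        finally show ?case .
      qed
      have "(\<integral>\<^sup>+Y. ennreal W \<partial>\<mu>) = (\<integral>\<^sup>+Y. \<rho> Y * ennreal W \<partial>?P)"
        unfolding \<mu>_def by (rule nn_integral_density) measurable
      also have "\<dots> \<le> (\<integral>\<^sup>+Y. ennreal (f0 Y) * ennreal W \<partial>?P)"
        unfolding \<rho>_def by (intro nn_integral_mono) (auto simp: indicator_def)
      also have "\<dots> = ennreal W" using density_nn_integral[OF f] by (simp add: nn_integral_multc)
      finally show "(\<integral>\<^sup>+Y. ennreal W \<partial>\<mu>) < \<infinity>" by (simp add: le_less_trans)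
    qed simp
    also have "\<dots> \<le> (\<integral>\<^sup>+Y. ennreal (16 * (sqrt (inertia N Y) * sqrt (kinetic N Y))) \<partial>\<mu>)"
    proof (rule nn_integral_mono_AE, use AE_\<mu> in eventually_elim)
      case (elim Y)
      then have b: "billiard N (\<lambda>t. \<psi> t Y)" "\<psi> 0 Y = Y" by (auto simp: regular_def)
      have nt: "\<not> touching N (\<psi> 0 Y)" using elim b(2) by (simp add: hs_domain_not_touching)
      have "(\<lambda>n. A n Y) = (\<lambda>n. \<integral>\<^sup>+t\<in>{-T..T}. ennreal (shells (1 / real (Suc n)) N (\<psi> t Y)) \<partial>lborel)"
        unfolding A_def S_def fst_conv snd_conv using elim by (intro ext sampled_time_integral) auto
      then show "limsup (\<lambda>n. A n Y) \<le> ennreal (16 * (sqrt (inertia N Y) * sqrt (kinetic N Y)))"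
        using shells_integral_limsup[OF b(1) nt T] b(2) by simp
    qed
    also have "\<dots> = (\<integral>\<^sup>+Y. \<rho> Y * ennreal (16 * (sqrt (inertia N Y) * sqrt (kinetic N Y))) \<partial>?P)"
    proof -
      note [measurable] = inertia_kinetic_measurable[of N]
      show ?thesis unfolding \<mu>_def by (rule nn_integral_density) measurable
    qed
    also have "\<dots> \<le> (\<integral>\<^sup>+Y. ennreal (16 * (sqrt (inertia N Y) * sqrt (kinetic N Y))) * ennreal (f0 Y) \<partial>?P)"
      unfolding \<rho>_def by (intro nn_integral_mono) (auto simp: indicator_def mult.commute)
    finally show ?thesis .
  qed
  have m: "(\<lambda>t. liminf (\<lambda>n. g n t)) \<in> borel_measurable lborel" by measurable
  have "(\<integral>\<^sup>+t. L t \<partial>lborel) \<le> (\<integral>\<^sup>+t. ennreal (1 / real c) * liminf (\<lambda>n. g n t) \<partial>lborel)"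
    by (intro nn_integral_mono Lg)
  also have "\<dots> = ennreal (1 / real c) * (\<integral>\<^sup>+t. liminf (\<lambda>n. g n t) \<partial>lborel)"
    by (rule nn_integral_cmult[OF m])
  also have "\<dots> \<le> ennreal (1 / real c) *
      (\<integral>\<^sup>+Y. ennreal (16 * (sqrt (inertia N Y) * sqrt (kinetic N Y))) * ennreal (f0 Y) \<partial>?P)"
    by (rule mult_left_mono[OF nn_integral_exhaust_le[OF m window]]) simp_all
  finally show ?thesis unfolding c_def .
qed

end

section \<open>Moments of the initial density and the Cauchy-Schwarz inequality\<close>

lemma density_moment:
  fixes f0 :: "(nat \<Rightarrow> 'a::euclidean_space \<times> 'a) \<Rightarrow> real" and q :: "'a \<times> 'a \<Rightarrow> real"
  assumes f: "hs_initial_density N f0" and q [measurable]: "q \<in> borel_measurable borel"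
    and q0: "\<And>z. 0 \<le> q z" and k: "k \<in> {1..N}"
    and bnd: "\<And>Z. Z \<in> extensional {1..N} \<Longrightarrow> f0 Z \<noteq> 0 \<Longrightarrow> q (Z 1) \<le> C"
  shows "(\<integral>\<^sup>+Z. ennreal (q (Z k)) * ennreal (f0 Z) \<partial>phase_measure N) =
      ennreal (\<integral>Z. q (Z 1) * marginal N 1 f0 Z \<partial>phase_measure 1)"
    and "0 \<le> (\<integral>Z. q (Z 1) * marginal N 1 f0 Z \<partial>phase_measure 1)"
proof -
  let ?P = "phase_measure N :: (nat \<Rightarrow> 'a \<times> 'a) measure"
  interpret A: product_sigma_finite "\<lambda>_::nat. lborel :: ('a \<times> 'a) measure" by (rule product_sigma_finite_lborel)
  have N: "1 \<in> {1..N}" using k by auto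
  have un: "{1..1} \<union> {1 + 1..N} = {1..N}" using k by auto
  note [measurable] = density_measurable[OF f]
  have comp: "(\<lambda>Z. q (Z l)) \<in> borel_measurable ?P" if "l \<in> {1..N}" for l
    unfolding phase_measure_def
    by (rule measurable_compose[OF measurable_component_singleton[OF that]]) simp
  note [measurable] = comp[OF N] comp[OF k]
  \<comment> \<open>Symmetry replaces particle \<open>k\<close> by particle 1, whose law is the
    first marginal.\<close>
  define \<sigma> where "\<sigma> = Transposition.transpose 1 k"
  have \<sigma>: "\<sigma> permutes {1..N}" unfolding \<sigma>_def using N k by (intro permutes_swap_id)
  have "(\<integral>\<^sup>+Z. ennreal (q (Z k)) * ennreal (f0 Z) \<partial>?P) = (\<integral>\<^sup>+Z. ennreal (q ((Z \<circ> \<sigma>) k)) * ennreal (f0 (Z \<circ> \<sigma>)) \<partial>?P)"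
    by (rule nn_integral_permute[OF \<sigma>, symmetric]) measurable
  also have "\<dots> = (\<integral>\<^sup>+Z. ennreal (q (Z 1) * f0 Z) \<partial>?P)"
  proof (rule nn_integral_cong)
    fix Z assume "Z \<in> space ?P"
    then have Z: "Z \<in> extensional {1..N}" by (simp add: space_phase_measure)
    then have "f0 (Z \<circ> \<sigma>) = f0 Z" using f \<sigma> unfolding hs_initial_density_def by blast
    then show "ennreal (q ((Z \<circ> \<sigma>) k)) * ennreal (f0 (Z \<circ> \<sigma>)) = ennreal (q (Z 1) * f0 Z)"
      using q0 by (simp add: \<sigma>_def ennreal_mult')
  qed
  \<comment> \<open>Boundedness of \<open>q\<close> on the support makes the moment integrable. So
    the nonnegative integral equals the Bochner integral of the statement, and Fubini's theorem
    produces the marginal.\<close>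
  also have int: "integrable ?P (\<lambda>Z. q (Z 1) * f0 Z)"
  proof (rule Bochner_Integration.integrable_bound)
    show "integrable ?P (\<lambda>Z. \<bar>C\<bar> * f0 Z)"
      using f by (intro integrable_mult_right) (auto simp: hs_initial_density_def intro: integrable.intros)
    show "AE Z in ?P. norm (q (Z 1) * f0 Z) \<le> norm (\<bar>C\<bar> * f0 Z)"
    proof (rule AE_I2)
      fix Z assume "Z \<in> space ?P"
      then have Z: "Z \<in> extensional {1..N}" by (simp add: space_phase_measure)
      show "norm (q (Z 1) * f0 Z) \<le> norm (\<bar>C\<bar> * f0 Z)"
        using bnd[OF Z] q0[of "Z 1"] by (cases "f0 Z = 0") (auto simp: abs_mult mult_right_mono)
    qed
  qed measurable
  then have "(\<integral>\<^sup>+Z. ennreal (q (Z 1) * f0 Z) \<partial>?P) = ennreal (\<integral>Z. q (Z 1) * f0 Z \<partial>?P)"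
    using density_nonneg[OF f] q0
    by (intro nn_integral_eq_integral AE_I2 mult_nonneg_nonneg q0) (simp_all add: space_phase_measure)
  also have eq: "(\<integral>Z. q (Z 1) * f0 Z \<partial>?P) = (\<integral>Z. q (Z 1) * marginal N 1 f0 Z \<partial>phase_measure 1)"
  proof -
    have int': "integrable (\<Pi>\<^sub>M k\<in>{1..1} \<union> {1+1..N}. lborel) (\<lambda>Z. q (Z 1) * f0 Z)"
      using int unfolding un phase_measure_def .
    have "(\<integral>Z. q (Z 1) * f0 Z \<partial>?P) = (\<integral>Z. (\<integral>Y. q (merge {1..1} {1+1..N} (Z, Y) 1) *
        f0 (merge {1..1} {1+1..N} (Z, Y)) \<partial>(\<Pi>\<^sub>M k\<in>{1+1..N}. lborel)) \<partial>(\<Pi>\<^sub>M k\<in>{1..1}. lborel))"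
      unfolding phase_measure_def un[symmetric]
      by (rule A.product_integral_fold[OF _ _ _ int']) auto
    also have "\<dots> = (\<integral>Z. q (Z 1) * marginal N 1 f0 Z \<partial>phase_measure 1)"
      unfolding marginal_def phase_measure_def by (simp add: merge_def)
    finally show ?thesis .
  qed
  finally show "(\<integral>\<^sup>+Z. ennreal (q (Z k)) * ennreal (f0 Z) \<partial>?P) =
      ennreal (\<integral>Z. q (Z 1) * marginal N 1 f0 Z \<partial>phase_measure 1)" .
  have "0 \<le> (\<integral>Z. q (Z 1) * f0 Z \<partial>?P)"
    using density_nonneg[OF f]
    by (intro integral_nonneg_AE AE_I2 mult_nonneg_nonneg q0) (simp_all add: space_phase_measure)
  then show "0 \<le> (\<integral>Z. q (Z 1) * marginal N 1 f0 Z \<partial>phase_measure 1)" unfolding eq .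
qed

text \<open>For positive \<open>a\<close> and \<open>b\<close> the weighted mean is smallest at
  \<open>\<kappa> = sqrt b / sqrt a\<close>, where it is the geometric mean. Adding
  \<open>e n\<close> to both keeps this choice available when one of them is 0.\<close>

lemma le_sqrt_mult_of_le_weighted_mean:
  fixes x :: ennreal
  assumes "0 \<le> a" "0 \<le> b" and le: "\<And>\<kappa>. 0 < \<kappa> \<Longrightarrow> x \<le> ennreal ((\<kappa> * a + b / \<kappa>) / 2)"
  shows "x \<le> ennreal (sqrt a * sqrt b)"
proof -
  define e where "e n = 1 / real (Suc n)" for n
  have e: "0 < e n" for n by (simp add: e_def)
  have elim: "e \<longlonglongrightarrow> 0" unfolding e_def[abs_def] using LIMSEQ_inverse_real_of_nat
    by (simp add: inverse_eq_divide)
  have "x \<le> ennreal (sqrt (a + e n) * sqrt (b + e n))" for n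
  proof -
    define \<alpha> where "\<alpha> = sqrt (a + e n)"
    define \<beta> where "\<beta> = sqrt (b + e n)"
    have pos: "0 < \<alpha>" "0 < \<beta>" using e[of n] assms(1,2) by (simp_all add: \<alpha>_def \<beta>_def)
    have "x \<le> ennreal ((\<beta> / \<alpha> * a + b / (\<beta> / \<alpha>)) / 2)" using pos by (intro le) simp
    also have "\<dots> \<le> ennreal ((\<beta> / \<alpha> * \<alpha>\<^sup>2 + \<beta>\<^sup>2 / (\<beta> / \<alpha>)) / 2)"
      using pos e[of n] assms(1,2)
      by (intro ennreal_leI divide_right_mono add_mono mult_left_mono) (auto simp: \<alpha>_def \<beta>_def)
    also have "(\<beta> / \<alpha> * \<alpha>\<^sup>2 + \<beta>\<^sup>2 / (\<beta> / \<alpha>)) / 2 = \<alpha> * \<beta>"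
      using pos by (simp add: field_simps power2_eq_square)
    finally show ?thesis by (simp add: \<alpha>_def \<beta>_def)
  qed
  moreover have "(\<lambda>n. ennreal (sqrt (a + e n) * sqrt (b + e n))) \<longlonglongrightarrow> ennreal (sqrt (a + 0) * sqrt (b + 0))"
    by (intro tendsto_intros elim)
  ultimately show ?thesis by (intro LIMSEQ_le_const) auto
qed

text \<open>Cauchy-Schwarz under the density, obtained from Young's inequality with a free weight
  \<open>\<kappa>\<close>, so that only means of \<open>inertia\<close> and \<open>kinetic\<close>
  occur. By symmetry these are \<open>real N * a\<close> and \<open>real N * b\<close>.\<close>

lemma virial_moment_le:
  fixes f0 :: "(nat \<Rightarrow> 'a::euclidean_space \<times> 'a) \<Rightarrow> real"
  assumes f: "hs_initial_density N f0" and N: "1 \<le> N"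
  defines "a \<equiv> (\<integral>Z. (norm (fst (Z 1)))\<^sup>2 * marginal N 1 f0 Z \<partial>phase_measure 1)"
    and "b \<equiv> (\<integral>Z. (norm (snd (Z 1)))\<^sup>2 * marginal N 1 f0 Z \<partial>phase_measure 1)"
  shows "(\<integral>\<^sup>+Y. ennreal (16 * (sqrt (inertia N Y) * sqrt (kinetic N Y))) * ennreal (f0 Y) \<partial>phase_measure N)
      \<le> ennreal (16 * real N * (sqrt a * sqrt b))"
    and "0 \<le> a" and "0 \<le> b"
proof -
  let ?P = "phase_measure N :: (nat \<Rightarrow> 'a \<times> 'a) measure"
  note fm [measurable] = density_measurable[OF f]
  obtain C where C: "0 \<le> C"
    "\<And>Z. Z \<in> extensional {1..N} \<Longrightarrow> f0 Z \<noteq> 0 \<Longrightarrow> inertia N Z \<le> C \<and> kinetic N Z \<le> C"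
    using density_support_bound[OF f] by blast
  have m1: "(\<lambda>z. (norm (fst z))\<^sup>2) \<in> borel_measurable (borel :: ('a \<times> 'a) measure)"
    and m2: "(\<lambda>z. (norm (snd z))\<^sup>2) \<in> borel_measurable (borel :: ('a \<times> 'a) measure)"
    by (intro borel_measurable_continuous_onI continuous_intros)+
  have one: "1 \<in> {1..N}" using N by simp
  have bnd1: "(norm (fst (Z 1)))\<^sup>2 \<le> C" and bnd2: "(norm (snd (Z 1)))\<^sup>2 \<le> C"
    if "Z \<in> extensional {1..N}" "f0 Z \<noteq> 0" for Z
    using C(2)[OF that] member_le_sum[OF one, of "\<lambda>k. (norm (fst (Z k)))\<^sup>2"]
      member_le_sum[OF one, of "\<lambda>k. (norm (snd (Z k)))\<^sup>2"]
    by (auto simp: inertia_def kinetic_def)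
  have mom1: "(\<integral>\<^sup>+Z. ennreal ((norm (fst (Z k)))\<^sup>2) * ennreal (f0 Z) \<partial>?P) = ennreal a"
    and mom2: "(\<integral>\<^sup>+Z. ennreal ((norm (snd (Z k)))\<^sup>2) * ennreal (f0 Z) \<partial>?P) = ennreal b"
    if k: "k \<in> {1..N}" for k
    unfolding a_def b_def
    using zero_le_power2 bnd1 bnd2 density_moment(1)[of N f0 "\<lambda>z. (norm (fst z))\<^sup>2" k C]
      density_moment(1)[of N f0 "\<lambda>z. (norm (snd z))\<^sup>2" k C] f m1 m2 k by blast+
  have ab: "0 \<le> a" "0 \<le> b"
    unfolding a_def b_def
    using zero_le_power2 bnd1 bnd2 density_moment(2)[of N f0 "\<lambda>z. (norm (fst z))\<^sup>2" 1 C]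
      density_moment(2)[of N f0 "\<lambda>z. (norm (snd z))\<^sup>2" 1 C] f m1 m2 one by blast+
  note comp = norm_square_measurable
  have I: "(\<integral>\<^sup>+Y. ennreal (inertia N Y) * ennreal (f0 Y) \<partial>?P) = ennreal (real N * a)"
  proof -
    have "(\<integral>\<^sup>+Y. ennreal (inertia N Y) * ennreal (f0 Y) \<partial>?P) =
        (\<integral>\<^sup>+Y. (\<Sum>k\<in>{1..N}. ennreal ((norm (fst (Y k)))\<^sup>2) * ennreal (f0 Y)) \<partial>?P)"
    proof (rule nn_integral_cong)
      fix Y :: "nat \<Rightarrow> 'a \<times> 'a"
      have "ennreal (inertia N Y) = (\<Sum>k\<in>{1..N}. ennreal ((norm (fst (Y k)))\<^sup>2))"
        unfolding inertia_def by (rule sum_ennreal[symmetric]) simp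
      then show "ennreal (inertia N Y) * ennreal (f0 Y) =
          (\<Sum>k\<in>{1..N}. ennreal ((norm (fst (Y k)))\<^sup>2) * ennreal (f0 Y))"
        by (simp only: sum_distrib_right)
    qed
    also have "\<dots> = (\<Sum>k\<in>{1..N}. (\<integral>\<^sup>+Y. ennreal ((norm (fst (Y k)))\<^sup>2) * ennreal (f0 Y) \<partial>?P))"
      using comp fm by (intro nn_integral_sum borel_measurable_times_ennreal measurable_compose[OF _ measurable_ennreal])
    also have "\<dots> = (\<Sum>k\<in>{1..N}. ennreal a)" by (intro sum.cong refl mom1)
    finally show ?thesis using ab by (simp add: ennreal_mult' ennreal_of_nat_eq_real_of_nat)
  qed
  have K: "(\<integral>\<^sup>+Y. ennreal (kinetic N Y) * ennreal (f0 Y) \<partial>?P) = ennreal (real N * b)"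
  proof -
    have "(\<integral>\<^sup>+Y. ennreal (kinetic N Y) * ennreal (f0 Y) \<partial>?P) =
        (\<integral>\<^sup>+Y. (\<Sum>k\<in>{1..N}. ennreal ((norm (snd (Y k)))\<^sup>2) * ennreal (f0 Y)) \<partial>?P)"
    proof (rule nn_integral_cong)
      fix Y :: "nat \<Rightarrow> 'a \<times> 'a"
      have "ennreal (kinetic N Y) = (\<Sum>k\<in>{1..N}. ennreal ((norm (snd (Y k)))\<^sup>2))"
        unfolding kinetic_def by (rule sum_ennreal[symmetric]) simp
      then show "ennreal (kinetic N Y) * ennreal (f0 Y) =
          (\<Sum>k\<in>{1..N}. ennreal ((norm (snd (Y k)))\<^sup>2) * ennreal (f0 Y))"
        by (simp only: sum_distrib_right)
    qed
    also have "\<dots> = (\<Sum>k\<in>{1..N}. (\<integral>\<^sup>+Y. ennreal ((norm (snd (Y k)))\<^sup>2) * ennreal (f0 Y) \<partial>?P))"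
      using comp fm by (intro nn_integral_sum borel_measurable_times_ennreal measurable_compose[OF _ measurable_ennreal])
    also have "\<dots> = (\<Sum>k\<in>{1..N}. ennreal b)" by (intro sum.cong refl mom2)
    finally show ?thesis using ab by (simp add: ennreal_mult' ennreal_of_nat_eq_real_of_nat)
  qed
  note [measurable] = inertia_kinetic_measurable[of N]
  have "(\<integral>\<^sup>+Y. ennreal (16 * (sqrt (inertia N Y) * sqrt (kinetic N Y))) * ennreal (f0 Y) \<partial>?P)
      \<le> ennreal (sqrt (16 * real N * a) * sqrt (16 * real N * b))"
  proof (rule le_sqrt_mult_of_le_weighted_mean)
    fix \<kappa> :: real assume \<kappa>: "0 < \<kappa>"
    have "(\<integral>\<^sup>+Y. ennreal (16 * (sqrt (inertia N Y) * sqrt (kinetic N Y))) * ennreal (f0 Y) \<partial>?P) \<le>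
        (\<integral>\<^sup>+Y. ennreal (8 * \<kappa>) * (ennreal (inertia N Y) * ennreal (f0 Y)) +
          ennreal (8 / \<kappa>) * (ennreal (kinetic N Y) * ennreal (f0 Y)) \<partial>?P)"
    proof (rule nn_integral_mono)
      fix Y :: "nat \<Rightarrow> 'a \<times> 'a"
      define u where "u = sqrt (inertia N Y)"
      define v where "v = sqrt (kinetic N Y)"
      have uv: "inertia N Y = u\<^sup>2" "kinetic N Y = v\<^sup>2"
        by (simp_all add: u_def v_def inertia_nonneg kinetic_nonneg)
      have "0 \<le> (\<kappa> * u - v)\<^sup>2 / \<kappa>" using \<kappa> by simp
      also have "(\<kappa> * u - v)\<^sup>2 / \<kappa> = \<kappa> * u\<^sup>2 + v\<^sup>2 / \<kappa> - 2 * (u * v)"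
        using \<kappa> by (simp add: field_simps power2_eq_square)
      finally have "16 * (u * v) \<le> 8 * \<kappa> * u\<^sup>2 + 8 / \<kappa> * v\<^sup>2" by simp
      then have "ennreal (16 * (u * v)) \<le> ennreal (8 * \<kappa>) * ennreal (u\<^sup>2) + ennreal (8 / \<kappa>) * ennreal (v\<^sup>2)"
        using \<kappa> by (simp add: ennreal_mult'[symmetric] ennreal_plus[symmetric] ennreal_leI del: ennreal_plus)
      then have "ennreal (16 * (u * v)) * ennreal (f0 Y) \<le>
         (ennreal (8 * \<kappa>) * ennreal (u\<^sup>2) + ennreal (8 / \<kappa>) * ennreal (v\<^sup>2)) * ennreal (f0 Y)"
        by (rule mult_right_mono) simp
      then show "ennreal (16 * (sqrt (inertia N Y) * sqrt (kinetic N Y))) * ennreal (f0 Y) \<le>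
         ennreal (8 * \<kappa>) * (ennreal (inertia N Y) * ennreal (f0 Y)) +
          ennreal (8 / \<kappa>) * (ennreal (kinetic N Y) * ennreal (f0 Y))"
        unfolding u_def[symmetric] v_def[symmetric] unfolding uv by (simp add: distrib_right mult.assoc)
    qed
    also have "\<dots> = ennreal (8 * \<kappa>) * ennreal (real N * a) + ennreal (8 / \<kappa>) * ennreal (real N * b)"
      using I K by (simp add: nn_integral_add nn_integral_cmult)
    also have "\<dots> = ennreal ((\<kappa> * (16 * real N * a) + (16 * real N * b) / \<kappa>) / 2)"
      using \<kappa> ab by (simp add: ennreal_mult'[symmetric] ennreal_plus[symmetric] del: ennreal_plus)
    finally show "(\<integral>\<^sup>+Y. ennreal (16 * (sqrt (inertia N Y) * sqrt (kinetic N Y))) * ennreal (f0 Y) \<partial>?P)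
      \<le> ennreal ((\<kappa> * (16 * real N * a) + (16 * real N * b) / \<kappa>) / 2)" .
  qed (use ab in simp_all)
  also have "sqrt (16 * real N * a) * sqrt (16 * real N * b) = 16 * real N * (sqrt a * sqrt b)"
    using real_sqrt_mult_self[of "16 * real N"] by (simp add: real_sqrt_mult)
  finally show "(\<integral>\<^sup>+Y. ennreal (16 * (sqrt (inertia N Y) * sqrt (kinetic N Y))) * ennreal (f0 Y) \<partial>?P)
      \<le> ennreal (16 * real N * (sqrt a * sqrt b))" .
  show "0 \<le> a" "0 \<le> b" by (rule ab)+
qed

theorem proposition4p1:
  shows "\<exists>C::real. \<forall>(N::nat)
      (\<psi> :: real \<Rightarrow> (nat \<Rightarrow> 'a::euclidean_space \<times> 'a) \<Rightarrow> nat \<Rightarrow> 'a \<times> 'a)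
      (f0 :: (nat \<Rightarrow> 'a \<times> 'a) \<Rightarrow> real).
    hard_sphere_flow N \<psi> \<longrightarrow> hs_initial_density N f0 \<longrightarrow>
    (\<forall>s. 2 \<le> s \<and> s \<le> N \<longrightarrow>
      (\<Sum>(i, j)\<in>{(i, j). 1 \<le> i \<and> i < j \<and> j \<le> s}.
         \<integral>\<^sup>+t. (\<integral>\<^sup>+(V, X, \<omega>).
             ennreal (\<bar>\<omega> \<bullet> (V j - V i)\<bar>\<^sup>2 *
               boundary_trace (marginal N s (evolve N \<psi> f0 t)) s i j X V \<omega>)
           \<partial>((\<Pi>\<^sub>M k\<in>{1..s}. lborel) \<Otimes>\<^sub>M (\<Pi>\<^sub>M k\<in>{1..s} - {j}. lborel) \<Otimes>\<^sub>M sphere_measure)) \<partial>lborel)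
      \<le> ennreal (C * (real s * (real s - 1) / real N) *
          sqrt (LINT Z|phase_measure 1. (norm (fst (Z 1)))\<^sup>2 * marginal N 1 f0 Z) *
          sqrt (LINT Z|phase_measure 1. (norm (snd (Z 1)))\<^sup>2 * marginal N 1 f0 Z)))"
proof (intro exI[of _ 32] allI impI, elim conjE)
  fix N s :: nat and \<psi> :: "real \<Rightarrow> (nat \<Rightarrow> 'a \<times> 'a) \<Rightarrow> nat \<Rightarrow> 'a \<times> 'a"
    and f0 :: "(nat \<Rightarrow> 'a \<times> 'a) \<Rightarrow> real"
  assume flow: "hard_sphere_flow N \<psi>" and f: "hs_initial_density N f0" and s: "2 \<le> s" "s \<le> N"
  define L where "L i j t = (\<integral>\<^sup>+(V, X, \<omega>).
             ennreal (\<bar>\<omega> \<bullet> (V j - V i)\<bar>\<^sup>2 *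
               boundary_trace (marginal N s (evolve N \<psi> f0 t)) s i j X V \<omega>)
           \<partial>((\<Pi>\<^sub>M k\<in>{1..s}. lborel) \<Otimes>\<^sub>M (\<Pi>\<^sub>M k\<in>{1..s} - {j}. lborel) \<Otimes>\<^sub>M sphere_measure))" for i j t
  define r where "r = sqrt (LINT Z|phase_measure 1. (norm (fst (Z 1)))\<^sup>2 * marginal N 1 f0 Z) *
          sqrt (LINT Z|phase_measure 1. (norm (snd (Z 1)))\<^sup>2 * marginal N 1 f0 Z)"
  define S where "S = {(i, j). 1 \<le> i \<and> i < j \<and> j \<le> s}"
  have N: "1 \<le> N" "2 \<le> real N" using s by simp_all
  have r0: "0 \<le> r"
    unfolding r_def using virial_moment_le(2,3)[OF f N(1)] by (intro mult_nonneg_nonneg real_sqrt_ge_zero)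
  have single: "(\<integral>\<^sup>+t. L i j t \<partial>lborel) \<le> ennreal (32 / real N * r)" if ij: "(i, j) \<in> S" for i j
  proof -
    have ij': "i \<in> {1..s}" "j \<in> {1..s}" "i \<noteq> j" "(i, j) \<in> pairs N"
      using ij s by (auto simp: S_def pairs_def)
    have "L i j t \<le> liminf (\<lambda>n. pair_flux N \<psi> f0 (1 / real (Suc n)) t i j)" for t
    proof -
      have "L i j t \<le> liminf (\<lambda>n. \<integral>\<^sup>+Z. ennreal (shell (1 / real (Suc n)) (fst (Z j) - fst (Z i)) (snd (Z j) - snd (Z i)))
          * ennreal (evolve N \<psi> f0 t Z) \<partial>phase_measure N)"
        unfolding L_def
        by (rule trace_integral_le[OF evolve_measurable[OF flow f] evolve_nonneg[OF flow f] s(2) ij'(1-3)])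
      also have "\<dots> \<le> liminf (\<lambda>n. pair_flux N \<psi> f0 (1 / real (Suc n)) t i j)"
        unfolding pair_flux_def
      proof (intro Liminf_mono always_eventually allI evolve_integral_le[OF flow f])
        fix n
        show "(\<lambda>Z. ennreal (shell (1 / real (Suc n)) (fst (Z j) - fst (Z i)) (snd (Z j) - snd (Z i)))) \<in>
            borel_measurable (phase_measure N :: (nat \<Rightarrow> 'a \<times> 'a) measure)"
          unfolding phase_measure_def using ij'(4)
          by (intro measurable_compose[OF measurable_pair_shell measurable_ennreal]) (auto simp: pairs_def)
      qed
      finally show ?thesis .
    qed
    then have "(\<integral>\<^sup>+t. L i j t \<partial>lborel) \<le> ennreal (1 / real (card (pairs N))) *
      (\<integral>\<^sup>+Y. ennreal (16 * (sqrt (inertia N Y) * sqrt (kinetic N Y))) * ennreal (f0 Y) \<partial>phase_measure N)"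
      by (rule flux_time_integral_le[OF flow f ij'(4)])
    also have "\<dots> \<le> ennreal (1 / real (card (pairs N))) * ennreal (16 * real N * r)"
      unfolding r_def by (intro mult_left_mono virial_moment_le(1)[OF f N(1)]) simp
    also have "\<dots> = ennreal (16 / (real N - 1) * r)"
      using N by (simp add: ennreal_mult'[symmetric] card_pairs_real)
    also have "\<dots> \<le> ennreal (32 / real N * r)"
    proof (intro ennreal_leI mult_right_mono)
      \<comment> \<open>As \<open>N\<close> is at least 2, \<open>N\<close> is at most
        \<open>2 * (N - 1)\<close>; this doubling turns 16 into the final constant 32.\<close>
      show "16 / (real N - 1) \<le> 32 / real N" using N by (simp add: field_simps)
    qed (rule r0)
    finally show ?thesis .
  qed
  have "(\<Sum>(i, j)\<in>S. \<integral>\<^sup>+t. L i j t \<partial>lborel) \<le> (\<Sum>(i, j)\<in>S. ennreal (32 / real N * r))"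
    using single by (intro sum_mono) auto
  also have "\<dots> = ennreal (real (card S) * (32 / real N * r))"
    using r0 by (simp add: case_prod_beta ennreal_of_nat_eq_real_of_nat ennreal_mult[symmetric])
  also have "\<dots> \<le> ennreal (32 * (real s * (real s - 1) / real N) * r)"
  proof (rule ennreal_leI)
    \<comment> \<open>Passing to ordered pairs loses a factor 2 and gives the form
      \<open>s * (s - 1)\<close> of the claim.\<close>
    have "card S \<le> card (pairs s)" by (rule card_mono[OF finite_pairs]) (auto simp: S_def pairs_def)
    then have "real (card S) \<le> real s * (real s - 1)" using card_pairs_real[of s] s by simp
    then have "real (card S) * (32 / real N * r) \<le> (real s * (real s - 1)) * (32 / real N * r)"
      using r0 by (intro mult_right_mono) auto
    then show "real (card S) * (32 / real N * r) \<le> 32 * (real s * (real s - 1) / real N) * r"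
      by (simp add: field_simps)
  qed
  finally show "(\<Sum>(i, j)\<in>{(i, j). 1 \<le> i \<and> i < j \<and> j \<le> s}.
         \<integral>\<^sup>+t. (\<integral>\<^sup>+(V, X, \<omega>).
             ennreal (\<bar>\<omega> \<bullet> (V j - V i)\<bar>\<^sup>2 *
               boundary_trace (marginal N s (evolve N \<psi> f0 t)) s i j X V \<omega>)
           \<partial>((\<Pi>\<^sub>M k\<in>{1..s}. lborel) \<Otimes>\<^sub>M (\<Pi>\<^sub>M k\<in>{1..s} - {j}. lborel) \<Otimes>\<^sub>M sphere_measure)) \<partial>lborel)
      \<le> ennreal (32 * (real s * (real s - 1) / real N) *
          sqrt (LINT Z|phase_measure 1. (norm (fst (Z 1)))\<^sup>2 * marginal N 1 f0 Z) *
          sqrt (LINT Z|phase_measure 1. (norm (snd (Z 1)))\<^sup>2 * marginal N 1 f0 Z))"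
    unfolding L_def S_def r_def by (simp only: mult.assoc)
qed

end
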